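(* Let $X$ be a separable infinite-dimensional Fréchet algebra over $\mathbb{K}\in\{\mathbb{R},\mathbb{C}\}$. Then there exist a continuous linear operator $T:X\to X$ and a dense subalgebra $\mathcal{A}\subset X$ of algebraic dimension $\aleph_0$ such that $T(\mathcal{A})\subset\mathcal{A}$ and $\mathcal{A}$ is a hypercyclic algebra for $T$, i.e. every nonzero element of $\mathcal{A}$ is a hypercyclic vector for $T$.
   Context: All vector spaces are over $\mathbb{K}\in\{\mathbb{R},\mathbb{C}\}$ and Hausdorff; all dimensions are algebraic (Hamel) dimensions. A Fréchet space is a locally convex, complete metrizable topological vector space (equivalently, its topology is defined by a separating increasing sequence of seminorms for which it is complete). A Fréchet algebra is a Fréchet space equipped with a bilinear associative multiplication $X\times X\to X$ that is continuous for the product topology; it need not be commutative or unital. A subalgebra is a linear subspace closed under multiplication; it is not required to contain a unit. For a continuous linear operator $T:X\to X$ and $x\in X$, the orbit is $\mathrm{Orb}(x,T)=\{T^n x: n\ge 0\}$; $x$ is a hypercyclic vector for $T$ if $\mathrm{Orb}(x,T)$ is dense in $X$, and $HC(T)$ is the set of hypercyclic vectors. A nonzero subalgebra $\mathcal{A}\subset X$ is a hypercyclic algebra for $T$ if $\mathcal{A}\setminus\{0\}\subset HC(T)$. *)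

theory Defs
  imports "HOL-Analysis.Analysis"
begin

text \<open>
  The scalar field enters only through \<open>smul\<close>; the definitions are stated over an arbitrary
  real normed field and are meant to be used for the types real and complex.
\<close>

definition seminorm :: "('k::real_normed_field \<Rightarrow> 'a::ab_group_add \<Rightarrow> 'a) \<Rightarrow> ('a \<Rightarrow> real) \<Rightarrow> bool" where
  "seminorm smul q \<longleftrightarrow>
     (\<forall>x y. q (x + y) \<le> q x + q y) \<and> (\<forall>c x. q (smul c x) = norm c * q x)"

text \<open>
  The topology is that of the type class. Since the sequence is increasing, the sets
  \<open>{y. p n (y - x) < e}\<close> form a neighbourhood base at \<open>x\<close>, not merely a subbase.
\<close>

definition frechet_seminorms ::
  "('k::real_normed_field \<Rightarrow> 'a::{ab_group_add,t2_space} \<Rightarrow> 'a) \<Rightarrow> (nat \<Rightarrow> 'a \<Rightarrow> real) \<Rightarrow> bool" where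
  "frechet_seminorms smul p \<longleftrightarrow>
     (\<forall>n. seminorm smul (p n)) \<and>
     (\<forall>n x. p n x \<le> p (Suc n) x) \<and>
     (\<forall>x. (\<forall>n. p n x = 0) \<longrightarrow> x = 0) \<and>
     (\<forall>U. open U \<longleftrightarrow> (\<forall>x\<in>U. \<exists>n. \<exists>e>0. {y. p n (y - x) < e} \<subseteq> U)) \<and>
     (\<forall>s::nat \<Rightarrow> 'a.
        (\<forall>n. \<forall>e>0. \<exists>N. \<forall>i\<ge>N. \<forall>j\<ge>N. p n (s i - s j) < e) \<longrightarrow> (\<exists>l. s \<longlonglongrightarrow> l))"

locale frechet_space = vector_space smul
  for smul :: "'k::real_normed_field \<Rightarrow> 'a::{ab_group_add,t2_space} \<Rightarrow> 'a" +
  assumes ex_frechet_seminorms: "\<exists>p. frechet_seminorms smul p"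

text \<open>
  The class \<^class>\<open>ring\<close> requires neither a unit nor commutativity; it provides associativity
  and biadditivity of the multiplication.
\<close>

locale frechet_algebra = frechet_space smul
  for smul :: "'k::real_normed_field \<Rightarrow> 'a::{ring,t2_space} \<Rightarrow> 'a" +
  assumes mult_smul_left: "smul c x * y = smul c (x * y)"
    and mult_smul_right: "x * smul c y = smul c (x * y)"
    and continuous_mult: "continuous_on UNIV (\<lambda>z::'a \<times> 'a. fst z * snd z)"

definition infinite_dimensional :: "('k::field \<Rightarrow> 'a::ab_group_add \<Rightarrow> 'a) \<Rightarrow> bool" where
  "infinite_dimensional smul \<longleftrightarrow> \<not> (\<exists>B. finite B \<and> module.span smul B = UNIV)"

definition hamel_dim_aleph0 :: "('k::field \<Rightarrow> 'a::ab_group_add \<Rightarrow> 'a) \<Rightarrow> 'a set \<Rightarrow> bool" where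
  "hamel_dim_aleph0 smul A \<longleftrightarrow>
     (\<exists>B. \<not> module.dependent smul B \<and> module.span smul B = A \<and> B \<approx> (UNIV :: nat set))"

definition subalgebra :: "('k::field \<Rightarrow> 'a::ring \<Rightarrow> 'a) \<Rightarrow> 'a set \<Rightarrow> bool" where
  "subalgebra smul A \<longleftrightarrow> module.subspace smul A \<and> (\<forall>x\<in>A. \<forall>y\<in>A. x * y \<in> A)"

definition orbit :: "('a \<Rightarrow> 'a) \<Rightarrow> 'a \<Rightarrow> 'a set" where
  "orbit T x = {(T ^^ n) x | n. True}"

definition hypercyclic_vectors :: "('a::topological_space \<Rightarrow> 'a) \<Rightarrow> 'a set" where
  "hypercyclic_vectors T = {x. closure (orbit T x) = UNIV}"

definition hypercyclic_algebra ::
  "('k::field \<Rightarrow> 'a::{ring,topological_space} \<Rightarrow> 'a) \<Rightarrow> ('a \<Rightarrow> 'a) \<Rightarrow> 'a set \<Rightarrow> bool" where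
  "hypercyclic_algebra smul T A \<longleftrightarrow>
     subalgebra smul A \<and> A \<noteq> {0} \<and> A - {0} \<subseteq> hypercyclic_vectors T"

end

theory Submission
  imports Defs "HOL-Computational_Algebra.Polynomial"
begin

text \<open>
  Let \<open>p\<^sub>0 \<le> p\<^sub>1 \<le> \<dots>\<close> define the topology. The algebra \<open>A\<close> is generated by a countable set that is
  dense in every \<open>W\<^sub>n = {x. p\<^sub>i x = 0 for i < n}\<close>; from then on only the vector space structure matters.

  A greedy biorthogonal system of \<open>A\<close> supports weighted shifts \<open>S\<close>. If some \<open>p\<^sub>n\<close> is a norm, \<open>1 + S\<close> with a
  unilateral shift is conjugate, on a dense subspace, to the translation of polynomials. Otherwise \<open>S\<close> can be
  arranged to pull every basis vector back through basis vectors lying in deeper and deeper \<open>W\<^sub>n\<close>. In both cases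
  every nonzero polynomial in the operator has dense range and the operator is mixing, in the second case even
  starting from each \<open>W\<^sub>n\<close>. Hence generic vectors \<open>y\<^sub>i\<close> of the \<open>W\<^sub>n\<close> are jointly hypercyclic, and every nonzero
  vector of the span \<open>F\<close> of their orbits is hypercyclic.

  Finally, \<open>A\<close> and \<open>F\<close> are both dense in every \<open>W\<^sub>n\<close>, so a back-and-forth construction of small rank-one
  perturbations of the identity yields an automorphism \<open>J\<close> with \<open>J A = F\<close>. Conjugating by \<open>J\<close> gives \<open>T\<close>.
\<close>

section \<open>The Hahn-Banach theorem\<close>

text \<open>\<open>A\<close> has to be an algebra before any operator is available, and the span of
  some orbits is in general not closed under products. Hence \<open>F\<close> is built freely and
  transported to \<open>A\<close> by an automorphism. Plain density of \<open>A\<close> and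
  \<open>F\<close> would not allow this. An operator \<open>f(.) u\<close> with \<open>f\<close>
  bounded by \<open>p l\<close> keeps every seminorm under control only if the seminorms before
  \<open>p l\<close> vanish on \<open>u\<close>, so a vector of \<open>van l\<close> has to be
  approximated from inside \<open>van l\<close>. The two cases come from the weights. Those that
  make the shift \<open>S\<close> continuous are so small that, when \<open>p 0\<close> is a norm,
  preimages under the powers of \<open>S\<close> blow up; adding the identity cures this. When no
  \<open>p n\<close> is a norm, the preimages can be moved into \<open>van n\<close> with growing
  \<open>n\<close>, where the first \<open>n\<close> seminorms vanish and large coefficients do no
  harm.\<close>

definition sublinear :: "(real \<Rightarrow> 'a::ab_group_add \<Rightarrow> 'a) \<Rightarrow> ('a \<Rightarrow> real) \<Rightarrow> bool" where
  "sublinear smul s \<longleftrightarrow> (\<forall>x y. s (x + y) \<le> s x + s y) \<and> (\<forall>t>0. \<forall>x. s (smul t x) \<le> t * s x)"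

lemma seminorm_zero:
  assumes "vector_space smul" "seminorm smul q"
  shows "q 0 = 0"
proof -
  interpret vector_space smul by fact
  have "q (smul 0 0) = norm (0::'a) * q 0"
    using assms(2) by (metis seminorm_def)
  then show ?thesis by simp
qed

context
  fixes smul :: "real \<Rightarrow> 'a::ab_group_add \<Rightarrow> 'a"
  assumes vs: "vector_space smul"
begin

interpretation vector_space smul by (rule vs)

lemma sublinear_zero:
  assumes "sublinear smul s"
  shows "s 0 = 0"
proof -
  have "s 0 \<le> 2 * s 0" "s 0 \<le> (1/2) * s 0"
    using assms unfolding sublinear_def by (metis scale_zero_right zero_less_numeral, metis scale_zero_right half_gt_zero_iff zero_less_one)
  then show ?thesis by linarith
qed

lemma sublinear_neg:
  assumes "sublinear smul s"
  shows "- s (- x) \<le> s x"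
proof -
  have "s (x + - x) \<le> s x + s (- x)"
    using assms unfolding sublinear_def by blast
  then show ?thesis using sublinear_zero[OF assms] by simp
qed

text \<open>Applying the defining inequality with 1/t gives the reverse one, so for the infima below
  a single inequality has to be checked.\<close>

lemma sublinear_scale:
  assumes "sublinear smul s" "t > 0"
  shows "s (smul t x) = t * s x"
proof (rule antisym)
  show "s (smul t x) \<le> t * s x" using assms unfolding sublinear_def by blast
  have "s (smul (1 / t) (smul t x)) \<le> (1 / t) * s (smul t x)"
    using assms unfolding sublinear_def by (meson zero_less_divide_1_iff)
  with assms(2) show "t * s x \<le> s (smul t x)" by (simp add: field_simps)
qed

text \<open>\<open>r\<close> is the infimum of \<open>s (x + t z) - t s z\<close> over t >= 0; t = 0
  and t = 1 give the two bounds. A functional without smaller sublinear ones is unchanged by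
  shaving, and the second bound then says that it is superadditive.\<close>

lemma sublinear_shave:
  assumes s: "sublinear smul s"
  obtains r where "sublinear smul r" "\<And>x. r x \<le> s x" "\<And>x. r x \<le> s (x + z) - s z"
proof -
  define A where "A x = (\<lambda>t. s (x + smul t z) - t * s z) ` {0..}" for x
  define r where "r x = Inf (A x)" for x
  have sz: "s (smul t z) = t * s z" if "t \<ge> 0" for t
    using sublinear_scale[OF s, of t] sublinear_zero[OF s] that by (cases "t = 0") auto
  have low: "- s (- x) \<le> s (x + smul t z) - t * s z" if "t \<ge> 0" for x t
  proof -
    have "s ((x + smul t z) + - x) \<le> s (x + smul t z) + s (- x)"
      using s unfolding sublinear_def by blast
    then show ?thesis using sz[OF that] by (simp add: algebra_simps)
  qed
  then have bdd: "bdd_below (A x)" for x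
    unfolding A_def by (intro bdd_belowI[of _ "- s (- x)"]) auto
  have le: "r x \<le> s (x + smul t z) - t * s z" if "t \<ge> 0" for x t
    unfolding r_def using that by (intro cInf_lower bdd) (auto simp: A_def)
  have ge: "c \<le> r x" if "\<And>t. t \<ge> 0 \<Longrightarrow> c \<le> s (x + smul t z) - t * s z" for c x
    unfolding r_def using that by (intro cInf_greatest) (auto simp: A_def)
  have add: "r (x + y) \<le> r x + r y" for x y
  proof -
    have "r (x + y) - (s (y + smul u z) - u * s z) \<le> r x" if "u \<ge> 0" for u
    proof (rule ge)
      fix t :: real assume t: "t \<ge> 0"
      have "r (x + y) \<le> s (x + y + smul (t + u) z) - (t + u) * s z"
        using t that by (intro le) auto
      also have "x + y + smul (t + u) z = (x + smul t z) + (y + smul u z)"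
        by (simp add: algebra_simps)
      also have "s \<dots> \<le> s (x + smul t z) + s (y + smul u z)"
        using s unfolding sublinear_def by blast
      finally show "r (x + y) - (s (y + smul u z) - u * s z) \<le> s (x + smul t z) - t * s z"
        by (simp add: algebra_simps)
    qed
    then have "r (x + y) - r x \<le> r y"
      by (intro ge) (simp add: algebra_simps)
    then show ?thesis by simp
  qed
  have hom: "r (smul c x) \<le> c * r x" if "c > 0" for c x
  proof -
    have "r (smul c x) / c \<le> r x"
    proof (rule ge)
      fix t :: real assume t: "t \<ge> 0"
      have "r (smul c x) \<le> s (smul c x + smul (c * t) z) - (c * t) * s z"
        using t that by (intro le) auto
      also have "smul c x + smul (c * t) z = smul c (x + smul t z)"
        by (simp add: algebra_simps)
      also have "s \<dots> = c * s (x + smul t z)"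
        by (rule sublinear_scale[OF s that])
      finally show "r (smul c x) / c \<le> s (x + smul t z) - t * s z"
        using that by (simp add: field_simps)
    qed
    then show ?thesis using that by (simp add: field_simps)
  qed
  show ?thesis
  proof (rule that[of r])
    show "sublinear smul r" using add hom by (auto simp: sublinear_def)
    show "r x \<le> s x" for x using le[of 0 x] by simp
    show "r x \<le> s (x + z) - s z" for x using le[of 1 x] by simp
  qed
qed

text \<open>Zorn's lemma for the reversed pointwise order. The infimum of a chain is finite because
  every member lies above \<open>- q (- x)\<close>, and subadditive because of any two members one
  lies below the other.\<close>

lemma sublinear_minimal:
  assumes q: "sublinear smul q"
  obtains m where "sublinear smul m" "\<And>x. m x \<le> q x"
    "\<And>s. sublinear smul s \<Longrightarrow> (\<And>x. s x \<le> m x) \<Longrightarrow> s = m"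
proof -
  define A where "A = {s. sublinear smul s \<and> (\<forall>x. s x \<le> q x)}"
  define P where "P s t \<longleftrightarrow> (\<forall>x. t x \<le> s x)" for s t :: "'a \<Rightarrow> real"
  have "\<exists>m\<in>A. \<forall>a\<in>A. P m a \<longrightarrow> a = m"
  proof (rule predicate_Zorn)
    show "partial_order_on A (relation_of P A)"
      unfolding P_def by (intro partial_order_on_relation_ofI)
        (auto intro: order_trans, meson ext antisym)
    fix C assume C: "C \<in> Chains (relation_of P A)"
    then have CA: "C \<subseteq> A" and tot: "\<And>s t. s \<in> C \<Longrightarrow> t \<in> C \<Longrightarrow> P s t \<or> P t s"
      by (auto simp: Chains_def relation_of_def)
    show "\<exists>u\<in>A. \<forall>a\<in>C. P a u"
    proof (cases "C = {}")
      case True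
      then show ?thesis using q by (auto simp: A_def)
    next
      case ne: False
      define u where "u x = Inf ((\<lambda>s. s x) ` C)" for x
      have low: "- q (- x) \<le> s x" if "s \<in> C" for s x
      proof -
        have "- s (- x) \<le> s x" "s (- x) \<le> q (- x)"
          using that CA sublinear_neg by (auto simp: A_def)
        then show ?thesis by linarith
      qed
      then have bdd: "bdd_below ((\<lambda>s. s x) ` C)" for x
        by (intro bdd_belowI[of _ "- q (- x)"]) auto
      have le: "u x \<le> s x" if "s \<in> C" for s x
        unfolding u_def using that by (intro cInf_lower bdd) auto
      have ge: "c \<le> u x" if "\<And>s. s \<in> C \<Longrightarrow> c \<le> s x" for c x
        unfolding u_def using that ne by (intro cInf_greatest) auto
      have add: "u (x + y) \<le> u x + u y" for x y
      proof -
        have "u (x + y) - t y \<le> u x" if t: "t \<in> C" for t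
        proof (rule ge)
          fix s assume s: "s \<in> C"
          obtain r where r: "r \<in> C" "r x \<le> s x" "r y \<le> t y"
            using tot[OF s t] s t unfolding P_def by blast
          have "u (x + y) \<le> r (x + y)" using r(1) by (rule le)
          also have "\<dots> \<le> r x + r y" using r(1) CA by (auto simp: A_def sublinear_def)
          finally show "u (x + y) - t y \<le> s x" using r by linarith
        qed
        then have "u (x + y) - u x \<le> u y"
          by (intro ge) (simp add: algebra_simps)
        then show ?thesis by simp
      qed
      have hom: "u (smul c x) \<le> c * u x" if "c > 0" for c x
      proof -
        have "u (smul c x) / c \<le> u x"
        proof (rule ge)
          fix s assume s: "s \<in> C"
          have "u (smul c x) \<le> s (smul c x)" using s by (rule le)
          also have "\<dots> = c * s x" using s CA that by (intro sublinear_scale) (auto simp: A_def)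
          finally show "u (smul c x) / c \<le> s x" using that by (simp add: field_simps)
        qed
        then show ?thesis using that by (simp add: field_simps)
      qed
      obtain s where s: "s \<in> C" using ne by blast
      then have "u x \<le> q x" for x
        using le[OF s, of x] CA by (force simp: A_def intro: order_trans)
      then have "u \<in> A" using add hom by (auto simp: A_def sublinear_def)
      then show ?thesis using le by (auto simp: P_def)
    qed
  qed
  then obtain m where m: "m \<in> A" "\<And>a. a \<in> A \<Longrightarrow> P m a \<Longrightarrow> a = m" by blast
  show ?thesis
  proof (rule that[of m])
    show "sublinear smul m" "\<And>x. m x \<le> q x" using m(1) by (auto simp: A_def)
    fix s assume s: "sublinear smul s" "\<And>x. s x \<le> m x"
    then have "s \<in> A" using m(1) by (auto simp: A_def intro: order_trans)
    then show "s = m" using m(2) s(2) by (auto simp: P_def)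
  qed
qed

text \<open>Minimal sublinear functionals are linear; shaving the seminorm at \<open>a\<close> beforehand
  forces the value at \<open>a\<close>.\<close>

lemma seminorm_dominated_functional:
  assumes q: "seminorm smul q"
  obtains f where "Vector_Spaces.linear smul (*) f" "\<And>x. f x \<le> q x" "f a = q a"
proof -
  have "sublinear smul q" using q by (auto simp: seminorm_def sublinear_def)
  then obtain r where r: "sublinear smul r" "\<And>x. r x \<le> q x" "\<And>x. r x \<le> q (x + a) - q a"
    using sublinear_shave by metis
  obtain m where m: "sublinear smul m" "\<And>x. m x \<le> r x"
    and mini: "\<And>s. sublinear smul s \<Longrightarrow> (\<And>x. s x \<le> m x) \<Longrightarrow> s = m"
    using sublinear_minimal[OF r(1)] by metis
  have sup: "m x + m z \<le> m (x + z)" for x z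
  proof -
    obtain s where s: "sublinear smul s" "\<And>x. s x \<le> m x" "\<And>x. s x \<le> m (x + z) - m z"
      using sublinear_shave[OF m(1), of z] by metis
    then show ?thesis using mini[OF s(1,2)] by (metis le_diff_eq)
  qed
  have add: "m (x + z) = m x + m z" for x z
    using sup m(1) by (intro antisym) (auto simp: sublinear_def)
  have neg: "m (- x) = - m x" for x
    using add[of x "- x"] sublinear_zero[OF m(1)] by simp
  have hom: "m (smul c x) = c * m x" for c x
  proof -
    consider "c > 0" | "c = 0" | "c < 0" by linarith
    then show ?thesis
    proof cases
      case 3
      then have "m (smul (- c) x) = - c * m x" by (intro sublinear_scale[OF m(1)]) auto
      then show ?thesis using neg[of "smul c x"] by simp
    qed (use sublinear_scale[OF m(1)] sublinear_zero[OF m(1)] in auto)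
  qed
  show ?thesis
  proof (rule that[of m])
    show "Vector_Spaces.linear smul (*) m"
      using add hom vs by (intro linear_module_homI)
        (auto simp: module_hom_def module_hom_axioms_def module_iff_vector_space
          vector_space_def algebra_simps)
    show le: "m x \<le> q x" for x using m(2) r(2) order_trans by blast
    have "m (- a) \<le> q (- a + a) - q a" using m(2) r(3) order_trans by blast
    then have "q a \<le> m a" using neg seminorm_zero[OF vs q] by simp
    then show "m a = q a" using le by (simp add: antisym)
  qed
qed

end

text \<open>A property of the scalar multiplication rather than a theorem, so that the construction
  runs over an arbitrary real normed field and only this property is proved separately for real and
  complex scalars. Functionals are normalised at \<open>a\<close> later.\<close>

definition hahn_banach :: "('k::real_normed_field \<Rightarrow> 'a::ab_group_add \<Rightarrow> 'a) \<Rightarrow> bool" where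
  "hahn_banach smul \<longleftrightarrow> (\<forall>q a. seminorm smul q \<and> q a \<noteq> 0 \<longrightarrow>
     (\<exists>f. Vector_Spaces.linear smul (*) f \<and> (\<forall>x. norm (f x) \<le> q x) \<and> f a \<noteq> 0))"

lemma hahn_banach_real:
  fixes smul :: "real \<Rightarrow> 'a::ab_group_add \<Rightarrow> 'a"
  assumes vs: "vector_space smul"
  shows "hahn_banach smul"
  unfolding hahn_banach_def
proof (intro allI impI, elim conjE)
  interpret vector_space smul by (rule vs)
  fix q a assume q: "seminorm smul q" and a: "q a \<noteq> 0"
  obtain f where f: "Vector_Spaces.linear smul (*) f" "\<And>x. f x \<le> q x" "f a = q a"
    using seminorm_dominated_functional[OF vs q] by metis
  interpret f: Vector_Spaces.linear smul "(*)" f by (rule f)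
  have "norm (f x) \<le> q x" for x
  proof -
    have "q (smul (-1) x) = norm (-1::real) * q x" using q unfolding seminorm_def by blast
    then have "f (- x) \<le> q x" using f(2)[of "- x"] by simp
    then show ?thesis using f(2)[of x] f.neg[of x] by (simp add: abs_le_iff)
  qed
  then show "\<exists>f. Vector_Spaces.linear smul (*) f \<and> (\<forall>x. norm (f x) \<le> q x) \<and> f a \<noteq> 0"
    using f a by auto
qed

text \<open>A complex functional is determined by its real part:
  \<open>g x = f x - i f (i x)\<close> for a real functional \<open>f\<close> dominated by
  \<open>q\<close>.\<close>

lemma hahn_banach_complex:
  fixes smul :: "complex \<Rightarrow> 'a::ab_group_add \<Rightarrow> 'a"
  assumes vs: "vector_space smul"
  shows "hahn_banach smul"
  unfolding hahn_banach_def
proof (intro allI impI, elim conjE)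
  interpret vector_space smul by (rule vs)
  fix q a assume q: "seminorm smul q" and a: "q a \<noteq> 0"
  define rmul where "rmul t = smul (complex_of_real t)" for t
  have vsr: "vector_space rmul"
    unfolding rmul_def by unfold_locales (simp_all add: algebra_simps)
  have qr: "seminorm rmul q"
    using q by (auto simp: seminorm_def rmul_def)
  obtain f where f: "Vector_Spaces.linear rmul (*) f" "\<And>x. f x \<le> q x" "f a = q a"
    using seminorm_dominated_functional[OF vsr qr] by metis
  interpret f: Vector_Spaces.linear rmul "(*)" f by (rule f)
  have fr: "f (smul (complex_of_real t) x) = t * f x" for t x
    using f.scale[of t x] by (simp add: rmul_def)
  define g where "g x = Complex (f x) (- f (smul \<i> x))" for x
  have add: "g (x + y) = g x + g y" for x y
    by (simp add: g_def complex_eq_iff f.add scale_right_distrib)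
  have gi: "g (smul \<i> x) = \<i> * g x" for x
    by (simp add: g_def complex_eq_iff f.neg)
  have gr: "g (smul (complex_of_real t) x) = complex_of_real t * g x" for t x
  proof -
    have "smul \<i> (smul (complex_of_real t) x) = smul (complex_of_real t) (smul \<i> x)"
      by (rule scale_left_commute)
    then show ?thesis unfolding g_def by (simp add: complex_eq_iff fr del: scale_scale)
  qed
  have hom: "g (smul c x) = c * g x" for c x
  proof -
    have "smul c x = smul (complex_of_real (Re c)) x + smul \<i> (smul (complex_of_real (Im c)) x)"
      by (metis complex_eq scale_left_distrib scale_scale)
    then have "g (smul c x) = (complex_of_real (Re c) + \<i> * complex_of_real (Im c)) * g x"
      by (simp only: add gi gr) (simp add: algebra_simps)
    then show ?thesis using complex_eq by metis
  qed
  have "Vector_Spaces.linear smul (*) g"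
    using add hom vs by (intro linear_module_homI)
      (auto simp: module_hom_def module_hom_axioms_def module_iff_vector_space
        vector_space_def algebra_simps)
  moreover have "norm (g x) \<le> q x" for x
  proof (cases "g x = 0")
    case True
    have "q (x + - x) \<le> q x + q (- x)" using q unfolding seminorm_def by blast
    moreover have "q (smul (-1) x) = norm (-1::complex) * q x"
      using q unfolding seminorm_def by blast
    ultimately show ?thesis using True seminorm_zero[OF vs q] by simp
  next
    case False
    \<comment> \<open>The rotation that makes \<open>g (smul c x)\<close> real and equal to
      \<open>norm (g x)\<close>, so that the bound for the real part applies.\<close>
    define c where "c = cnj (sgn (g x))"
    have nc: "norm c = 1" using False by (simp add: c_def norm_sgn)
    have "g (smul c x) = complex_of_real (norm (g x))"
      using False complex_norm_square[of "g x"]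
      by (simp add: hom c_def sgn_eq field_simps power2_eq_square)
    then have "norm (g x) = f (smul c x)" by (simp add: g_def complex_eq_iff)
    also have "\<dots> \<le> q (smul c x)" by (rule f)
    also have "\<dots> = q x" using q nc unfolding seminorm_def by simp
    finally show ?thesis .
  qed
  moreover have "g a \<noteq> 0" using f(3) a by (simp add: g_def complex_eq_iff)
  ultimately show "\<exists>f. Vector_Spaces.linear smul (*) f \<and> (\<forall>x. norm (f x) \<le> q x) \<and> f a \<noteq> 0"
    by blast
qed

section \<open>Graded spaces and biorthogonal systems\<close>

locale graded_frechet = vector_space smul
  for smul :: "'k::real_normed_field \<Rightarrow> 'a::{ab_group_add,t2_space} \<Rightarrow> 'a" +
  fixes p :: "nat \<Rightarrow> 'a \<Rightarrow> real"
  assumes frechet: "frechet_seminorms smul p"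
    and hb: "hahn_banach smul"
begin

section \<open>Calculus with the seminorms and their limits\<close>

lemma p_seminorm: "seminorm smul (p n)"
  using frechet by (simp add: frechet_seminorms_def)

lemma p_add: "p n (x + y) \<le> p n x + p n y"
  using p_seminorm[of n] by (simp add: seminorm_def)

lemma p_scale: "p n (smul c x) = norm c * p n x"
  using p_seminorm[of n] by (simp add: seminorm_def)

lemma p_zero [simp]: "p n 0 = 0"
  using p_scale[of n 0 0] by simp

lemma p_minus [simp]: "p n (- x) = p n x"
  using p_scale[of n "- 1" x] by simp

lemma p_nonneg [simp]: "0 \<le> p n x"
  using p_add[of n x "- x"] by simp

lemma p_diff: "p n (x - y) \<le> p n x + p n y"
  using p_add[of n x "- y"] by simp

lemma p_commute: "p n (x - y) = p n (y - x)"
  using p_minus[of n "x - y"] by simp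

lemma p_triangle: "p n (x - z) \<le> p n (x - y) + p n (y - z)"
  using p_add[of n "x - y" "y - z"] by simp

lemma p_sum: "p n (sum g A) \<le> (\<Sum>i\<in>A. p n (g i))"
  by (induction A rule: infinite_finite_induct) (auto intro: order_trans[OF p_add])

lemma p_mono: "m \<le> n \<Longrightarrow> p m x \<le> p n x"
  using frechet by (auto intro: lift_Suc_mono_le[of "\<lambda>n. p n x"] simp: frechet_seminorms_def)

lemma p_eq_0: "(\<And>n. p n x = 0) \<Longrightarrow> x = 0"
  using frechet by (auto simp: frechet_seminorms_def)

lemma open_iff: "open U \<longleftrightarrow> (\<forall>x\<in>U. \<exists>n. \<exists>e>0. {y. p n (y - x) < e} \<subseteq> U)"
  using frechet by (auto simp: frechet_seminorms_def)

lemma open_ball: "open {y. p n (y - x) < e}"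
  unfolding open_iff
proof (intro ballI)
  fix z assume "z \<in> {y. p n (y - x) < e}"
  then have "e - p n (z - x) > 0" by simp
  moreover have "{y. p n (y - z) < e - p n (z - x)} \<subseteq> {y. p n (y - x) < e}"
  proof
    fix y assume "y \<in> {y. p n (y - z) < e - p n (z - x)}"
    then show "y \<in> {y. p n (y - x) < e}" using p_triangle[of n y x z] by auto
  qed
  ultimately show "\<exists>m. \<exists>d>0. {y. p m (y - z) < d} \<subseteq> {y. p n (y - x) < e}" by blast
qed

lemma closure_iff: "x \<in> closure S \<longleftrightarrow> (\<forall>m. \<forall>e>0. \<exists>y\<in>S. p m (y - x) < e)"
proof
  assume x: "x \<in> closure S"
  show "\<forall>m. \<forall>e>0. \<exists>y\<in>S. p m (y - x) < e"
  proof (intro allI impI)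
    fix m and e :: real assume "e > 0"
    then have "x \<in> {y. p m (y - x) < e}" by simp
    then show "\<exists>y\<in>S. p m (y - x) < e"
      using x open_ball[of m x e] unfolding closure_iff_nhds_not_empty
      by (metis (no_types, lifting) disjoint_iff mem_Collect_eq order_refl)
  qed
next
  assume h: "\<forall>m. \<forall>e>0. \<exists>y\<in>S. p m (y - x) < e"
  show "x \<in> closure S"
    unfolding closure_iff_nhds_not_empty
  proof (intro allI impI)
    fix A U assume U: "U \<subseteq> A" "open U" "x \<in> U"
    then obtain n e where "e > 0" "{y. p n (y - x) < e} \<subseteq> U"
      unfolding open_iff by blast
    then show "S \<inter> A \<noteq> {}" using h U by blast
  qed
qed

text \<open>Limits are expressed through the seminorms because the sort only provides a group and a
  topology, without a relation between them; \<open>cauchy_conv\<close> connects this notion with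
  completeness.\<close>

definition conv :: "(nat \<Rightarrow> 'a) \<Rightarrow> 'a \<Rightarrow> bool" where
  "conv s l \<longleftrightarrow> (\<forall>m. (\<lambda>i. p m (s i - l)) \<longlonglongrightarrow> 0)"

lemma conv_D: "conv s l \<Longrightarrow> e > 0 \<Longrightarrow> \<exists>N. \<forall>i\<ge>N. p m (s i - l) < e"
  using LIMSEQ_D[of "\<lambda>i. p m (s i - l)" 0 e] by (auto simp: conv_def)

lemma cauchy_conv:
  assumes "\<And>m e. e > 0 \<Longrightarrow> \<exists>N. \<forall>i\<ge>N. \<forall>j\<ge>N. p m (s i - s j) < e"
  obtains l where "conv s l"
proof -
  obtain l where l: "s \<longlonglongrightarrow> l"
    using frechet assms unfolding frechet_seminorms_def by metis
  have "(\<lambda>i. p m (s i - l)) \<longlonglongrightarrow> 0" for m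
  proof (rule LIMSEQ_I)
    fix r :: real assume "r > 0"
    then have "eventually (\<lambda>i. s i \<in> {y. p m (y - l) < r}) sequentially"
      using l open_ball by (intro topological_tendstoD) auto
    then show "\<exists>N. \<forall>i\<ge>N. norm (p m (s i - l) - 0) < r"
      by (simp add: eventually_sequentially)
  qed
  then show ?thesis using that by (auto simp: conv_def)
qed

text \<open>The bound is the exact geometric sum from k to j - 1, which lets the induction
  close.\<close>

lemma geometric_tail:
  assumes "\<And>k. k \<ge> K \<Longrightarrow> p m (s (Suc k) - s k) \<le> B / 2 ^ k" and "K \<le> k" "k \<le> j"
  shows "p m (s j - s k) \<le> 2 * B / 2 ^ k - 2 * B / 2 ^ j"
  using \<open>k \<le> j\<close>
proof (induction j rule: dec_induct)
  case (step j)
  have "p m (s (Suc j) - s k) \<le> p m (s (Suc j) - s j) + p m (s j - s k)"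
    by (rule p_triangle)
  also have "\<dots> \<le> B / 2 ^ j + (2 * B / 2 ^ k - 2 * B / 2 ^ j)"
    using step assms by (intro add_mono) auto
  finally show ?case by (simp add: field_simps)
qed simp

lemma geometric_conv:
  assumes "\<And>m. \<exists>B K. \<forall>k\<ge>K. p m (s (Suc k) - s k) \<le> B / 2 ^ k"
  obtains l where "conv s l"
proof (rule cauchy_conv)
  fix m and e :: real assume e: "e > 0"
  obtain B K where BK: "\<And>k. k \<ge> K \<Longrightarrow> p m (s (Suc k) - s k) \<le> B / 2 ^ k"
    using assms by metis
  have "0 \<le> B / 2 ^ K" using BK[of K] p_nonneg order_trans by blast
  then have B: "B \<ge> 0" by (simp add: field_simps)
  have tail: "p m (s j - s k) \<le> 2 * B / 2 ^ k" if "K \<le> k" "k \<le> j" for j k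
  proof -
    have "p m (s j - s k) \<le> 2 * B / 2 ^ k - 2 * B / 2 ^ j"
      using geometric_tail[OF BK that] by blast
    moreover have "0 \<le> 2 * B / 2 ^ j" using B by simp
    ultimately show ?thesis by linarith
  qed
  have "(\<lambda>k. 4 * B / 2 ^ k) \<longlonglongrightarrow> 0" by (rule LIMSEQ_divide_realpow_zero) simp
  then obtain N where N: "\<And>k. k \<ge> N \<Longrightarrow> norm (4 * B / 2 ^ k - 0) < e"
    using LIMSEQ_D e by blast
  define M where "M = max N K"
  have "p m (s i - s j) < e" if "i \<ge> M" "j \<ge> M" for i j
  proof -
    have "p m (s i - s j) \<le> p m (s i - s M) + p m (s M - s j)" by (rule p_triangle)
    also have "\<dots> \<le> 2 * B / 2 ^ M + 2 * B / 2 ^ M"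
      using that by (intro add_mono tail, simp_all add: M_def p_commute[of m "s (max N K)"])
        (intro tail, auto)
    also have "\<dots> < e" using N[of M] B by (simp add: M_def)
    finally show ?thesis .
  qed
  then show "\<exists>N. \<forall>i\<ge>N. \<forall>j\<ge>N. p m (s i - s j) < e" by blast
qed

lemma conv_le:
  assumes "conv s l" "\<And>j. j \<ge> k \<Longrightarrow> p m (s j - x) \<le> b"
  shows "p m (l - x) \<le> b"
proof (rule field_le_epsilon)
  fix e :: real assume "e > 0"
  then obtain N where N: "\<And>i. i \<ge> N \<Longrightarrow> p m (s i - l) < e"
    using conv_D[OF assms(1)] by blast
  have "p m (l - x) \<le> p m (l - s (max N k)) + p m (s (max N k) - x)" by (rule p_triangle)
  also have "\<dots> \<le> e + b"
    using N[of "max N k"] assms(2)[of "max N k"] by (intro add_mono) (auto simp: p_commute)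
  finally show "p m (l - x) \<le> b + e" by simp
qed

lemma conv_geometric_le:
  assumes "conv s l" "\<And>k. k \<ge> K \<Longrightarrow> p m (s (Suc k) - s k) \<le> B / 2 ^ k" "k \<ge> K"
  shows "p m (l - s k) \<le> 2 * B / 2 ^ k"
proof (rule conv_le[OF assms(1)])
  fix j assume "k \<le> j"
  have "0 \<le> B / 2 ^ K" using assms(2)[of K] p_nonneg order_trans by blast
  then have "0 \<le> 2 * B / 2 ^ j" by (simp add: field_simps)
  then show "p m (s j - s k) \<le> 2 * B / 2 ^ k"
    using geometric_tail[OF assms(2,3) \<open>k \<le> j\<close>] by auto
qed

lemma conv_unique:
  assumes "conv s l" "conv s l'"
  shows "l = l'"
proof -
  have "p m (l - l') \<le> 0" for m
  proof (rule field_le_epsilon)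
    fix e :: real assume "e > 0"
    then obtain N where "\<And>i. i \<ge> N \<Longrightarrow> p m (s i - l') < e"
      using conv_D[OF assms(2)] by blast
    then show "p m (l - l') \<le> 0 + e" by (intro conv_le[OF assms(1)]) (auto intro: less_imp_le)
  qed
  then have "l - l' = 0" by (intro p_eq_0) (simp add: antisym)
  then show ?thesis by simp
qed

lemma conv_add: "conv s l \<Longrightarrow> conv t k \<Longrightarrow> conv (\<lambda>i. s i + t i) (l + k)"
  unfolding conv_def
proof
  fix m assume *: "\<forall>m. (\<lambda>i. p m (s i - l)) \<longlonglongrightarrow> 0" "\<forall>m. (\<lambda>i. p m (t i - k)) \<longlonglongrightarrow> 0"
  have "(\<lambda>i. p m (s i - l) + p m (t i - k)) \<longlonglongrightarrow> 0"
    using tendsto_add[of "\<lambda>i. p m (s i - l)" 0 _ "\<lambda>i. p m (t i - k)" 0] * by simp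
  then show "(\<lambda>i. p m (s i + t i - (l + k))) \<longlonglongrightarrow> 0"
    by (rule tendsto_sandwich[OF _ _ tendsto_const, rotated 2])
      (auto simp: add_diff_add p_add)
qed

lemma conv_scale: "conv s l \<Longrightarrow> conv (\<lambda>i. smul c (s i)) (smul c l)"
  unfolding conv_def by (auto simp: p_scale scale_right_diff_distrib[symmetric] intro!: tendsto_eq_intros)

lemma conv_eventually_const:
  assumes "\<And>i. i \<ge> N \<Longrightarrow> s i = l"
  shows "conv s l"
  unfolding conv_def
proof
  show "(\<lambda>i. p m (s i - l)) \<longlonglongrightarrow> 0" for m
    using assms by (intro tendsto_eventually eventually_sequentiallyI[of N]) auto
qed

section \<open>Continuous and tame linear operators\<close>

abbreviation lin :: "('a \<Rightarrow> 'a) \<Rightarrow> bool" where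
  "lin \<equiv> Vector_Spaces.linear smul smul"

abbreviation lfun :: "('a \<Rightarrow> 'k) \<Rightarrow> bool" where
  "lfun \<equiv> Vector_Spaces.linear smul (*)"

lemma linI:
  assumes "\<And>x y. T (x + y) = T x + T y" "\<And>c x. T (smul c x) = smul c (T x)"
  shows "lin T"
  using assms by (intro linear_module_homI module_hom.intro module_axioms)
    (simp add: module_hom_axioms_def)

lemma lfunI:
  assumes "\<And>x y. f (x + y) = f x + f y" "\<And>c x. f (smul c x) = c * f x"
  shows "lfun f"
  using assms by (intro linear_module_homI module_hom.intro module_axioms)
    (simp_all add: module_hom_axioms_def module_def algebra_simps)

lemma lin_rules:
  assumes "lin T"
  shows lin_add: "T (x + y) = T x + T y" and lin_scale: "T (smul c x) = smul c (T x)"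
    and lin_zero: "T 0 = 0" and lin_diff: "T (x - y) = T x - T y"
    and lin_sum: "T (sum g A) = (\<Sum>i\<in>A. T (g i))"
proof -
  interpret Vector_Spaces.linear smul smul T by fact
  show "T (x + y) = T x + T y" "T (smul c x) = smul c (T x)" "T 0 = 0"
    "T (x - y) = T x - T y" "T (sum g A) = (\<Sum>i\<in>A. T (g i))"
    by (simp_all add: add scale diff sum)
qed

lemma lfun_rules:
  assumes "lfun f"
  shows lfun_add: "f (x + y) = f x + f y" and lfun_scale: "f (smul c x) = c * f x"
    and lfun_zero: "f 0 = 0" and lfun_diff: "f (x - y) = f x - f y"
    and lfun_sum: "f (sum g A) = (\<Sum>i\<in>A. f (g i))"
proof -
  interpret Vector_Spaces.linear smul "(*)" f by fact
  show "f (x + y) = f x + f y" "f (smul c x) = c * f x" "f 0 = 0"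
    "f (x - y) = f x - f y" "f (sum g A) = (\<Sum>i\<in>A. f (g i))"
    by (simp_all add: add scale diff sum)
qed

definition cont_lin :: "('a \<Rightarrow> 'a) \<Rightarrow> bool" where
  "cont_lin T \<longleftrightarrow> lin T \<and> (\<forall>m. \<exists>n. \<exists>C\<ge>0. \<forall>v. p m (T v) \<le> C * p n v)"

text \<open>The same seminorm stands on both sides. Hence a tame operator maps every
  \<open>van n\<close> into itself, and limits of tame operators can be controlled one seminorm at a
  time.\<close>

definition tame :: "('a \<Rightarrow> 'a) \<Rightarrow> bool" where
  "tame T \<longleftrightarrow> lin T \<and> (\<forall>m. \<exists>C\<ge>0. \<forall>v. p m (T v) \<le> C * p m v)"

text \<open>These are the spaces W of the overview. The strict inequality makes \<open>van 0\<close>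
  the whole space, so a density statement about all levels includes density in the whole
  space.\<close>

definition van :: "nat \<Rightarrow> 'a set" where
  "van n = {x. \<forall>i<n. p i x = 0}"

lemma tame_lin: "tame T \<Longrightarrow> lin T" and cont_lin_lin: "cont_lin T \<Longrightarrow> lin T"
  by (auto simp: tame_def cont_lin_def)

lemma tame_cont_lin: "tame T \<Longrightarrow> cont_lin T"
  unfolding tame_def cont_lin_def by blast

lemma cont_linD:
  assumes "cont_lin T"
  obtains n C where "C \<ge> 0" "\<And>v. p m (T v) \<le> C * p n v"
  using assms unfolding cont_lin_def by blast

lemma tameD:
  assumes "tame T"
  obtains C where "C \<ge> 0" "\<And>v. p m (T v) \<le> C * p m v"
  using assms unfolding tame_def by blast

lemma cont_lin_small:
  assumes "cont_lin T" "e > 0"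
  obtains n d where "d > 0" "\<And>v. p n v < d \<Longrightarrow> p m (T v) < e"
proof -
  obtain n C where C: "C \<ge> 0" "\<And>v. p m (T v) \<le> C * p n v"
    using cont_linD[OF assms(1)] by metis
  have "p m (T v) < e" if "p n v < e / (C + 1)" for v
  proof -
    have "p m (T v) \<le> (C + 1) * p n v" by (rule order_trans[OF C(2)]) (simp add: distrib_right)
    also have "\<dots> < e" using that C(1) by (simp add: field_simps)
    finally show ?thesis .
  qed
  then show ?thesis using that[of "e / (C + 1)" n] C assms(2) by auto
qed

lemma cont_lin_continuous:
  assumes "cont_lin T"
  shows "continuous_on UNIV T"
  unfolding continuous_on_open_vimage[OF open_UNIV]
proof (intro allI impI)
  fix B :: "'a set" assume B: "open B"
  have "open (T -` B)"
    unfolding open_iff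
  proof
    fix x assume "x \<in> T -` B"
    then obtain m e where me: "e > 0" "{y. p m (y - T x) < e} \<subseteq> B"
      using B unfolding open_iff by blast
    obtain n d where "d > 0" "\<And>v. p n v < d \<Longrightarrow> p m (T v) < e"
      using cont_lin_small[OF assms me(1)] by metis
    then have "{y. p n (y - x) < d} \<subseteq> T -` B"
      using me(2) lin_diff[OF cont_lin_lin[OF assms]] by fastforce
    then show "\<exists>n. \<exists>e>0. {y. p n (y - x) < e} \<subseteq> T -` B" using \<open>d > 0\<close> by blast
  qed
  then show "open (T -` B \<inter> UNIV)" by simp
qed

lemma cont_lin_id: "cont_lin (\<lambda>x. x)"
  unfolding cont_lin_def
proof (intro conjI linI allI)
  show "\<exists>n. \<exists>C\<ge>0. \<forall>v. p m v \<le> C * p n v" for m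
    by (rule exI[of _ m], rule exI[of _ 1]) simp
qed simp_all

lemma cont_lin_scale:
  assumes "cont_lin T"
  shows "cont_lin (\<lambda>x. smul c (T x))"
proof -
  have "\<exists>n. \<exists>C\<ge>0. \<forall>v. p m (smul c (T v)) \<le> C * p n v" for m
  proof -
    obtain n C where C: "C \<ge> 0" "\<And>v. p m (T v) \<le> C * p n v"
      using cont_linD[OF assms] by metis
    then have "p m (smul c (T v)) \<le> (norm c * C) * p n v" for v
      unfolding p_scale using C(2)[of v] by (simp add: mult.assoc mult_left_mono)
    then show ?thesis using C(1) by (meson mult_nonneg_nonneg norm_ge_zero)
  qed
  then show ?thesis unfolding cont_lin_def
    using cont_lin_lin[OF assms] by (auto intro!: linI simp: lin_rules scale_right_distrib mult.commute)
qed

lemma cont_lin_add: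
  assumes "cont_lin S" "cont_lin T"
  shows "cont_lin (\<lambda>x. S x + T x)"
proof -
  have "\<exists>n. \<exists>C\<ge>0. \<forall>v. p m (S v + T v) \<le> C * p n v" for m
  proof -
    obtain n C where C: "C \<ge> 0" "\<And>v. p m (S v) \<le> C * p n v"
      using cont_linD[OF assms(1)] by metis
    obtain n' C' where C': "C' \<ge> 0" "\<And>v. p m (T v) \<le> C' * p n' v"
      using cont_linD[OF assms(2)] by metis
    have "p m (S v + T v) \<le> (C + C') * p (max n n') v" for v
    proof -
      have "p m (S v + T v) \<le> C * p n v + C' * p n' v"
        using p_add[of m "S v" "T v"] C(2)[of v] C'(2)[of v] by linarith
      also have "\<dots> \<le> C * p (max n n') v + C' * p (max n n') v"
        using C C' by (intro add_mono mult_left_mono p_mono) auto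
      finally show ?thesis by (simp add: algebra_simps)
    qed
    then show ?thesis using C(1) C'(1) by (meson add_nonneg_nonneg)
  qed
  then show ?thesis unfolding cont_lin_def
    using cont_lin_lin[OF assms(1)] cont_lin_lin[OF assms(2)]
    by (auto intro!: linI simp: lin_rules scale_right_distrib)
qed

lemma cont_lin_comp:
  assumes "cont_lin S" "cont_lin T"
  shows "cont_lin (\<lambda>x. S (T x))"
proof -
  have "\<exists>n. \<exists>C\<ge>0. \<forall>v. p m (S (T v)) \<le> C * p n v" for m
  proof -
    obtain n C where C: "C \<ge> 0" "\<And>v. p m (S v) \<le> C * p n v"
      using cont_linD[OF assms(1)] by metis
    obtain n' C' where C': "C' \<ge> 0" "\<And>v. p n (T v) \<le> C' * p n' v"
      using cont_linD[OF assms(2)] by metis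
    have "p m (S (T v)) \<le> (C * C') * p n' v" for v
      using C(2)[of "T v"] mult_left_mono[OF C'(2)[of v] C(1)] by (simp add: mult.assoc)
    then show ?thesis using C(1) C'(1) by (meson mult_nonneg_nonneg)
  qed
  then show ?thesis unfolding cont_lin_def
    using cont_lin_lin[OF assms(1)] cont_lin_lin[OF assms(2)]
    by (auto intro!: linI simp: lin_rules)
qed

lemma cont_lin_funpow: "cont_lin T \<Longrightarrow> cont_lin (T ^^ n)"
  by (induction n) (auto simp: o_def id_def cont_lin_id cont_lin_comp)

lemma tame_id: "tame (\<lambda>x. x)"
  unfolding tame_def by (auto intro!: linI exI[of _ 1])

lemma tame_add:
  assumes "tame S" "tame T"
  shows "tame (\<lambda>x. S x + T x)"
proof -
  have "\<exists>C\<ge>0. \<forall>v. p m (S v + T v) \<le> C * p m v" for m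
  proof -
    obtain C where C: "C \<ge> 0" "\<And>v. p m (S v) \<le> C * p m v"
      using tameD[OF assms(1)] by metis
    obtain C' where C': "C' \<ge> 0" "\<And>v. p m (T v) \<le> C' * p m v"
      using tameD[OF assms(2)] by metis
    have "p m (S v + T v) \<le> (C + C') * p m v" for v
      using p_add[of m "S v" "T v"] C(2)[of v] C'(2)[of v] by (simp add: algebra_simps)
    then show ?thesis using C(1) C'(1) by (meson add_nonneg_nonneg)
  qed
  then show ?thesis unfolding tame_def
    using tame_lin[OF assms(1)] tame_lin[OF assms(2)]
    by (auto intro!: linI simp: lin_rules scale_right_distrib)
qed

lemma tame_comp:
  assumes "tame S" "tame T"
  shows "tame (\<lambda>x. S (T x))"
proof -
  have "\<exists>C\<ge>0. \<forall>v. p m (S (T v)) \<le> C * p m v" for m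
  proof -
    obtain C where C: "C \<ge> 0" "\<And>v. p m (S v) \<le> C * p m v"
      using tameD[OF assms(1)] by metis
    obtain C' where C': "C' \<ge> 0" "\<And>v. p m (T v) \<le> C' * p m v"
      using tameD[OF assms(2)] by metis
    have "p m (S (T v)) \<le> (C * C') * p m v" for v
      using C(2)[of "T v"] mult_left_mono[OF C'(2)[of v] C(1)] by (simp add: mult.assoc)
    then show ?thesis using C(1) C'(1) by (meson mult_nonneg_nonneg)
  qed
  then show ?thesis unfolding tame_def
    using tame_lin[OF assms(1)] tame_lin[OF assms(2)]
    by (auto intro!: linI simp: lin_rules)
qed

lemma van_0 [simp]: "van 0 = UNIV"
  by (simp add: van_def)

lemma van_mono: "m \<le> n \<Longrightarrow> van n \<subseteq> van m"
  by (auto simp: van_def)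

lemma vanD: "x \<in> van n \<Longrightarrow> i < n \<Longrightarrow> p i x = 0"
  by (simp add: van_def)

lemma van_add: "x \<in> van n \<Longrightarrow> y \<in> van n \<Longrightarrow> x + y \<in> van n"
  unfolding van_def
proof clarify
  fix i assume "\<forall>i<n. p i x = 0" "\<forall>i<n. p i y = 0" "i < n"
  then show "p i (x + y) = 0" using p_add[of i x y] by (simp add: antisym)
qed

lemma van_scale: "x \<in> van n \<Longrightarrow> smul c x \<in> van n"
  by (simp add: van_def p_scale)

lemma subspace_van: "subspace (van n)"
  by (intro subspaceI van_add van_scale) (simp_all add: van_def)

lemma van_diff: "x \<in> van n \<Longrightarrow> y \<in> van n \<Longrightarrow> x - y \<in> van n"
  using subspace_van by (rule subspace_diff)

lemma van_tame: "tame T \<Longrightarrow> x \<in> van n \<Longrightarrow> T x \<in> van n"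
  unfolding van_def
proof clarify
  fix i assume "tame T" "\<forall>i<n. p i x = 0" "i < n"
  then show "p i (T x) = 0" using tameD[of T i] by (metis mult_zero_right p_nonneg antisym)
qed

lemma van_conv: "conv s l \<Longrightarrow> (\<And>i. s i \<in> van n) \<Longrightarrow> l \<in> van n"
  unfolding van_def
proof clarify
  fix i assume *: "conv s l" "\<And>j. s j \<in> {x. \<forall>i<n. p i x = 0}" "i < n"
  then have "p i (l - 0) \<le> 0" by (intro conv_le[OF *(1), of 0]) auto
  then show "p i l = 0" by (simp add: antisym)
qed

text \<open>The seminorms before \<open>l\<close> vanish on \<open>u\<close>, and those from
  \<open>l\<close> on dominate \<open>p l\<close> and hence \<open>f\<close>.\<close>

lemma tame_rank_one:
  assumes "lfun f" "C \<ge> 0" "\<And>v. norm (f v) \<le> C * p l v" "u \<in> van l"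
  shows "tame (\<lambda>v. smul (f v) u)"
proof -
  have "\<exists>K\<ge>0. \<forall>v. p m (smul (f v) u) \<le> K * p m v" for m
  proof (cases "m < l")
    case True
    then show ?thesis using vanD[OF assms(4)] by (auto simp: p_scale)
  next
    case False
    have "p m (smul (f v) u) \<le> (C * p m u) * p m v" for v
    proof -
      have "norm (f v) * p m u \<le> (C * p m v) * p m u"
        using assms(3)[of v] p_mono[of l m v] False \<open>C \<ge> 0\<close>
        by (intro mult_right_mono p_nonneg) (meson mult_left_mono not_less order_trans)
      then show ?thesis by (simp add: p_scale mult_ac)
    qed
    then show ?thesis using \<open>C \<ge> 0\<close> by (intro exI[of _ "C * p m u"]) auto
  qed
  then show ?thesis unfolding tame_def
    using assms(1) by (auto intro!: linI simp: lfun_rules scale_left_distrib)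
qed

section \<open>Functionals of the right level, projections and biorthogonal bases\<close>

lemma level_exists:
  assumes "a \<noteq> 0"
  obtains l where "a \<in> van l" "p l a \<noteq> 0"
proof -
  define l where "l = (LEAST n. p n a \<noteq> 0)"
  have "\<exists>n. p n a \<noteq> 0" using assms p_eq_0 by blast
  then have "p l a \<noteq> 0" unfolding l_def by (rule LeastI_ex)
  moreover have "a \<in> van l" unfolding van_def l_def using not_less_Least by blast
  ultimately show ?thesis using that by blast
qed

text \<open>Hahn-Banach at the first seminorm that does not vanish on \<open>a\<close>. Composition
  with \<open>P\<close> makes the functional vanish on the kernel of \<open>P\<close>, and tameness
  of \<open>P\<close> keeps the bound at the same level \<open>l\<close>.\<close>

lemma functional_step:
  assumes P: "tame P" "\<And>v. P (P v) = P v" and a: "P a = a" "a \<noteq> 0"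
  obtains l C f where "a \<in> van l" "C \<ge> 0" "lfun f" "\<And>v. norm (f v) \<le> C * p l v"
    "\<And>v. f (P v) = f v" "f a = 1"
proof -
  obtain l where l: "a \<in> van l" "p l a \<noteq> 0" using level_exists[OF a(2)] .
  obtain h where h: "lfun h" "\<And>x. norm (h x) \<le> p l x" "h a \<noteq> 0"
    using hb p_seminorm[of l] l(2) unfolding hahn_banach_def by blast
  obtain C where C: "C \<ge> 0" "\<And>v. p l (P v) \<le> C * p l v" using tameD[OF P(1)] by metis
  define f where "f v = h (P v) / h a" for v
  show ?thesis
  proof (rule that[of l "C / norm (h a)" f])
    show "lfun f" unfolding f_def
      using h(1) tame_lin[OF P(1)]
      by (intro lfunI) (simp_all add: lin_rules lfun_rules add_divide_distrib)
    show "norm (f v) \<le> C / norm (h a) * p l v" for v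
      using h(2)[of "P v"] C(2)[of v] unfolding f_def norm_divide
      by (simp add: divide_right_mono)
  qed (use l C h a P in \<open>auto simp: f_def\<close>)
qed

text \<open>The span of \<open>B\<close> is the kernel of \<open>P\<close>, hence closed; this later
  shows that no finite set has dense span. Each new vector \<open>b\<close> is killed by subtracting
  \<open>f v\<close> times \<open>P b\<close>, where \<open>f\<close> factors through
  \<open>P\<close> and is 1 at \<open>P b\<close>.\<close>

lemma finite_projection:
  assumes "finite B"
  obtains P where "tame P" "\<And>v. v - P v \<in> span B" "\<And>b. b \<in> B \<Longrightarrow> P b = 0"
proof -
  have "\<exists>P. tame P \<and> (\<forall>v. P (P v) = P v) \<and> (\<forall>v. v - P v \<in> span B) \<and> (\<forall>b\<in>B. P b = 0)"
    using assms
  proof (induction B rule: finite_induct)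
    case empty
    then show ?case using tame_id by (intro exI[of _ "\<lambda>x. x"]) auto
  next
    case (insert b B)
    then obtain P where P: "tame P" "\<And>v. P (P v) = P v" "\<And>v. v - P v \<in> span B"
      "\<And>b. b \<in> B \<Longrightarrow> P b = 0" by blast
    note lP = lin_rules[OF tame_lin[OF P(1)]]
    have mono: "span B \<subseteq> span (insert b B)" by (intro span_mono) auto
    show ?case
    proof (cases "P b = 0")
      case True
      then show ?thesis using P mono by (intro exI[of _ P]) auto
    next
      case False
      obtain l C f where f: "P b \<in> van l" "C \<ge> 0" "lfun f" "\<And>v. norm (f v) \<le> C * p l v"
        "\<And>v. f (P v) = f v" "f (P b) = 1"
        using functional_step[OF P(1,2) P(2) False] by metis
      define P' where "P' v = P v + smul (f v) (- P b)" for v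
      have "- P b \<in> van l" using subspace_neg[OF subspace_van] f(1) by blast
      then have tame: "tame P'" unfolding P'_def
        by (intro tame_add P(1) tame_rank_one[OF f(3,2,4)])
      have fb: "f b = 1" using f(5,6) by metis
      have "P (P' v) = P' v" for v
        by (simp add: P'_def lP P(2))
      moreover have fP': "f (P' v) = 0" for v
        using f(5)[of v] f(6) lfun_rules[OF f(3)] by (simp add: P'_def)
      ultimately have "P' (P' v) = P' v" for v by (simp add: P'_def[of "P' v"])
      moreover have "v - P' v \<in> span (insert b B)" for v
      proof -
        have "b - P b \<in> span (insert b B)" using P(3) mono by blast
        then have "P b \<in> span (insert b B)"
          using span_diff[OF span_base[of b "insert b B"]] by fastforce
        then have "(v - P v) + smul (f v) (P b) \<in> span (insert b B)"
          using P(3) mono by (intro span_add span_scale) auto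
        then show ?thesis by (simp add: P'_def algebra_simps)
      qed
      moreover have "P' c = 0" if "c \<in> insert b B" for c
      proof (cases "c = b")
        case True
        then show ?thesis by (simp add: P'_def fb)
      next
        case False
        then have "P c = 0" using that P(4) by blast
        then have "f c = 0" using f(5)[of c] lfun_zero[OF f(3)] by simp
        then show ?thesis using \<open>P c = 0\<close> by (simp add: P'_def)
      qed
      ultimately show ?thesis using tame by blast
    qed
  qed
  then show ?thesis using that by blast
qed

text \<open>Greedy choice: the \<open>k\<close>-th functional is continuous for the first seminorm that does not
  vanish on the \<open>k\<close>-th vector. This balance between the kernels and the functionals is what makes
  rank-one operators \<open>f k \<otimes> e k\<close> and their small perturbations respect every seminorm.\<close>

lemma biorthogonal_basis:
  assumes ind: "independent (range b)" and inj: "inj (b :: nat \<Rightarrow> 'a)"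
  obtains e :: "nat \<Rightarrow> 'a" and f l C where "span (range e) = span (range b)" "\<And>k. e k \<in> van (l k)"
    "\<And>k. C k \<ge> 0" "\<And>k. lfun (f k)" "\<And>k v. norm (f k v) \<le> C k * p (l k) v"
    "\<And>j k. f k (e j) = (if j = k then 1 else 0)"
proof -
  \<comment> \<open>\<open>P\<close> is a projection that changes vectors only within the span of
    the first \<open>k\<close> vectors of \<open>b\<close>; the next basis vector will be
    \<open>P (b k)\<close>.\<close>
  define I where "I k P \<longleftrightarrow> tame P \<and> (\<forall>v. P (P v) = P v) \<and> (\<forall>v. v - P v \<in> span (b ` {..<k}))"
    for k :: nat and P
  define G where "G k P P' l C f \<longleftrightarrow> P (b k) \<in> van l \<and> C \<ge> 0 \<and> lfun f \<and>
      (\<forall>v. norm (f v) \<le> C * p l v) \<and> (\<forall>v. f (P v) = f v) \<and> f (P (b k)) = 1 \<and>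
      P' = (\<lambda>v. P v - smul (f v) (P (b k)))" for k P P' l C f
  define R where "R k P P' \<longleftrightarrow> (\<exists>l C f. G k P P' l C f)" for k P P'
  have "\<exists>Q. \<forall>k. I k (Q k) \<and> R k (Q k) (Q (Suc k))"
  proof (rule dependent_nat_choice)
    show "\<exists>P. I 0 P" using tame_id by (intro exI[of _ "\<lambda>x. x"]) (auto simp: I_def)
  next
    fix P k assume IP: "I k P"
    then have P: "tame P" "\<And>v. P (P v) = P v" "\<And>v. v - P v \<in> span (b ` {..<k})"
      by (auto simp: I_def)
    note lP = lin_rules[OF tame_lin[OF P(1)]]
    have "P (b k) \<noteq> 0"
    proof
      assume "P (b k) = 0"
      then have "b k \<in> span (b ` {..<k})" using P(3)[of "b k"] by simp
      also have "\<dots> \<subseteq> span (range b - {b k})"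
        using inj by (intro span_mono) (auto simp: inj_def)
      finally show False using ind dependent_def by blast
    qed
    then obtain l C f where f: "P (b k) \<in> van l" "C \<ge> 0" "lfun f" "\<And>v. norm (f v) \<le> C * p l v"
        "\<And>v. f (P v) = f v" "f (P (b k)) = 1"
      using functional_step[OF P(1,2) P(2)] by metis
    define P' where "P' v = P v - smul (f v) (P (b k))" for v
    have "- P (b k) \<in> van l" using subspace_neg[OF subspace_van] f(1) by blast
    then have "tame (\<lambda>v. P v + smul (f v) (- P (b k)))"
      by (intro tame_add P(1) tame_rank_one[OF f(3,2,4)])
    then have tame: "tame P'" by (simp add: P'_def[abs_def])
    have "P (P' v) = P' v" for v by (simp add: P'_def lP P(2))
    moreover have "f (P' v) = 0" for v
      using f(5)[of v] f(6) lfun_rules[OF f(3)] by (simp add: P'_def)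
    ultimately have idem: "P' (P' v) = P' v" for v by (simp add: P'_def[of "P' v"])
    have mono: "span (b ` {..<k}) \<subseteq> span (b ` {..<Suc k})" by (intro span_mono) auto
    have "v - P' v \<in> span (b ` {..<Suc k})" for v
    proof -
      have "b k - P (b k) \<in> span (b ` {..<Suc k})" using P(3) mono by blast
      then have "P (b k) \<in> span (b ` {..<Suc k})"
        using span_diff[OF span_base[of "b k" "b ` {..<Suc k}"]] by fastforce
      then have "(v - P v) + smul (f v) (P (b k)) \<in> span (b ` {..<Suc k})"
        using P(3) mono by (intro span_add span_scale) auto
      then show ?thesis by (simp add: P'_def algebra_simps)
    qed
    then have "I (Suc k) P'" using tame idem by (simp add: I_def)
    moreover have "R k P P'" unfolding R_def G_def using f
      by (intro exI[of _ l] exI[of _ C] exI[of _ f]) (simp add: P'_def[abs_def])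
    ultimately show "\<exists>P'. I (Suc k) P' \<and> R k P P'" by blast
  qed
  then obtain Q where Q: "\<And>k. I k (Q k)" "\<And>k. R k (Q k) (Q (Suc k))" by blast
  define e where "e k = Q k (b k)" for k
  obtain l C f where "\<And>k. G k (Q k) (Q (Suc k)) (l k) (C k) (f k)"
    using Q(2) unfolding R_def by metis
  then have f: "\<And>k. e k \<in> van (l k)" "\<And>k. C k \<ge> (0::real)" "\<And>k. lfun (f k)"
    "\<And>k v. norm (f k v) \<le> C k * p (l k) v" "\<And>k v. f k (Q k v) = f k v" "\<And>k. f k (e k) = 1"
    "\<And>k v. Q (Suc k) v = Q k v - smul (f k v) (e k)"
    unfolding G_def e_def by (blast | metis)+
  have idem: "Q k (Q k v) = Q k v" and Qb: "v - Q k v \<in> span (b ` {..<k})" for k v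
    using Q(1)[of k] by (auto simp: I_def)
  \<comment> \<open>One half of biorthogonality: \<open>f k\<close> factors through
    \<open>Q k\<close>, which kills the earlier \<open>e j\<close>.\<close>
  have Qe: "Q k (e j) = 0" if "j < k" for j k
    using that
  proof (induction k)
    case (Suc k)
    show ?case
    proof (cases "j = k")
      case True
      then show ?thesis using f(6)[of k] f(7)[of k "e k"] idem[of k "b k"] by (simp add: e_def)
    next
      case False
      then have z: "Q k (e j) = 0" using Suc by simp
      then have "f k (e j) = 0" using f(5)[of k "e j"] lfun_zero[OF f(3)] by simp
      then show ?thesis using z by (simp add: f(7))
    qed
  qed simp
  \<comment> \<open>The other half: \<open>e k\<close> lies in the range of \<open>Q k\<close>, on
    which the earlier functionals vanish.\<close>
  have fQ: "f j (Q k v) = 0" if "j < k" for j k v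
    using that
  proof (induction k arbitrary: v)
    case (Suc k)
    have fk: "f j (Q (Suc k) v) = f j (Q k v) - f k v * f j (e k)"
      by (simp add: f(7) lfun_rules[OF f(3)])
    show ?case
    proof (cases "j = k")
      case True
      then show ?thesis using fk f(5,6) by simp
    next
      case False
      then show ?thesis using fk Suc by (simp add: e_def)
    qed
  qed simp
  have bi: "f k (e j) = (if j = k then 1 else 0)" for j k
  proof -
    consider "j = k" | "j < k" | "k < j" by linarith
    then show ?thesis
    proof cases
      case 2
      then have "f k (Q k (e j)) = 0" using Qe lfun_zero[OF f(3)] by simp
      then show ?thesis using 2 f(5) by simp
    next
      case 3
      then show ?thesis using fQ by (simp add: e_def)
    qed (use f in auto)
  qed
  have Qsum: "v - Q k v = (\<Sum>j<k. smul (f j v) (e j))" for k v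
  proof (induction k)
    case 0
    then show ?case using Qb[of v 0] by simp
  next
    case (Suc k)
    have "v - Q (Suc k) v = (v - Q k v) + smul (f k v) (e k)" by (simp add: f(7))
    then show ?case using Suc by simp
  qed
  have "e k \<in> span (range b)" for k
  proof -
    have "b k - Q k (b k) \<in> span (range b)" using Qb[of "b k" k] span_mono[of "b ` {..<k}" "range b"] by blast
    then show ?thesis
      using span_diff[OF span_base[of "b k" "range b"]] by (fastforce simp: e_def)
  qed
  moreover have "b k \<in> span (range e)" for k
  proof -
    have "b k = e k + (\<Sum>j<k. smul (f j (b k)) (e j))" using Qsum[of "b k" k] by (simp add: e_def algebra_simps)
    also have "\<dots> \<in> span (range e)" by (intro span_add span_sum span_scale span_base) auto
    finally show ?thesis .
  qed
  ultimately have "span (range e) = span (range b)"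
    by (intro antisym span_minimal subspace_span) auto
  then show ?thesis using that[of e l C f] f bi by blast
qed

text \<open>The diagonal condition \<open>d\<close> bounds term \<open>k\<close> of the series in
  \<open>p m\<close> by a multiple of 2^-k as soon as k >= m. Condition \<open>r\<close> says that,
  for fixed \<open>m\<close>, the terms visible to \<open>p m\<close> use functionals of bounded
  order, so that one seminorm bounds the whole sum.\<close>

lemma nuclear_operator:
  assumes g: "\<And>k. lfun (g k)" "\<And>k. C k \<ge> 0" "\<And>k v. norm (g k v) \<le> C k * p (r k) v"
    and d: "\<And>k. C k * p k (d k) \<le> 1 / 2 ^ k"
    and r: "\<And>m. \<exists>n. \<forall>k. p m (d k) \<noteq> 0 \<longrightarrow> r k \<le> n"
  obtains S where "cont_lin S" "\<And>v. conv (\<lambda>n. \<Sum>k<n. smul (g k v) (d k)) (S v)"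
proof -
  define s where "s v n = (\<Sum>k<n. smul (g k v) (d k))" for v n
  have step: "\<exists>n. \<forall>v. \<forall>k\<ge>m. p m (s v (Suc k) - s v k) \<le> p n v / 2 ^ k" for m
  proof -
    obtain n where n: "\<And>k. p m (d k) \<noteq> 0 \<Longrightarrow> r k \<le> n" using r by blast
    have "p m (s v (Suc k) - s v k) \<le> p n v / 2 ^ k" if "m \<le> k" for v k
    proof (cases "p m (d k) = 0")
      case True
      then show ?thesis by (simp add: s_def p_scale)
    next
      case False
      have "p m (s v (Suc k) - s v k) = norm (g k v) * p m (d k)" by (simp add: s_def p_scale)
      also have "\<dots> \<le> (C k * p n v) * p k (d k)"
        using g(3)[of k v] p_mono[OF n[OF False], of v] p_mono[OF that] g(2)[of k]
        by (intro mult_mono) (auto intro: order_trans mult_left_mono)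
      also have "\<dots> = (C k * p k (d k)) * p n v" by simp
      also have "\<dots> \<le> (1 / 2 ^ k) * p n v" using d by (intro mult_right_mono) auto
      finally show ?thesis by simp
    qed
    then show ?thesis by blast
  qed
  have "\<exists>l. conv (s v) l" for v
  proof -
    have "\<exists>B K. \<forall>k\<ge>K. p m (s v (Suc k) - s v k) \<le> B / 2 ^ k" for m
      using step by blast
    then show ?thesis using geometric_conv by blast
  qed
  then obtain S where S: "\<And>v. conv (s v) (S v)" by metis
  have "lin S"
  proof (rule linI)
    fix x y
    have "s (x + y) = (\<lambda>i. s x i + s y i)"
      by (simp add: s_def fun_eq_iff lfun_rules[OF g(1)] scale_left_distrib sum.distrib)
    then show "S (x + y) = S x + S y" using S conv_add conv_unique by metis
  next
    fix c x
    have "s (smul c x) = (\<lambda>i. smul c (s x i))"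
      by (simp add: s_def fun_eq_iff lfun_rules[OF g(1)] scale_sum_right)
    then show "S (smul c x) = smul c (S x)" using S conv_scale conv_unique by metis
  qed
  moreover have "\<exists>n. \<exists>K\<ge>0. \<forall>v. p m (S v) \<le> K * p n v" for m
  proof -
    obtain n where n: "\<And>v k. k \<ge> m \<Longrightarrow> p m (s v (Suc k) - s v k) \<le> p n v / 2 ^ k"
      using step by blast
    obtain n' where n': "\<And>k. p m (d k) \<noteq> 0 \<Longrightarrow> r k \<le> n'" using r by blast
    define K where "K = (\<Sum>k<m. C k * p m (d k))"
    have K: "K \<ge> 0" unfolding K_def using g(2) by (intro sum_nonneg) auto
    \<comment> \<open>The 2 comes from the geometric tail, \<open>K\<close> from the first
      \<open>m\<close> terms, which the diagonal bound does not reach.\<close>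
    have "p m (S v) \<le> (2 + K) * p (max n n') v" for v
    proof -
      have "p m (S v - s v m) \<le> 2 * p n v / 2 ^ m"
        by (rule conv_geometric_le[OF S n]) auto
      also have "\<dots> \<le> 2 * p n v" using mult_left_mono[of 1 "2 ^ m" "2 * p n v"] by (simp add: divide_le_eq)
      finally have 1: "p m (S v - s v m) \<le> 2 * p (max n n') v"
        using p_mono[of n "max n n'" v] by simp
      have "p m (s v m) \<le> (\<Sum>k<m. p m (smul (g k v) (d k)))" unfolding s_def by (rule p_sum)
      also have "\<dots> \<le> (\<Sum>k<m. (C k * p m (d k)) * p (max n n') v)"
      proof (rule sum_mono)
        fix k
        show "p m (smul (g k v) (d k)) \<le> (C k * p m (d k)) * p (max n n') v"
        proof (cases "p m (d k) = 0")
          case False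
          then have "p (r k) v \<le> p (max n n') v" using n' by (intro p_mono) (auto simp: le_max_iff_disj)
          then have "norm (g k v) \<le> C k * p (max n n') v"
            using g(2,3) by (meson mult_left_mono order_trans)
          then have "norm (g k v) * p m (d k) \<le> (C k * p (max n n') v) * p m (d k)"
            by (intro mult_right_mono) auto
          then show ?thesis by (simp add: p_scale mult_ac)
        qed (simp add: p_scale)
      qed
      also have "\<dots> = K * p (max n n') v" by (simp add: K_def sum_distrib_right)
      finally have "p m (s v m) \<le> K * p (max n n') v" .
      then show ?thesis using 1 p_add[of m "S v - s v m" "s v m"] by (simp add: algebra_simps)
    qed
    then show ?thesis using K by (intro exI[of _ "max n n'"] exI[of _ "2 + K"]) auto
  qed
  ultimately show ?thesis using that[of S] S by (auto simp: cont_lin_def s_def[abs_def])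
qed

section \<open>Jointly hypercyclic sequences\<close>

text \<open>A Baire argument in the product of the \<open>W i\<close>, carried out with shrinking
  balls. Mixing, unlike mere transitivity, provides one exponent for finitely many coordinates at
  once; this is what makes the approximation joint.\<close>

lemma hypercyclic_sequence:
  assumes T: "cont_lin T"
    and W: "\<And>i s l. conv s l \<Longrightarrow> (\<And>k. s k \<in> W i) \<Longrightarrow> l \<in> W i"
    and mix: "\<And>i x y m e. x \<in> W i \<Longrightarrow> e > 0 \<Longrightarrow>
      \<exists>N. \<forall>n\<ge>N. \<exists>z\<in>W i. p m (z - x) < e \<and> p m ((T ^^ n) z - y) < e"
    and d: "\<And>i. d i \<in> W i"
  obtains y where "\<And>i. y i \<in> W i" "\<And>i. p i (y i - d i) \<le> 1 / 2 ^ i"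
    "\<And>xs m e. e > 0 \<Longrightarrow> \<exists>n. \<forall>i<length xs. p m ((T ^^ n) (y i) - q (xs ! i :: nat)) < e"
proof -
  \<comment> \<open>Varying the second component of the code makes every list of targets recur at
    arbitrarily late stages. This matters because stage \<open>k\<close> treats only coordinates
    below \<open>k\<close>, with precision 2^-k.\<close>
  define xs where "xs k = list_decode (fst (prod_decode k))" for k
  \<comment> \<open>\<open>c\<close> holds the centres, \<open>N\<close> the index of the seminorm,
    \<open>e\<close> the radius. Coordinates from \<open>k\<close> on still equal
    \<open>d i\<close>, so \<open>y i\<close> ends up within 2^-i of \<open>d i\<close>.\<close>
  define I where "I k s \<longleftrightarrow> (case s of (c, N, e) \<Rightarrow> (\<forall>i. c i \<in> W i) \<and> 0 < e \<and> e \<le> 1 / 2 ^ k \<and> k \<le> N \<and>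
      (\<forall>i\<ge>k. c i = d i))" for k :: nat and s :: "(nat \<Rightarrow> 'a) \<times> nat \<times> real"
  define R where "R k s s' \<longleftrightarrow> (case (s, s') of ((c, N, e), (c', N', e')) \<Rightarrow> N \<le> N' \<and> e' \<le> e / 2 \<and>
      (\<forall>i. p N (c' i - c i) \<le> e / 2) \<and>
      (\<exists>n. \<forall>i<min k (length (xs k)). \<forall>v. p N' (v - c' i) \<le> e' \<longrightarrow>
          p k ((T ^^ n) v - q (xs k ! i)) < 1 / 2 ^ k))"
    for k :: nat and s s' :: "(nat \<Rightarrow> 'a) \<times> nat \<times> real"
  have "\<exists>s. \<forall>k. I k (s k) \<and> R k (s k) (s (Suc k))"
  proof (rule dependent_nat_choice)
    show "\<exists>s. I 0 s" using d by (intro exI[of _ "(d, 0, 1)"]) (auto simp: I_def)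
  next
    fix s k assume "I k s"
    then obtain c N e where s: "s = (c, N, e)" and c: "\<And>i. c i \<in> W i" and e: "0 < e" "e \<le> 1 / 2 ^ k"
      and N: "k \<le> N" and cd: "\<And>i. i \<ge> k \<Longrightarrow> c i = d i"
      by (cases s) (auto simp: I_def)
    define r where "r = min k (length (xs k))"
    define h where "h = min (e / 2) (1 / 2 ^ Suc k)"
    have h: "h > 0" using e by (simp add: h_def)
    have "\<exists>n0. \<forall>i<r. \<forall>n\<ge>n0. \<exists>z\<in>W i. p N (z - c i) < h \<and> p N ((T ^^ n) z - q (xs k ! i)) < h"
    proof -
      have "\<forall>i. \<exists>n0. \<forall>n\<ge>n0. \<exists>z\<in>W i. p N (z - c i) < h \<and> p N ((T ^^ n) z - q (xs k ! i)) < h"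
        using mix c h by blast
      then obtain n0 where n0: "\<And>i n. n \<ge> n0 i \<Longrightarrow>
          \<exists>z\<in>W i. p N (z - c i) < h \<and> p N ((T ^^ n) z - q (xs k ! i)) < h" by metis
      show ?thesis
      proof (intro exI[of _ "\<Sum>i<r. n0 i"] allI impI)
        fix i n assume i: "i < r" "(\<Sum>i<r. n0 i) \<le> n"
        have "n0 i \<le> (\<Sum>i<r. n0 i)" using i(1) by (intro member_le_sum) auto
        then show "\<exists>z\<in>W i. p N (z - c i) < h \<and> p N ((T ^^ n) z - q (xs k ! i)) < h"
          using n0 i(2) by simp
      qed
    qed
    then obtain n where "\<forall>i<r. \<exists>z\<in>W i. p N (z - c i) < h \<and> p N ((T ^^ n) z - q (xs k ! i)) < h"
      by blast
    then obtain z where z: "\<And>i. i < r \<Longrightarrow> z i \<in> W i" "\<And>i. i < r \<Longrightarrow> p N (z i - c i) < h"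
      "\<And>i. i < r \<Longrightarrow> p N ((T ^^ n) (z i) - q (xs k ! i)) < h" by metis
    obtain n' \<delta> where \<delta>: "\<delta> > 0" "\<And>v. p n' v < \<delta> \<Longrightarrow> p k ((T ^^ n) v) < 1 / 2 ^ Suc k"
      using cont_lin_small[OF cont_lin_funpow[OF T], of "1 / 2 ^ Suc k" k n] zero_less_power[of 2 "Suc k"]
      by (metis zero_less_divide_1_iff zero_less_numeral)
    define c' where "c' i = (if i < r then z i else c i)" for i
    define N' where "N' = max N (max n' (Suc k))"
    define e' where "e' = min (e / 2) (\<delta> / 2)"
    have "I (Suc k) (c', N', e')"
      using c z(1) e \<delta>(1) cd by (auto simp: I_def c'_def N'_def e'_def r_def min_le_iff_disj)
    moreover have "R k s (c', N', e')"
    proof -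
      have "p N (c' i - c i) \<le> e / 2" for i
        using z(2)[of i] e by (auto simp: c'_def h_def)
      moreover have "p k ((T ^^ n) v - q (xs k ! i)) < 1 / 2 ^ k"
        if i: "i < r" and v: "p N' (v - c' i) \<le> e'" for i v
      proof -
        have "p n' (v - z i) \<le> p N' (v - z i)" by (intro p_mono) (auto simp: N'_def)
        also have "\<dots> < \<delta>" using v i \<delta>(1) by (simp add: c'_def e'_def)
        finally have 1: "p k ((T ^^ n) v - (T ^^ n) (z i)) < 1 / 2 ^ Suc k"
          using \<delta>(2) lin_diff[OF cont_lin_lin[OF cont_lin_funpow[OF T]]] by metis
        have "p k ((T ^^ n) (z i) - q (xs k ! i)) \<le> p N ((T ^^ n) (z i) - q (xs k ! i))"
          using N by (rule p_mono)
        also have "\<dots> < 1 / 2 ^ Suc k" using z(3)[OF i] by (simp add: h_def)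
        finally show ?thesis
          using 1 p_triangle[of k "(T ^^ n) v" "q (xs k ! i)" "(T ^^ n) (z i)"] by simp
      qed
      ultimately show ?thesis unfolding R_def s r_def N'_def e'_def by auto
    qed
    ultimately show "\<exists>s'. I (Suc k) s' \<and> R k s s'" by blast
  qed
  then obtain s where s: "\<And>k. I k (s k)" "\<And>k. R k (s k) (s (Suc k))" by blast
  define c where "c k = fst (s k)" for k
  define N where "N k = fst (snd (s k))" for k
  define e where "e k = snd (snd (s k))" for k
  have c: "c k i \<in> W i" and e: "0 < e k" "e k \<le> 1 / 2 ^ k" and N: "k \<le> N k"
    and cd: "k \<le> i \<Longrightarrow> c k i = d i" for k i
    using s(1)[of k] by (auto simp: I_def c_def e_def N_def split: prod.splits)
  have NS: "N k \<le> N (Suc k)" and eS: "e (Suc k) \<le> e k / 2"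
    and cS: "p (N k) (c (Suc k) i - c k i) \<le> e k / 2"
    and task: "\<exists>n. \<forall>i<min k (length (xs k)). \<forall>v. p (N (Suc k)) (v - c (Suc k) i) \<le> e (Suc k) \<longrightarrow>
          p k ((T ^^ n) v - q (xs k ! i)) < 1 / 2 ^ k" for k i
    using s(2)[of k] by (auto simp: R_def c_def e_def N_def split: prod.splits)
  have "\<exists>l. conv (\<lambda>k. c k i) l" for i
  proof -
    have "p m (c (Suc k) i - c k i) \<le> 1 / 2 ^ k" if "k \<ge> m" for m k
    proof -
      have "p m (c (Suc k) i - c k i) \<le> p (N k) (c (Suc k) i - c k i)"
        using that N[of k] by (intro p_mono) auto
      also have "\<dots> \<le> 1 / 2 ^ k" using cS[of k i] e[of k] by linarith
      finally show ?thesis .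
    qed
    then show ?thesis using geometric_conv[of "\<lambda>k. c k i"] by metis
  qed
  then obtain y where y: "\<And>i. conv (\<lambda>k. c k i) (y i)" by metis
  have mN: "N k \<le> N j" if "k \<le> j" for k j using NS lift_Suc_mono_le that by blast
  \<comment> \<open>The move at each stage and the next radius are both at most half of the current
    radius, so the balls are nested.\<close>
  have yc: "p (N k) (y i - c k i) \<le> e k" for i k
  proof (rule conv_le[OF y])
    fix j assume "k \<le> j"
    then have "p (N k) (c j i - c k i) \<le> e k - e j"
    proof (induction j rule: dec_induct)
      case (step j)
      have "p (N k) (c (Suc j) i - c k i) \<le> p (N k) (c (Suc j) i - c j i) + p (N k) (c j i - c k i)"
        by (rule p_triangle)
      also have "p (N k) (c (Suc j) i - c j i) \<le> p (N j) (c (Suc j) i - c j i)"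
        using mN step by (intro p_mono) auto
      finally show ?case using cS[of j i] eS[of j] step by linarith
    qed simp
    then show "p (N k) (c j i - c k i) \<le> e k" using e(1)[of j] by linarith
  qed
  show ?thesis
  proof (rule that[of y])
    show "y i \<in> W i" for i using W[OF y] c by blast
    show "p i (y i - d i) \<le> 1 / 2 ^ i" for i
      using p_mono[OF N, of i "y i - d i"] yc[of i i] cd[of i i] e(2)[of i] by simp
    fix zs m and \<epsilon> :: real assume "\<epsilon> > 0"
    obtain j where j: "1 / 2 ^ j < \<epsilon>"
      using real_arch_pow_inv[OF \<open>\<epsilon> > 0\<close>, of "1/2"] by (auto simp: power_one_over)
    define k where "k = prod_encode (list_encode zs, max j (max m (length zs)))"
    have k: "max j (max m (length zs)) \<le> k" unfolding k_def by (rule le_prod_encode_2)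
    have xk: "xs k = zs" by (simp add: xs_def k_def)
    have "(1::real) / 2 ^ k \<le> 1 / 2 ^ j" using k by (intro divide_left_mono power_increasing) auto
    then have small: "1 / 2 ^ k < \<epsilon>" using j by linarith
    obtain n where n: "\<And>i v. i < min k (length (xs k)) \<Longrightarrow> p (N (Suc k)) (v - c (Suc k) i) \<le> e (Suc k)
      \<Longrightarrow> p k ((T ^^ n) v - q (xs k ! i)) < 1 / 2 ^ k"
      using task[of k] by blast
    have "p m ((T ^^ n) (y i) - q (zs ! i)) < \<epsilon>" if "i < length zs" for i
    proof -
      have "p m ((T ^^ n) (y i) - q (zs ! i)) \<le> p k ((T ^^ n) (y i) - q (zs ! i))"
        using k by (intro p_mono) auto
      also have "\<dots> < 1 / 2 ^ k" using n[of i "y i"] that k yc xk by auto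
      finally show ?thesis using small by linarith
    qed
    then show "\<exists>n. \<forall>i<length zs. p m ((T ^^ n) (y i) - q (zs ! i)) < \<epsilon>" by blast
  qed
qed

section \<open>Polynomials in an operator\<close>

definition poly_op :: "('a \<Rightarrow> 'a) \<Rightarrow> 'k poly \<Rightarrow> 'a \<Rightarrow> 'a" where
  "poly_op T P x = (\<Sum>i\<le>degree P. smul (coeff P i) ((T ^^ i) x))"

lemma poly_op_altdef: "degree P \<le> n \<Longrightarrow> poly_op T P x = (\<Sum>i\<le>n. smul (coeff P i) ((T ^^ i) x))"
  unfolding poly_op_def by (rule sum.mono_neutral_left) (auto simp: coeff_eq_0)

lemma poly_op_0 [simp]: "poly_op T 0 x = 0"
  by (simp add: poly_op_def)

lemma poly_op_add: "poly_op T (P + Q) x = poly_op T P x + poly_op T Q x"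
proof -
  define n where "n = max (degree P) (degree Q)"
  have "degree P \<le> n" "degree Q \<le> n" "degree (P + Q) \<le> n"
    by (auto simp: n_def degree_add_le_max)
  then show ?thesis by (simp add: poly_op_altdef[of _ n] scale_left_distrib sum.distrib)
qed

lemma poly_op_pCons: "poly_op T (pCons a P) x = smul a x + poly_op T P (T x)"
proof -
  have "poly_op T (pCons a P) x = (\<Sum>i\<le>Suc (degree P). smul (coeff (pCons a P) i) ((T ^^ i) x))"
    by (intro poly_op_altdef) (auto simp: degree_pCons_le)
  also have "\<dots> = smul a x + poly_op T P (T x)"
    unfolding poly_op_def by (subst sum.atMost_Suc_shift) (simp add: funpow_swap1)
  finally show ?thesis .
qed

lemma cont_lin_poly_op: "cont_lin T \<Longrightarrow> cont_lin (poly_op T P)"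
proof (induction P)
  case 0
  then show ?case unfolding cont_lin_def by (auto intro!: linI exI[of _ "0::real"])
next
  case (pCons a P)
  then have "cont_lin (\<lambda>x. smul a x + poly_op T P (T x))"
    using cont_lin_add[OF cont_lin_scale[OF cont_lin_id, of a] cont_lin_comp[of "poly_op T P" T]] by blast
  then show ?case by (simp add: poly_op_pCons[abs_def])
qed

lemma lin_poly_op:
  assumes "lin T"
  shows "lin (poly_op T P)"
proof (induction P)
  case 0
  then show ?case by (intro linI) auto
next
  case (pCons a P)
  then show ?case
    by (intro linI) (simp_all add: poly_op_pCons lin_rules[OF assms] lin_rules[OF pCons.IH]
        scale_right_distrib mult.commute)
qed

lemma poly_op_commute:
  assumes "lin T"
  shows "poly_op T P (T x) = T (poly_op T P x)"
  by (simp add: poly_op_def lin_rules[OF assms] funpow_swap1)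

lemma poly_op_funpow:
  assumes "lin T"
  shows "(T ^^ n) (poly_op T P x) = poly_op T P ((T ^^ n) x)"
  by (induction n) (simp_all add: poly_op_commute[OF assms])

text \<open>Since \<open>poly_op T P\<close> commutes with \<open>T\<close>, density of its range
  makes it map hypercyclic vectors to hypercyclic vectors.\<close>

definition poly_dense_range :: "('a \<Rightarrow> 'a) \<Rightarrow> bool" where
  "poly_dense_range T \<longleftrightarrow> (\<forall>P x m. \<forall>e>0. P \<noteq> 0 \<longrightarrow> (\<exists>z. p m (poly_op T P z - x) < e))"

text \<open>If \<open>P 0 \<noteq> 0\<close>, the identity expressing \<open>x\<close> by \<open>P(S) x\<close> and the vectors \<open>S x, S\<^sup>2 x, \<dots>\<close> is a
  contraction for the distances of the \<open>S\<^sup>i x\<close> to the range of \<open>P(S)\<close>.\<close>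

lemma poly_dense_rangeI:
  assumes S: "cont_lin S"
    and dense: "\<And>x m e. e > 0 \<Longrightarrow> \<exists>y\<in>D. p m (y - x) < e"
    and surj: "\<And>x. x \<in> D \<Longrightarrow> \<exists>y\<in>D. S y = x"
    and decay: "\<And>x m \<theta>. x \<in> D \<Longrightarrow> \<theta> > 0 \<Longrightarrow> \<exists>B. \<forall>i. p m ((S ^^ i) x) \<le> B * \<theta> ^ i"
  shows "poly_dense_range S"
proof -
  note lS = cont_lin_lin[OF S]
  have *: "\<exists>z. p m (poly_op S P z - x) < e" if "P \<noteq> 0" "x \<in> D" "e > 0" for P x m e
    using that
  proof (induction P arbitrary: x m e)
    case (pCons a P)
    show ?case
    proof (cases "a = 0")
      \<comment> \<open>The polynomial has a factor X: the other factor is used to approximate a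
        preimage of \<open>x\<close> under \<open>S\<close>.\<close>
      case True
      obtain y where y: "y \<in> D" "S y = x" using surj pCons.prems by blast
      obtain n d where nd: "d > 0" "\<And>v. p n v < d \<Longrightarrow> p m (S v) < e"
        using cont_lin_small[OF S \<open>e > 0\<close>] by metis
      obtain z where "p n (poly_op S P z - y) < d"
        using pCons True y(1) nd(1) by blast
      then have "p m (S (poly_op S P z) - x) < e" using nd(2) y(2) lin_diff[OF lS] by metis
      then show ?thesis using True by (auto simp: poly_op_pCons poly_op_commute[OF lS])
    next
      case False
      define Q where "Q = pCons a P"
      define h where "h i = (S ^^ i) x" for i
      define K where "K = (\<Sum>j\<le>degree P. norm (coeff P j))"
      \<comment> \<open>Chosen so that \<open>K * \<theta>\<close> is at most half of
        \<open>norm a\<close>; each round of the approximation below then halves the error.\<close>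
      define \<theta> where "\<theta> = min 1 (norm a / (2 * (K + 1)))"
      have K: "K \<ge> 0" unfolding K_def by (intro sum_nonneg) auto
      then have th: "0 < \<theta>" "\<theta> \<le> 1" "K * \<theta> \<le> norm a / 2"
      proof -
        show "0 < \<theta>" "\<theta> \<le> 1" using K False by (auto simp: \<theta>_def)
        have "K * \<theta> \<le> K * (norm a / (2 * (K + 1)))"
          using K by (intro mult_left_mono) (auto simp: \<theta>_def)
        also have "\<dots> = (K / (K + 1)) * (norm a / 2)" by simp
        also have "\<dots> \<le> 1 * (norm a / 2)" using K by (intro mult_right_mono) auto
        finally show "K * \<theta> \<le> norm a / 2" by simp
      qed
      obtain B where B: "\<And>i. p m (h i) \<le> B * \<theta> ^ i"
        using decay[OF \<open>x \<in> D\<close> th(1), of m] by (auto simp: h_def)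
      have Bn: "B \<ge> 0" using order_trans[OF p_nonneg B[of 0]] by simp
      have lQ: "lin (poly_op S Q)" by (rule lin_poly_op[OF lS])
      have Qh: "poly_op S Q (h i) = smul a (h i) + (\<Sum>j\<le>degree P. smul (coeff P j) (h (i + Suc j)))" for i
      proof -
        have "(S ^^ j) (S (h i)) = h (i + Suc j)" for j
        proof -
          have "i + Suc j = j + Suc i" by simp
          then show ?thesis unfolding h_def by (simp only: funpow_add funpow.simps o_apply)
        qed
        then show ?thesis unfolding Q_def poly_op_pCons by (simp add: poly_op_def)
      qed
      \<comment> \<open>All \<open>i\<close> are treated together, since the improved approximation
        of \<open>h i\<close> uses those of the later \<open>h (i + Suc j)\<close>.\<close>
      have claim: "\<exists>z. p m (poly_op S Q z - h i) \<le> B * \<theta> ^ i / 2 ^ n" for n i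
      proof (induction n arbitrary: i)
        case 0
        then show ?case using B[of i] lin_zero[OF lQ] by (intro exI[of _ 0]) simp
      next
        case (Suc n)
        then obtain z where z: "\<And>i. p m (poly_op S Q (z i) - h i) \<le> B * \<theta> ^ i / 2 ^ n" by metis
        define w where "w = smul (1 / a) (h i - (\<Sum>j\<le>degree P. smul (coeff P j) (z (i + Suc j))))"
        define E where "E = (\<Sum>j\<le>degree P. smul (coeff P j) (poly_op S Q (z (i + Suc j)) - h (i + Suc j)))"
        have "poly_op S Q w = smul (1 / a) (smul a (h i) - E)"
          unfolding w_def E_def lin_rules[OF lQ] Qh
          by (simp add: scale_right_diff_distrib sum_subtractf algebra_simps)
        then have "poly_op S Q w - h i = - smul (1 / a) E"
          using False by (simp add: scale_right_diff_distrib)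
        then have "p m (poly_op S Q w - h i) = p m E / norm a"
          by (simp add: p_scale norm_divide)
        also have "p m E \<le> (\<Sum>j\<le>degree P. norm (coeff P j) * (B * \<theta> ^ i / 2 ^ n * \<theta>))"
          unfolding E_def
        proof (rule order_trans[OF p_sum sum_mono], unfold p_scale)
          fix j
          have 1: "p m (poly_op S Q (z (i + Suc j)) - h (i + Suc j)) \<le> B * \<theta> ^ (i + Suc j) / 2 ^ n" by (rule z)
          have "\<theta> ^ (i + Suc j) \<le> \<theta> ^ Suc i" using th by (intro power_decreasing) auto
          then have "B * \<theta> ^ (i + Suc j) / 2 ^ n \<le> B * \<theta> ^ Suc i / 2 ^ n"
            using Bn by (intro divide_right_mono mult_left_mono) auto
          with 1 have "p m (poly_op S Q (z (i + Suc j)) - h (i + Suc j)) \<le> B * \<theta> ^ i / 2 ^ n * \<theta>"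
            by (simp add: mult_ac)
          then show "norm (coeff P j) * p m (poly_op S Q (z (i + Suc j)) - h (i + Suc j))
              \<le> norm (coeff P j) * (B * \<theta> ^ i / 2 ^ n * \<theta>)" by (intro mult_left_mono) auto
        qed
        also have "\<dots> = (B * \<theta> ^ i / 2 ^ n) * (K * \<theta>)"
          by (simp add: K_def sum_distrib_right sum_distrib_left sum_divide_distrib mult_ac)
        also have "\<dots> \<le> (B * \<theta> ^ i / 2 ^ n) * (norm a / 2)"
          using th Bn by (intro mult_left_mono) auto
        finally show ?case using False
          by (intro exI[of _ w]) (simp add: divide_right_mono field_simps)
      qed
      have "(\<lambda>n. B / 2 ^ n) \<longlonglongrightarrow> 0" by (rule LIMSEQ_divide_realpow_zero) simp
      then obtain n where "norm (B / 2 ^ n - 0) < e" using LIMSEQ_D \<open>e > 0\<close> by blast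
      then have "B / 2 ^ n < e" using Bn by simp
      moreover obtain z where "p m (poly_op S Q z - h 0) \<le> B * \<theta> ^ 0 / 2 ^ n" using claim by blast
      ultimately show ?thesis by (intro exI[of _ z]) (simp add: Q_def h_def)
    qed
  qed simp
  show ?thesis
    unfolding poly_dense_range_def
  proof (intro allI impI)
    fix P :: "'k poly" and x m and e :: real assume P: "P \<noteq> 0" and e: "e > 0"
    obtain y where y: "y \<in> D" "p m (y - x) < e / 2" using dense[of "e / 2"] e by auto
    obtain z where "p m (poly_op S P z - y) < e / 2" using *[OF P y(1), of "e / 2"] e by auto
    then show "\<exists>z. p m (poly_op S P z - x) < e"
      using y(2) p_triangle[of m "poly_op S P z" x y for z] by (intro exI[of _ z]) (smt (verit) field_sum_of_halves)
  qed
qed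

text \<open>A polynomial in 1 + S is a polynomial in S after the substitution X -> X + 1. This
  substitution is injective, so dense ranges are inherited by \<open>T\<close>.\<close>

lemma poly_op_shift:
  assumes "lin S" "\<And>x. T x = x + S x"
  shows "poly_op T P x = poly_op S (P \<circ>\<^sub>p [:1, 1:]) x"
proof (induction P arbitrary: x)
  case (pCons a P)
  define R where "R = P \<circ>\<^sub>p [:1, 1:]"
  have "[:1, 1:] * R = R + pCons 0 R" by simp
  then have "pCons a P \<circ>\<^sub>p [:1, 1:] = [:a:] + (R + pCons 0 R)" by (simp add: pcompose_pCons R_def)
  moreover have "poly_op S R (x + S x) = poly_op S R x + poly_op S R (S x)"
    by (rule lin_add[OF lin_poly_op[OF assms(1)]])
  ultimately show ?case
    using pCons.IH[of "T x"] by (simp add: poly_op_pCons poly_op_add R_def[symmetric] assms(2))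
qed simp

lemma poly_dense_range_shift:
  assumes "lin S" "\<And>x. T x = x + S x" "poly_dense_range S"
  shows "poly_dense_range T"
  unfolding poly_dense_range_def
proof (intro allI impI)
  fix P :: "'k poly" and x m and e :: real assume "P \<noteq> 0" "e > 0"
  have "P \<circ>\<^sub>p [:1, 1:] \<noteq> 0" using \<open>P \<noteq> 0\<close> pcompose_eq_0[of P "[:1, 1:]"] by auto
  then show "\<exists>z. p m (poly_op T P z - x) < e"
    using assms(3) \<open>e > 0\<close> by (simp add: poly_dense_range_def poly_op_shift[OF assms(1,2)])
qed

section \<open>Hypercyclicity on the span of the orbits\<close>

definition hypercyclic_vec :: "('a \<Rightarrow> 'a) \<Rightarrow> 'a \<Rightarrow> bool" where
  "hypercyclic_vec T v \<longleftrightarrow> (\<forall>x m. \<forall>e>0. \<exists>n. p m ((T ^^ n) v - x) < e)"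

text \<open>\<open>v\<close> is a sum of vectors \<open>poly_op T (P i) (y i)\<close> with some
  \<open>P i0\<close> nonzero. Joint hypercyclicity brings \<open>y i0\<close> near a vector
  \<open>z\<close> whose image under \<open>poly_op T (P i0)\<close> is near the target, and at the
  same time all other \<open>y i\<close> near 0.\<close>

lemma hypercyclic_span:
  assumes T: "cont_lin T" and range: "poly_dense_range T"
    and q: "\<And>x m e. e > 0 \<Longrightarrow> \<exists>i::nat. p m (q i - x) < e"
    and y: "\<And>xs m e. e > 0 \<Longrightarrow> \<exists>n. \<forall>i<length xs. p m ((T ^^ n) (y i) - q (xs ! i)) < e"
    and v: "v \<in> span {(T ^^ j) (y i) | i j. True}" "v \<noteq> 0"
  shows "hypercyclic_vec T v"
proof -
  define rep where "rep u \<longleftrightarrow> (\<exists>r P. (\<forall>i\<ge>r. P i = 0) \<and> u = (\<Sum>i<r. poly_op T (P i) (y i)))" for u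
  have lT: "lin T" using T by (rule cont_lin_lin)
  have "rep v"
    using v(1)
  proof (induction rule: span_induct_alt)
    case base
    show ?case unfolding rep_def by (intro exI[of _ 0] exI[of _ "\<lambda>_. 0"]) simp
  next
    case (step c x u)
    then obtain i j where x: "x = (T ^^ j) (y i)" by blast
    obtain r P where P: "\<And>i. i \<ge> r \<Longrightarrow> P i = 0" "u = (\<Sum>i<r. poly_op T (P i) (y i))"
      using step unfolding rep_def by blast
    define P' where "P' l = P l + (if l = i then monom c j else 0)" for l
    define r' where "r' = max r (Suc i)"
    have "poly_op T (monom c j) z = smul c ((T ^^ j) z)" for z
      by (subst poly_op_altdef[of _ j]) (auto simp: degree_monom_le if_distrib[of "\<lambda>c. smul c _"] cong: if_cong)
    then have "poly_op T (P' l) (y l) = poly_op T (P l) (y l) + (if l = i then smul c x else 0)" for l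
      by (simp add: P'_def poly_op_add x)
    then have "(\<Sum>l<r'. poly_op T (P' l) (y l)) = (\<Sum>l<r'. poly_op T (P l) (y l)) + smul c x"
      by (simp add: sum.distrib r'_def less_max_iff_disj)
    also have "(\<Sum>l<r'. poly_op T (P l) (y l)) = u"
      unfolding P(2) by (rule sum.mono_neutral_right) (auto simp: r'_def P(1))
    finally have "smul c x + u = (\<Sum>l<r'. poly_op T (P' l) (y l))" by simp
    moreover have "\<forall>l\<ge>r'. P' l = 0" using P(1) by (auto simp: P'_def r'_def)
    ultimately show ?case unfolding rep_def by blast
  qed
  then obtain r P where P: "v = (\<Sum>i<r. poly_op T (P i) (y i))" unfolding rep_def by blast
  obtain i0 where i0: "i0 < r" "P i0 \<noteq> 0"
    using v(2) unfolding P by (metis (no_types, lifting) lessThan_iff poly_op_0 sum.neutral)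
  show ?thesis
    unfolding hypercyclic_vec_def
  proof (intro allI impI)
    fix x m and e :: real assume e: "e > 0"
    obtain z where z: "p m (poly_op T (P i0) z - x) < e / 2"
      using range i0(2) half_gt_zero[OF e] unfolding poly_dense_range_def by blast
    define h where "h = e / (2 * real r)"
    have h: "h > 0" using e i0 by (simp add: h_def)
    have "\<forall>i. \<exists>n. \<exists>d>0. \<forall>w. p n w < d \<longrightarrow> p m (poly_op T (P i) w) < h"
      using cont_lin_small[OF cont_lin_poly_op[OF T] h] by metis
    then obtain n d where nd: "\<And>i. d i > (0::real)"
      "\<And>i w. p (n i) w < d i \<Longrightarrow> p m (poly_op T (P i) w) < h" by metis
    define M where "M = Max (n ` {..<r})"
    define \<delta> where "\<delta> = Min (d ` {..<r})"
    have "d ` {..<r} \<noteq> {}" using i0(1) by auto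
    then have \<delta>: "\<delta> > 0" unfolding \<delta>_def using nd(1) by (subst Min_gr_iff) auto
    have \<delta>_le: "i < r \<Longrightarrow> \<delta> \<le> d i" and M: "i < r \<Longrightarrow> n i \<le> M" for i
      by (auto simp: \<delta>_def M_def)
    define t where "t i = (if i = i0 then z else 0)" for i
    have "\<forall>i. \<exists>j. p M (q j - t i) < \<delta> / 2" using q half_gt_zero[OF \<delta>] by blast
    then obtain a where a: "\<And>i. p M (q (a i) - t i) < \<delta> / 2" by metis
    obtain N where N: "\<And>i. i < r \<Longrightarrow> p M ((T ^^ N) (y i) - q (a i)) < \<delta> / 2"
      using y[OF half_gt_zero[OF \<delta>], of "map a [0..<r]" M] by auto
    have small: "p m (poly_op T (P i) ((T ^^ N) (y i) - t i)) < h" if "i < r" for i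
    proof (rule nd(2))
      have "p (n i) ((T ^^ N) (y i) - t i) \<le> p M ((T ^^ N) (y i) - t i)" using M[OF that] by (rule p_mono)
      also have "\<dots> < \<delta>" using N[OF that] a[of i] p_triangle[of M "(T ^^ N) (y i)" "t i" "q (a i)"] by simp
      finally show "p (n i) ((T ^^ N) (y i) - t i) < d i" using \<delta>_le[OF that] by simp
    qed
    have lP: "lin (poly_op T (P i))" for i by (rule lin_poly_op[OF lT])
    have "(T ^^ N) v = (\<Sum>i<r. poly_op T (P i) ((T ^^ N) (y i)))"
      unfolding P by (simp add: lin_sum[OF cont_lin_lin[OF cont_lin_funpow[OF T]]] poly_op_funpow[OF lT])
    also have "\<dots> = (\<Sum>i<r. poly_op T (P i) ((T ^^ N) (y i) - t i)) + (\<Sum>i<r. poly_op T (P i) (t i))"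
      by (simp add: lin_rules[OF lP] sum_subtractf)
    also have "(\<Sum>i<r. poly_op T (P i) (t i)) = poly_op T (P i0) z"
      using i0(1) by (subst sum.remove[of _ i0]) (auto simp: t_def lin_rules[OF lP] intro!: sum.neutral)
    finally have "(T ^^ N) v - x = (\<Sum>i<r. poly_op T (P i) ((T ^^ N) (y i) - t i)) + (poly_op T (P i0) z - x)"
      by simp
    moreover have "p m (\<Sum>i<r. poly_op T (P i) ((T ^^ N) (y i) - t i)) \<le> e / 2"
    proof -
      have "p m (\<Sum>i<r. poly_op T (P i) ((T ^^ N) (y i) - t i)) \<le> (\<Sum>i<r. h)"
        using small by (intro order_trans[OF p_sum sum_mono]) (auto intro: less_imp_le)
      also have "\<dots> = e / 2" using i0(1) by (simp add: h_def)
      finally show ?thesis .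
    qed
    ultimately have "p m ((T ^^ N) v - x) < e" using z p_add by (smt (verit) field_sum_of_halves)
    then show "\<exists>n. p m ((T ^^ n) v - x) < e" by blast
  qed
qed

section \<open>Matching dense subspaces\<close>

definition van_dense :: "'a set \<Rightarrow> bool" where
  "van_dense S \<longleftrightarrow> (\<forall>n. \<forall>x\<in>van n. \<forall>m. \<forall>e>0. \<exists>y\<in>S \<inter> van n. p m (y - x) < e)"

lemma van_dense_approx:
  assumes "van_dense S" "tame Q" "tame L" "x \<in> van l" "\<eta> > 0"
  obtains s where "s \<in> S" "s \<in> van l" "p M (Q (s - x)) < \<eta>" "p M (L (Q (s - x))) < \<eta>"
proof -
  obtain n d where d: "d > 0" "\<And>v. p n v < d \<Longrightarrow> p M (Q v) < \<eta>"
    using cont_lin_small[OF tame_cont_lin[OF assms(2)] \<open>\<eta> > 0\<close>] by metis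
  obtain n' d' where d': "d' > 0" "\<And>v. p n' v < d' \<Longrightarrow> p M (L (Q v)) < \<eta>"
    using cont_lin_small[OF tame_cont_lin[OF tame_comp[OF assms(3,2)]] \<open>\<eta> > 0\<close>] by metis
  obtain s where s: "s \<in> S \<inter> van l" "p (max n n') (s - x) < min d d'"
    using assms(1,4) d(1) d'(1) unfolding van_dense_def by (metis min_less_iff_conj)
  have "p n (s - x) < d" "p n' (s - x) < d'"
    using s(2) p_mono[of n "max n n'" "s - x"] p_mono[of n' "max n n'" "s - x"] by auto
  then show ?thesis using that[of s] s(1) d(2) d'(2) by blast
qed

text \<open>\<open>J\<close> is a partial matching of \<open>E\<close> with \<open>F\<close> and \<open>L\<close> its inverse; \<open>P\<close> is a projection along the span of
  the elements of \<open>F\<close> that are matched already.\<close>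

definition matching :: "'a set \<Rightarrow> 'a set \<Rightarrow> ('a \<Rightarrow> 'a) \<times> ('a \<Rightarrow> 'a) \<times> ('a \<Rightarrow> 'a) \<Rightarrow> bool" where
  "matching E F s \<longleftrightarrow> (case s of (P, J, L) \<Rightarrow> tame P \<and> tame J \<and> tame L \<and> (\<forall>v. P (P v) = P v) \<and>
     (\<forall>v. J (L v) = v) \<and> (\<forall>v. L (J v) = v) \<and> (\<forall>v. v - P v \<in> F) \<and> (\<forall>v. L (v - P v) \<in> E))"

text \<open>Errors in \<open>p m\<close> are relative to the same \<open>p m v\<close>, which keeps
  limits tame. The last clauses freeze what is matched already, so that on each generator the
  sequence of maps becomes constant.\<close>

definition refines :: "nat \<Rightarrow> real \<Rightarrow> ('a \<Rightarrow> 'a) \<times> ('a \<Rightarrow> 'a) \<times> ('a \<Rightarrow> 'a) \<Rightarrow>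
    ('a \<Rightarrow> 'a) \<times> ('a \<Rightarrow> 'a) \<times> ('a \<Rightarrow> 'a) \<Rightarrow> bool" where
  "refines k \<epsilon> s s' \<longleftrightarrow> (case (s, s') of ((P, J, L), (P', J', L')) \<Rightarrow>
     (\<forall>m\<le>k. \<forall>v. p m (J' v - J v) \<le> \<epsilon> * p m v \<and> p m (L' v - L v) \<le> \<epsilon> * p m v) \<and>
     (\<forall>v. P (J v) = 0 \<longrightarrow> J' v = J v) \<and> (\<forall>w. P w = 0 \<longrightarrow> P' w = 0 \<and> L' w = L w))"

lemma refines_refl: "\<epsilon> \<ge> 0 \<Longrightarrow> refines k \<epsilon> s s"
  by (auto simp: refines_def split: prod.splits)

lemma refines_trans:
  assumes "refines k \<epsilon> s s'" "refines k \<epsilon>' s' s''"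
  shows "refines k (\<epsilon> + \<epsilon>') s s''"
proof -
  obtain P J L P' J' L' P'' J'' L'' where s: "s = (P, J, L)" "s' = (P', J', L')" "s'' = (P'', J'', L'')"
    by (metis prod_cases3)
  have "p m (J'' v - J v) \<le> (\<epsilon> + \<epsilon>') * p m v" "p m (L'' v - L v) \<le> (\<epsilon> + \<epsilon>') * p m v" if "m \<le> k" for m v
    using assms that p_triangle[of m "J'' v" "J v" "J' v"] p_triangle[of m "L'' v" "L v" "L' v"]
    unfolding refines_def s prod.case distrib_right by (smt (verit))+
  then show ?thesis using assms unfolding refines_def s by auto
qed

text \<open>The two regimes of \<open>tame_rank_one\<close>, with explicit constants.\<close>

lemma rank_one_small:
  assumes "norm g \<le> C * p l v" "C * p k w \<le> \<epsilon> * norm c" "c \<noteq> 0" "C \<ge> 0" "w \<in> van l"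
    "m \<le> k" "\<epsilon> \<ge> 0"
  shows "p m (smul (g / c) w) \<le> \<epsilon> * p m v"
proof (cases "m < l")
  case True
  then show ?thesis using vanD[OF assms(5)] assms by (simp add: p_scale)
next
  case False
  have "norm g * p m w \<le> (C * p m v) * p k w"
    using assms(1) p_mono[of l m v] False \<open>C \<ge> 0\<close> p_mono[OF \<open>m \<le> k\<close>]
    by (intro mult_mono) (auto intro: order_trans mult_left_mono)
  also have "\<dots> = (C * p k w) * p m v" by simp
  also have "\<dots> \<le> (\<epsilon> * norm c) * p m v" using assms(2) by (intro mult_right_mono) auto
  finally show ?thesis using \<open>c \<noteq> 0\<close> by (simp add: p_scale norm_divide field_simps)
qed

text \<open>With \<open>u = y - a\<close>, the map \<open>1 + f(.) u / f a\<close> sends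
  \<open>a\<close> to \<open>y\<close> and has the inverse \<open>1 - f(.) u / f y\<close>, because
  \<open>f u = f y - f a\<close>. Applied after \<open>J\<close> it matches the preimage of
  \<open>a\<close> with \<open>y\<close>, and since \<open>f\<close> factors through
  \<open>P\<close> it moves nothing in the kernel of \<open>P\<close>. The hypotheses are symmetric
  enough for both directions: \<open>a\<close> given and \<open>y\<close> chosen, or
  conversely.\<close>

lemma matching_update:
  assumes M: "matching E F (P, J, L)" and E: "subspace E" and F: "subspace F"
    and f: "lfun f" "C \<ge> 0" "\<And>v. norm (f v) \<le> C * p l v" "\<And>v. norm (f (J v)) \<le> C * p l v"
      "\<And>v. f (P v) = f v"
    and a: "P a = a" "f a \<noteq> 0" "L a \<in> E" and y: "P y = y" "f y \<noteq> 0" "y \<in> F" "y \<in> van l"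
    and u: "y - a \<in> van l" "C * p k (y - a) \<le> \<epsilon> * norm (f a)" "C * p k (L (y - a)) \<le> \<epsilon> * norm (f y)"
    and \<epsilon>: "\<epsilon> \<ge> 0"
  obtains P' J' L' where "matching E F (P', J', L')" "refines k \<epsilon> (P, J, L) (P', J', L')"
    "P' y = 0" "\<And>v. P (J v) = a \<Longrightarrow> P' (J' v) = 0"
proof -
  have tame: "tame P" "tame J" "tame L" and idem: "P (P v) = P v" and JL: "J (L v) = v"
    and LJ: "L (J v) = v" and PF: "v - P v \<in> F" and LE: "L (v - P v) \<in> E" for v
    using M by (auto simp: matching_def)
  note lP = lin_rules[OF tame_lin[OF tame(1)]]
  note lJ = lin_rules[OF tame_lin[OF tame(2)]]
  note lL = lin_rules[OF tame_lin[OF tame(3)]]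
  note lf = lfun_rules[OF f(1)]
  define u where "u = y - a"
  have fu: "f u = f y - f a" by (simp add: u_def lf)
  have Pu: "P u = u" using a y by (simp add: u_def lP)
  have uv: "u \<in> van l" using u by (simp add: u_def)
  define P' where "P' v = P v - smul (f v / f y) y" for v
  define J' where "J' v = J v + smul (f (J v) / f a) u" for v
  define L' where "L' v = L v - smul (f v / f y) (L u)" for v
  have tame1: "tame (\<lambda>v. smul (f v) w)" if "w \<in> van l" for w
    by (rule tame_rank_one[OF f(1-3) that])
  have tP: "tame P'"
    using tame_add[OF tame(1) tame1[OF van_scale[OF y(4), of "- (1 / f y)"]]]
    by (simp add: P'_def[abs_def])
  have "tame (\<lambda>w. w + smul (f w) (smul (1 / f a) u))"
    by (intro tame_add tame_id tame1 van_scale uv)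
  from tame_comp[OF this tame(2)] have tJ: "tame J'" by (simp add: J'_def[abs_def])
  have "tame (\<lambda>w. w + smul (f w) (smul (- (1 / f y)) u))"
    by (intro tame_add tame_id tame1 van_scale uv)
  from tame_comp[OF tame(3) this] have tL: "tame L'"
    by (simp add: L'_def[abs_def] lL)
  note lL' = lin_rules[OF tame_lin[OF tL]]
  have L'_eq: "L' v = L (v - smul (f v / f y) u)" for v by (simp add: L'_def lL)
  have "J' (L' v) = v" for v
  proof -
    have "f (v - smul (f v / f y) u) / f a = f v / f y"
      using a(2) y(2) by (simp add: lf fu field_simps)
    then show ?thesis by (simp add: J'_def L'_eq JL)
  qed
  moreover have "L' (J' v) = v" for v
  proof -
    have "f (J' v) / f y = f (J v) / f a"
      using a(2) y(2) by (simp add: J'_def lf fu field_simps)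
    then show ?thesis by (simp add: L'_eq) (simp add: J'_def LJ)
  qed
  moreover have "P' (P' v) = P' v" for v
  proof -
    have "f (P' v) = 0" using y(2) by (simp add: P'_def lf f(5))
    moreover have "P (P' v) = P' v" by (simp add: P'_def lP idem y(1))
    ultimately show ?thesis by (simp add: P'_def[of "P' v"])
  qed
  moreover have "v - P' v \<in> F" "L' (v - P' v) \<in> E" for v
  proof -
    have eq: "v - P' v = (v - P v) + smul (f v / f y) y" by (simp add: P'_def)
    show "v - P' v \<in> F" unfolding eq by (intro subspace_add[OF F] subspace_scale[OF F] PF y(3))
    have "L' (v - P v) = L (v - P v)" by (simp add: L'_def lf f(5))
    moreover have "L' y = L a" using y(2) by (simp add: L'_eq) (simp add: u_def)
    ultimately show "L' (v - P' v) \<in> E" unfolding eq lL'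
      by (auto intro!: subspace_add[OF E] subspace_scale[OF E] LE a(3))
  qed
  ultimately have "matching E F (P', J', L')" using tP tJ tL by (simp add: matching_def)
  moreover have "refines k \<epsilon> (P, J, L) (P', J', L')"
  proof -
    have "p m (J' v - J v) \<le> \<epsilon> * p m v" if "m \<le> k" for m v
      using rank_one_small[OF f(4) u(2)[folded u_def] a(2) f(2) uv that \<epsilon>]
      by (simp add: J'_def)
    moreover have "p m (L' v - L v) \<le> \<epsilon> * p m v" if "m \<le> k" for m v
    proof -
      have "L' v - L v = - smul (f v / f y) (L u)" by (simp add: L'_def)
      then have "p m (L' v - L v) = p m (smul (f v / f y) (L u))" by simp
      then show ?thesis
        using rank_one_small[OF f(3) u(3)[folded u_def] y(2) f(2) van_tame[OF tame(3) uv] that \<epsilon>]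
        by simp
    qed
    moreover have "f v = 0" if "P v = 0" for v using f(5)[of v] that by (simp add: lf)
    ultimately show ?thesis by (auto simp: refines_def J'_def L'_def P'_def)
  qed
  moreover have "P' y = 0" using y by (simp add: P'_def)
  moreover have "P' (J' v) = 0" if "P (J v) = a" for v
  proof -
    have "f (J v) = f a" using f(5)[of "J v"] that by simp
    then have "J' v = J v + u" using a(2) by (simp add: J'_def)
    moreover have "f (J v + u) = f y" using \<open>f (J v) = f a\<close> by (simp add: lf fu)
    ultimately have "P' (J' v) = P (J v + u) - y" using y(2) by (simp add: P'_def)
    then show ?thesis using that by (simp add: lP Pu) (simp add: u_def)
  qed
  ultimately show ?thesis using that by blast
qed

text \<open>Both \<open>f\<close> and its composition with \<open>J\<close> are bounded at the same
  level: the first governs the change of \<open>L\<close>, the second that of \<open>J\<close>. The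
  constant \<open>C * (K + 1)\<close> covers both.\<close>

lemma matching_functional:
  assumes M: "matching E F (P, J, L)" and a: "P a = a" "a \<noteq> 0"
  obtains l C f where "a \<in> van l" "lfun f" "C \<ge> 0" "\<And>v. norm (f v) \<le> C * p l v"
    "\<And>v. norm (f (J v)) \<le> C * p l v" "\<And>v. f (P v) = f v" "f a = 1"
proof -
  have tame: "tame P" "tame J" and idem: "\<And>v. P (P v) = P v" using M by (auto simp: matching_def)
  obtain l C f where f: "a \<in> van l" "C \<ge> 0" "lfun f" "\<And>v. norm (f v) \<le> C * p l v"
    "\<And>v. f (P v) = f v" "f a = 1"
    using functional_step[OF tame(1) idem a] by metis
  obtain K where K: "K \<ge> 0" "\<And>v. p l (J v) \<le> K * p l v" using tameD[OF tame(2)] by metis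
  show ?thesis
  proof (rule that[of l f "C * (K + 1)"])
    fix v
    have "norm (f v) \<le> C * p l v" by (rule f)
    also have "\<dots> \<le> C * (K + 1) * p l v" using f(2) K(1) by (simp add: distrib_left distrib_right)
    finally show "norm (f v) \<le> C * (K + 1) * p l v" .
    have "norm (f (J v)) \<le> C * p l (J v)" by (rule f)
    also have "\<dots> \<le> C * ((K + 1) * p l v)"
      using f(2) by (intro mult_left_mono order_trans[OF K(2)]) (auto simp: distrib_right)
    finally show "norm (f (J v)) \<le> C * (K + 1) * p l v" by (simp add: mult.assoc)
  qed (use f K in auto)
qed

text \<open>The bound 1/2 keeps a functional that is 1 at one end of the match at least 1/2 in norm
  at the other; the bound \<epsilon>/2 then allows division by that value.\<close>

lemma small_radius:
  assumes "C \<ge> 0" "\<epsilon> > 0"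
  obtains \<eta> :: real where "\<eta> > 0" "C * \<eta> \<le> 1 / 2" "C * \<eta> \<le> \<epsilon> / 2"
proof (rule that[of "min 1 \<epsilon> / (2 * (C + 1))"])
  have "C / (C + 1) \<le> 1" using assms by simp
  then have "C / (C + 1) * (min 1 \<epsilon> / 2) \<le> 1 * (min 1 \<epsilon> / 2)"
    using assms by (intro mult_right_mono) auto
  then have "C * (min 1 \<epsilon> / (2 * (C + 1))) \<le> min 1 \<epsilon> / 2" by (simp add: field_simps)
  then show "C * (min 1 \<epsilon> / (2 * (C + 1))) \<le> 1 / 2" "C * (min 1 \<epsilon> / (2 * (C + 1))) \<le> \<epsilon> / 2"
    by linarith+
qed (use assms in auto)

lemma matching_forth:
  assumes M: "matching E F (P, J, L)" and E: "subspace E" and F: "subspace F" "van_dense F"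
    and a: "a \<in> E" and \<epsilon>: "\<epsilon> > 0"
  obtains P' J' L' where "matching E F (P', J', L')" "refines k \<epsilon> (P, J, L) (P', J', L')"
    "P' (J' a) = 0"
proof (cases "P (J a) = 0")
  case True
  then show ?thesis using that M refines_refl \<epsilon> by (meson less_imp_le)
next
  case False
  have tame: "tame P" "tame J" "tame L" and idem: "P (P v) = P v"
    and LJ: "L (J v) = v" and PF: "v - P v \<in> F" and LE: "L (v - P v) \<in> E" for v
    using M by (auto simp: matching_def)
  note lP = lin_rules[OF tame_lin[OF tame(1)]]
  note lL = lin_rules[OF tame_lin[OF tame(3)]]
  define a' where "a' = P (J a)"
  have Pa: "P a' = a'" by (simp add: a'_def idem)
  obtain l C f where f: "a' \<in> van l" "lfun f" "C \<ge> 0" "\<And>v. norm (f v) \<le> C * p l v"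
    "\<And>v. norm (f (J v)) \<le> C * p l v" "\<And>v. f (P v) = f v" "f a' = 1"
    using matching_functional[OF M Pa] False unfolding a'_def by metis
  obtain \<eta> where \<eta>: "\<eta> > 0" "C * \<eta> \<le> 1 / 2" "C * \<eta> \<le> \<epsilon> / 2"
    using small_radius[OF f(3) \<epsilon>] .
  \<comment> \<open>In \<open>max k l\<close>, the index \<open>l\<close> serves to control
    \<open>f\<close> on the error and \<open>k\<close> to obtain the required refinement.\<close>
  obtain b where b: "b \<in> F" "b \<in> van l" "p (max k l) (P (b - a')) < \<eta>" "p (max k l) (L (P (b - a'))) < \<eta>"
    using van_dense_approx[OF F(2) tame(1,3) f(1) \<eta>(1)] by metis
  \<comment> \<open>Projection keeps the level, as \<open>P\<close> is tame, and changes
    \<open>b\<close> only by an element of \<open>F\<close>.\<close>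
  define y where "y = P b"
  have u: "y - a' = P (b - a')" by (simp add: y_def lP Pa)
  have small: "C * p m (y - a') \<le> C * \<eta>" "C * p m (L (y - a')) \<le> C * \<eta>" if "m \<le> max k l" for m
    using b(3,4) p_mono[OF that, of "y - a'"] p_mono[OF that, of "L (y - a')"] f(3)
    unfolding u by (auto intro!: mult_left_mono)
  have "norm (f (y - a')) \<le> 1 / 2" using f(4)[of "y - a'"] small(1)[of l] \<eta>(2) by simp
  then have fy: "norm (f y) \<ge> 1 / 2"
    using norm_triangle_ineq4[of "f y" "f (y - a')"] f(7) by (simp add: lfun_rules[OF f(2)])
  have half: "\<epsilon> / 2 \<le> \<epsilon> * norm (f y)" using mult_left_mono[OF fy, of \<epsilon>] \<epsilon> by simp
  have "y = b - (b - P b)" by (simp add: y_def)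
  then have yF: "y \<in> F" using subspace_diff[OF F(1) b(1) PF[of b]] by simp
  \<comment> \<open>\<open>a'\<close> differs from \<open>J a\<close> only by a vector that is
    matched already, so \<open>L a'\<close> stays in \<open>E\<close>.\<close>
  have "a' = J a - (J a - P (J a))" by (simp add: a'_def)
  then have "L a' = a - L (J a - P (J a))" by (metis lL(4) LJ)
  then have aE: "L a' \<in> E" using subspace_diff[OF E a LE] by simp
  have uv: "y - a' \<in> van l" unfolding u by (intro van_tame[OF tame(1)] van_diff b f)
  have yv: "y \<in> van l" unfolding y_def by (intro van_tame[OF tame(1)] b)
  show ?thesis
  proof (rule matching_update[OF M E F(1) f(2,3,4,5,6) Pa _ aE _ _ yF yv uv, of k \<epsilon>])
    show "P y = y" by (simp add: y_def idem)
    show "f y \<noteq> 0" using fy by auto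
    show "C * p k (y - a') \<le> \<epsilon> * norm (f a')" using small(1)[of k] \<eta>(3) \<epsilon> f(7) by simp
    show "C * p k (L (y - a')) \<le> \<epsilon> * norm (f y)" using small(2)[of k] \<eta>(3) half by simp
  qed (use that f(7) \<epsilon> a'_def in auto)
qed

text \<open>Now the vector of \<open>F\<close> is given, and \<open>L y\<close> is approximated from
  \<open>E\<close>. Tameness of \<open>L\<close> ensures that \<open>L y\<close> has the level of
  \<open>y\<close>.\<close>

lemma matching_back:
  assumes M: "matching E F (P, J, L)" and E: "subspace E" "van_dense E" and F: "subspace F"
    and b: "b \<in> F" and \<epsilon>: "\<epsilon> > 0"
  obtains P' J' L' where "matching E F (P', J', L')" "refines k \<epsilon> (P, J, L) (P', J', L')"
    "P' b = 0"
proof (cases "P b = 0")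
  case True
  then show ?thesis using that M refines_refl \<epsilon> by (meson less_imp_le)
next
  case False
  have tame: "tame P" "tame J" "tame L" and idem: "P (P v) = P v" and JL: "J (L v) = v"
    and LJ: "L (J v) = v" and PF: "v - P v \<in> F" and LE: "L (v - P v) \<in> E" for v
    using M by (auto simp: matching_def)
  note lP = lin_rules[OF tame_lin[OF tame(1)]]
  note lJ = lin_rules[OF tame_lin[OF tame(2)]]
  note lL = lin_rules[OF tame_lin[OF tame(3)]]
  define y where "y = P b"
  have Py: "P y = y" by (simp add: y_def idem)
  obtain l C f where f: "y \<in> van l" "lfun f" "C \<ge> 0" "\<And>v. norm (f v) \<le> C * p l v"
    "\<And>v. norm (f (J v)) \<le> C * p l v" "\<And>v. f (P v) = f v" "f y = 1"
    using matching_functional[OF M Py] False unfolding y_def by metis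
  obtain \<eta> where \<eta>: "\<eta> > 0" "C * \<eta> \<le> 1 / 2" "C * \<eta> \<le> \<epsilon> / 2"
    using small_radius[OF f(3) \<epsilon>] .
  obtain a where a: "a \<in> E" "a \<in> van l" "p (max k l) (P (J (a - L y))) < \<eta>"
    "p (max k l) (L (P (J (a - L y)))) < \<eta>"
    using van_dense_approx[OF E(2) tame_comp[OF tame(1,2)] tame(3) van_tame[OF tame(3) f(1)] \<eta>(1)] by metis
  define a' where "a' = P (J a)"
  have u: "a' - y = P (J (a - L y))" by (simp add: a'_def lP lJ JL Py)
  have pu: "p m (y - a') = p m (a' - y)" "p m (L (y - a')) = p m (L (a' - y))" for m
    by (simp_all add: p_commute lL(4) p_commute[of m "L y"])
  have small: "C * p m (y - a') \<le> C * \<eta>" "C * p m (L (y - a')) \<le> C * \<eta>" if "m \<le> max k l" for m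
    using a(3,4) p_mono[OF that, of "a' - y"] p_mono[OF that, of "L (a' - y)"] f(3)
    unfolding pu u by (auto intro!: mult_left_mono)
  have "norm (f (y - a')) \<le> 1 / 2" using f(4)[of "y - a'"] small(1)[of l] \<eta>(2) by simp
  then have fa: "norm (f a') \<ge> 1 / 2"
    using norm_triangle_ineq2[of "f y" "f (y - a')"] f(7) by (simp add: lfun_rules[OF f(2)])
  have half: "\<epsilon> / 2 \<le> \<epsilon> * norm (f a')" using mult_left_mono[OF fa, of \<epsilon>] \<epsilon> by simp
  have "y = b - (b - P b)" by (simp add: y_def)
  then have yF: "y \<in> F" using subspace_diff[OF F b PF[of b]] by simp
  have "a' = J a - (J a - P (J a))" by (simp add: a'_def)
  then have "L a' = a - L (J a - P (J a))" by (metis lL(4) LJ)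
  then have aE: "L a' \<in> E" using subspace_diff[OF E(1) a(1) LE] by simp
  have uv: "y - a' \<in> van l"
    unfolding a'_def by (intro van_diff f van_tame[OF tame(1)] van_tame[OF tame(2)] a)
  show ?thesis
  proof (rule matching_update[OF M E(1) F f(2,3,4,5,6) _ _ aE Py _ yF f(1) uv, of k \<epsilon>])
    show "P a' = a'" by (simp add: a'_def idem)
    show "f a' \<noteq> 0" using fa by auto
    show "C * p k (y - a') \<le> \<epsilon> * norm (f a')" using small(1)[of k] \<eta>(3) half by simp
    show "C * p k (L (y - a')) \<le> \<epsilon> * norm (f y)" using small(2)[of k] \<eta>(3) \<epsilon> f(7) by simp
    fix P' J' L' assume n: "matching E F (P', J', L')" "refines k \<epsilon> (P, J, L) (P', J', L')" "P' y = 0"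
    \<comment> \<open>\<open>b - P b\<close> was matched before and remains so under
      \<open>refines\<close>; the new part is \<open>y = P b\<close>.\<close>
    have "P (b - P b) = 0" by (simp add: lP idem)
    then have "P' (b - P b) = 0" using n(2) unfolding refines_def by auto
    moreover have "lin P'" using n(1) tame_lin by (auto simp: matching_def)
    ultimately have "P' b = 0" using n(3) lin_diff[of P' b "P b"] by (simp add: y_def)
    then show thesis using that n by blast
  qed (use f(7) \<epsilon> in auto)
qed

text \<open>The increments are bounded by \<open>p m v\<close> itself, so the limit inherits
  tameness, and its distance to stage \<open>k\<close> is controlled uniformly in
  \<open>v\<close>.\<close>

lemma refines_limit:
  assumes step: "\<And>k m v. m \<le> k \<Longrightarrow> p m (K (Suc k) v - K k v) \<le> p m v / 2 ^ k"
    and tame: "\<And>k. tame (K k)"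
  obtains H where "tame H" "\<And>k m v. m \<le> k \<Longrightarrow> p m (H v - K k v) \<le> 2 * p m v / 2 ^ k"
proof -
  have "\<exists>l. conv (\<lambda>k. K k v) l" for v
    using step geometric_conv[of "\<lambda>k. K k v"] by metis
  then obtain H where H: "\<And>v. conv (\<lambda>k. K k v) (H v)" by metis
  have bound: "p m (H v - K k v) \<le> 2 * p m v / 2 ^ k" if "m \<le> k" for k m v
    by (rule conv_geometric_le[OF H _ that]) (rule step)
  note lK = lin_rules[OF tame_lin[OF tame]]
  have "lin H"
  proof (rule linI)
    show "H (x + y) = H x + H y" for x y
      using conv_unique[OF H[of "x + y"]] conv_add[OF H[of x] H[of y]] by (simp add: lK)
    show "H (smul c x) = smul c (H x)" for c x
      using conv_unique[OF H[of "smul c x"]] conv_scale[OF H[of x]] by (simp add: lK)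
  qed
  moreover have "\<exists>C\<ge>0. \<forall>v. p m (H v) \<le> C * p m v" for m
  proof -
    obtain C where C: "C \<ge> 0" "\<And>v. p m (K m v) \<le> C * p m v" using tameD[OF tame] by metis
    have "p m (H v) \<le> (C + 2) * p m v" for v
    proof -
      have "2 * p m v / 2 ^ m \<le> 2 * p m v"
        using mult_left_mono[of 1 "2 ^ m" "2 * p m v"] by (simp add: divide_le_eq)
      then show ?thesis
        using p_add[of m "H v - K m v" "K m v"] bound[of m m v] C(2)[of v] by (simp add: distrib_right)
    qed
    then show ?thesis using C(1) by (intro exI[of _ "C + 2"]) auto
  qed
  ultimately show ?thesis using that[of H] bound by (simp add: tame_def)
qed

text \<open>The difference \<open>H (H' v) - v\<close> splits as
  \<open>(H - K k) (H' v) + K k (H' v - K' k v)\<close>. For k >= m the \<open>K k\<close> share the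
  bound \<open>C + 2\<close> in \<open>p m\<close>, so both terms decay like 2^-k.\<close>

lemma limit_inverse:
  assumes K: "\<And>k m v. m \<le> k \<Longrightarrow> p m (H v - K k v) \<le> 2 * p m v / 2 ^ k"
    and K': "\<And>k m v. m \<le> k \<Longrightarrow> p m (H' v - K' k v) \<le> 2 * p m v / 2 ^ k"
    and tame: "\<And>k. tame (K k)" "tame H" and inv: "\<And>k v. K k (K' k v) = v"
  shows "H (H' v) = v"
proof -
  have "p m (H (H' v) - v) \<le> 0" for m
  proof -
    obtain C where C: "C \<ge> 0" "\<And>w. p m (H w) \<le> C * p m w" using tameD[OF tame(2)] by metis
    define B where "B = 2 * p m (H' v) + (C + 2) * (2 * p m v)"
    have "p m (H (H' v) - v) \<le> B / 2 ^ k" if "m \<le> k" for k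
    proof -
      define w where "w = H' v - K' k v"
      have w: "p m w \<le> 2 * p m v / 2 ^ k" using K'[OF that] by (simp add: w_def)
      have "H (H' v) - v = (H (H' v) - K k (H' v)) + K k w"
        by (simp add: w_def lin_diff[OF tame_lin[OF tame(1)]] inv)
      then have "p m (H (H' v) - v) \<le> 2 * p m (H' v) / 2 ^ k + p m (K k w)"
        using p_add K[OF that, of "H' v"] by (metis add_right_mono order_trans)
      moreover have "p m (K k w) \<le> (C + 2) * p m w"
      proof -
        have "2 * p m w / 2 ^ k \<le> 2 * p m w"
          using mult_left_mono[of 1 "2 ^ k" "2 * p m w"] by (simp add: divide_le_eq)
        then show ?thesis
          using p_diff[of m "H w" "H w - K k w"] K[OF that, of w] C(2)[of w] by (simp add: distrib_right)
      qed
      moreover have "(C + 2) * p m w \<le> (C + 2) * (2 * p m v / 2 ^ k)"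
        using w C(1) by (intro mult_left_mono) auto
      ultimately show ?thesis by (simp add: B_def add_divide_distrib)
    qed
    moreover have "(\<lambda>k. B / 2 ^ k) \<longlonglongrightarrow> 0" by (rule LIMSEQ_divide_realpow_zero) simp
    ultimately show ?thesis by (intro LIMSEQ_le_const[of _ 0]) auto
  qed
  then have "H (H' v) - v = 0" by (intro p_eq_0) (simp add: antisym)
  then show ?thesis by simp
qed

text \<open>Stage \<open>k\<close> matches \<open>a k\<close> and \<open>b k\<close>, which stay
  fixed afterwards. Thus the limits take on these generators values of finite stages, and these lie
  in \<open>F\<close> and \<open>E\<close> themselves, not merely in their closures.\<close>

lemma tame_isomorphism:
  fixes a b :: "nat \<Rightarrow> 'a"
  assumes E: "E = span (range a)" "van_dense E" and F: "F = span (range b)" "van_dense F"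
  obtains J L where "tame J" "tame L" "\<And>v. J (L v) = v" "\<And>v. L (J v) = v" "J ` E = F"
proof -
  have sE: "subspace E" and sF: "subspace F" using E F by simp_all
  have aE: "a k \<in> E" and bF: "b k \<in> F" for k using E F by (auto intro: span_base)
  define Q where "Q k s s' \<longleftrightarrow> refines k (1 / 2 ^ k) s s' \<and>
    (case s' of (P, J, L) \<Rightarrow> P (J (a k)) = 0 \<and> P (b k) = 0)" for k s s'
  have "\<exists>s. \<forall>k. matching E F (s k) \<and> Q k (s k) (s (Suc k))"
  proof (rule dependent_nat_choice)
    have "matching E F (\<lambda>v. v, \<lambda>v. v, \<lambda>v. v)"
      using subspace_0[OF sE] subspace_0[OF sF] by (simp add: matching_def tame_id)
    then show "\<exists>s. matching E F s" by blast
  next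
    fix s k assume m: "matching E F s"
    obtain P J L where s: "s = (P, J, L)" by (cases s)
    \<comment> \<open>Two half steps of size 2^-(k+1) add up to the 2^-k allowed by
      \<open>Q\<close>.\<close>
    have \<epsilon>: "(0::real) < 1 / 2 ^ Suc k" by simp
    obtain P1 J1 L1 where s1: "matching E F (P1, J1, L1)"
      "refines k (1 / 2 ^ Suc k) (P, J, L) (P1, J1, L1)" "P1 (J1 (a k)) = 0"
      using matching_forth[OF m[unfolded s] sE sF F(2) aE \<epsilon>] by metis
    obtain P2 J2 L2 where s2: "matching E F (P2, J2, L2)"
      "refines k (1 / 2 ^ Suc k) (P1, J1, L1) (P2, J2, L2)" "P2 (b k) = 0"
      using matching_back[OF s1(1) sE E(2) sF bF \<epsilon>] by metis
    have "P2 (J2 (a k)) = 0" using s2(2) s1(3) by (auto simp: refines_def)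
    moreover have "refines k (1 / 2 ^ k) s (P2, J2, L2)"
      using refines_trans[OF s1(2) s2(2)] by (simp add: s)
    ultimately have "Q k s (P2, J2, L2)" using s2(3) by (simp add: Q_def)
    then show "\<exists>s'. matching E F s' \<and> Q k s s'" using s2(1) by blast
  qed
  then obtain s where s: "\<And>k. matching E F (s k)" "\<And>k. Q k (s k) (s (Suc k))" by blast
  define P where "P k = fst (s k)" for k
  define J where "J k = fst (snd (s k))" for k
  define L where "L k = snd (snd (s k))" for k
  have tame: "tame (P k)" "tame (J k)" "tame (L k)" and JL: "J k (L k v) = v"
    and LJ: "L k (J k v) = v" and PF: "v - P k v \<in> F" and LE: "L k (v - P k v) \<in> E" for k v
    using s(1)[of k] by (auto simp: matching_def P_def J_def L_def split: prod.splits)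
  have stepJ: "m \<le> k \<Longrightarrow> p m (J (Suc k) v - J k v) \<le> p m v / 2 ^ k"
    and stepL: "m \<le> k \<Longrightarrow> p m (L (Suc k) v - L k v) \<le> p m v / 2 ^ k"
    and keepJ: "P k (J k v) = 0 \<Longrightarrow> J (Suc k) v = J k v"
    and keepL: "P k v = 0 \<Longrightarrow> P (Suc k) v = 0 \<and> L (Suc k) v = L k v"
    and doneJ: "P (Suc k) (J (Suc k) (a k)) = 0" and doneL: "P (Suc k) (b k) = 0" for k m v
    using s(2)[of k] by (auto simp: Q_def refines_def P_def J_def L_def split: prod.splits)
  obtain H where H: "tame H" "\<And>k m v. m \<le> k \<Longrightarrow> p m (H v - J k v) \<le> 2 * p m v / 2 ^ k"
    using refines_limit[of J] stepJ tame(2) by metis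
  obtain H' where H': "tame H'" "\<And>k m v. m \<le> k \<Longrightarrow> p m (H' v - L k v) \<le> 2 * p m v / 2 ^ k"
    using refines_limit[of L] stepL tame(3) by metis
  have HH': "H (H' v) = v" for v by (rule limit_inverse[OF H(2) H'(2) tame(2) H(1) JL])
  have H'H: "H' (H v) = v" for v by (rule limit_inverse[OF H'(2) H(2) tame(3) H'(1) LJ])
  have eventually_limit: "w = K (Suc k) v"
    if "\<And>k m. m \<le> k \<Longrightarrow> p m (w - K k v) \<le> 2 * p m v / 2 ^ k" "\<And>j. k < j \<Longrightarrow> K j v = K (Suc k) v"
    for w v :: 'a and K :: "nat \<Rightarrow> 'a \<Rightarrow> 'a" and k
  proof -
    have "p m (w - K (Suc k) v) \<le> 0" for m
    proof (rule LIMSEQ_le_const)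
      show "(\<lambda>k. 2 * p m v / 2 ^ k) \<longlonglongrightarrow> 0" by (rule LIMSEQ_divide_realpow_zero) simp
      show "\<exists>N. \<forall>j\<ge>N. p m (w - K (Suc k) v) \<le> 2 * p m v / 2 ^ j"
      proof (intro exI[of _ "max m (Suc k)"] allI impI)
        fix j assume "max m (Suc k) \<le> j"
        then show "p m (w - K (Suc k) v) \<le> 2 * p m v / 2 ^ j"
          using that(1)[of m j] that(2)[of j] by simp
      qed
    qed
    then have "w - K (Suc k) v = 0" by (intro p_eq_0) (simp add: antisym)
    then show ?thesis by simp
  qed
  have "H (a k) \<in> F" for k
  proof -
    have st: "P j (J j (a k)) = 0 \<and> J j (a k) = J (Suc k) (a k)" if "k < j" for j
      using that
    proof (induction j)
      case (Suc j)
      show ?case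
      proof (cases "j = k")
        case False
        then have IH: "P j (J j (a k)) = 0" "J j (a k) = J (Suc k) (a k)" using Suc by auto
        then show ?thesis using keepJ[of j "a k"] keepL[of j "J j (a k)"] by simp
      qed (use doneJ in simp)
    qed simp
    have "H (a k) = J (Suc k) (a k)"
      by (rule eventually_limit[where K = J]) (erule H(2), use st in blast)
    also have "\<dots> \<in> F" using PF[of "J (Suc k) (a k)" "Suc k"] doneJ[of k] by simp
    finally show ?thesis .
  qed
  then have "H ` range a \<subseteq> F" by blast
  moreover have "H' (b k) \<in> E" for k
  proof -
    have st: "P j (b k) = 0 \<and> L j (b k) = L (Suc k) (b k)" if "k < j" for j
      using that
    proof (induction j)
      case (Suc j)
      show ?case
      proof (cases "j = k")
        case False
        then have IH: "P j (b k) = 0" "L j (b k) = L (Suc k) (b k)" using Suc by auto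
        then show ?thesis using keepL[of j "b k"] by simp
      qed (use doneL in simp)
    qed simp
    have "H' (b k) = L (Suc k) (b k)"
      by (rule eventually_limit[where K = L]) (erule H'(2), use st in blast)
    also have "\<dots> \<in> E" using LE[of "Suc k" "b k"] doneL[of k] by simp
    finally show ?thesis .
  qed
  then have "H' ` range b \<subseteq> E" by blast
  moreover have span_image: "T ` span X \<subseteq> Y" if "tame T" "subspace Y" "T ` X \<subseteq> Y" for T X Y
  proof -
    interpret Vector_Spaces.linear smul smul T using that(1) by (rule tame_lin)
    show ?thesis using that by (simp add: span_image[symmetric] span_minimal)
  qed
  ultimately have "H ` E \<subseteq> F" "H' ` F \<subseteq> E"
    using span_image[OF H(1) sF] span_image[OF H'(1) sE] E(1) F(1) by simp_all
  then have "H ` E = F" using HH' by (metis image_subset_iff subsetI subset_antisym imageI)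
  then show ?thesis using that[of H H'] H(1) H'(1) HH' H'H by blast
qed

section \<open>Weighted shifts\<close>

lemma conv_zero_small:
  assumes "conv z 0" "e > 0"
  obtains N where "\<And>i. i \<ge> N \<Longrightarrow> p m (z i) < e"
  using conv_D[OF assms] by auto

lemma conv_sum: "(\<And>i. i \<in> I \<Longrightarrow> conv (z i) (x i)) \<Longrightarrow> conv (\<lambda>n. \<Sum>i\<in>I. z i n) (\<Sum>i\<in>I. x i)"
  by (induction I rule: infinite_finite_induct)
    (auto intro: conv_add conv_eventually_const)

lemma conv_coeff: "a \<longlonglongrightarrow> c \<Longrightarrow> conv (\<lambda>n. smul (a n) x) (smul c x)"
  unfolding conv_def
proof
  fix m assume "a \<longlonglongrightarrow> c"
  then have "(\<lambda>n. norm (a n - c) * p m x) \<longlonglongrightarrow> 0"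
    by (intro tendsto_mult_left_zero) (simp add: tendsto_norm_zero LIM_zero)
  then show "(\<lambda>n. p m (smul (a n) x - smul c x)) \<longlonglongrightarrow> 0"
    by (simp add: scale_left_diff_distrib[symmetric] p_scale)
qed

definition mixing_on :: "('a \<Rightarrow> 'a) \<Rightarrow> 'a set \<Rightarrow> bool" where
  "mixing_on T W \<longleftrightarrow> (\<forall>x\<in>W. \<forall>y m. \<forall>e>0. \<exists>N. \<forall>n\<ge>N. \<exists>z\<in>W. p m (z - x) < e \<and> p m ((T ^^ n) z - y) < e)"

text \<open>A variant of Kitai's criterion with moving approximants: a sequence tending to
  \<open>x'\<close> whose images vanish is added to a null sequence whose images tend to
  \<open>y'\<close>. The targets are arbitrary even when the starting space \<open>W\<close> is
  small.\<close>

lemma mixing_onI: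
  assumes T: "cont_lin T" and W: "subspace W"
    and 1: "\<And>x m e. x \<in> W \<Longrightarrow> e > 0 \<Longrightarrow> \<exists>x'. p m (x' - x) < e \<and>
      (\<exists>z. (\<exists>N. \<forall>n\<ge>N. z n \<in> W) \<and> conv z x' \<and> conv (\<lambda>n. (T ^^ n) (z n)) 0)"
    and 2: "\<And>y m e. e > 0 \<Longrightarrow> \<exists>y'. p m (y' - y) < e \<and>
      (\<exists>z. (\<exists>N. \<forall>n\<ge>N. z n \<in> W) \<and> conv z 0 \<and> conv (\<lambda>n. (T ^^ n) (z n)) y')"
  shows "mixing_on T W"
  unfolding mixing_on_def
proof (intro ballI allI impI)
  fix x y m and e :: real assume x: "x \<in> W" and e: "e > 0"
  then have e3: "e / 3 > 0" by simp
  obtain x' z N where z: "p m (x' - x) < e / 3" "\<And>n. n \<ge> N \<Longrightarrow> z n \<in> W" "conv z x'"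
    "conv (\<lambda>n. (T ^^ n) (z n)) 0" using 1[OF x e3] by metis
  obtain y' z' N' where z': "p m (y' - y) < e / 3" "\<And>n. n \<ge> N' \<Longrightarrow> z' n \<in> W" "conv z' 0"
    "conv (\<lambda>n. (T ^^ n) (z' n)) y'" using 2[OF e3] by metis
  obtain A where A: "\<And>n. n \<ge> A \<Longrightarrow> p m (z n - x') < e / 3" using conv_D[OF z(3) e3] by metis
  obtain B where B: "\<And>n. n \<ge> B \<Longrightarrow> p m ((T ^^ n) (z n)) < e / 3" using conv_zero_small[OF z(4) e3] by metis
  obtain A' where A': "\<And>n. n \<ge> A' \<Longrightarrow> p m (z' n) < e / 3" using conv_zero_small[OF z'(3) e3] by metis
  obtain B' where B': "\<And>n. n \<ge> B' \<Longrightarrow> p m ((T ^^ n) (z' n) - y') < e / 3" using conv_D[OF z'(4) e3] by metis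
  define K where "K = N + N' + A + A' + B + B'"
  have "\<exists>w\<in>W. p m (w - x) < e \<and> p m ((T ^^ n) w - y) < e" if n: "n \<ge> K" for n
  proof (intro bexI[of _ "z n + z' n"] conjI)
    show "z n + z' n \<in> W" using n z(2) z'(2) by (intro subspace_add[OF W]) (auto simp: K_def)
    have "p m (z n + z' n - x) \<le> p m (z n - x') + p m (x' - x) + p m (z' n)"
      using p_add[of m "z n - x" "z' n"] p_triangle[of m "z n" x x'] by (simp add: algebra_simps)
    also have "\<dots> < e" using A[of n] A'[of n] z(1) n by (simp add: K_def)
    finally show "p m (z n + z' n - x) < e" .
    have "(T ^^ n) (z n + z' n) = (T ^^ n) (z n) + (T ^^ n) (z' n)"
      by (rule lin_add[OF cont_lin_lin[OF cont_lin_funpow[OF T]]])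
    then have "p m ((T ^^ n) (z n + z' n) - y) \<le> p m ((T ^^ n) (z n)) + p m ((T ^^ n) (z' n) - y') + p m (y' - y)"
      using p_add[of m "(T ^^ n) (z n)" "(T ^^ n) (z' n) - y"] p_triangle[of m "(T ^^ n) (z' n)" y y']
      by (simp add: algebra_simps)
    also have "\<dots> < e" using B[of n] B'[of n] z'(1) n by (simp add: K_def)
    finally show "p m ((T ^^ n) (z n + z' n) - y) < e" .
  qed
  then show "\<exists>N. \<forall>n\<ge>N. \<exists>w\<in>W. p m (w - x) < e \<and> p m ((T ^^ n) w - y) < e" by blast
qed

text \<open>\<open>\<mu>\<close> lists the levels on which \<open>T\<close> is mixing; all other
  \<open>van n\<close> are trivial. The jointly hypercyclic vectors shadow the dense sequences
  \<open>r n\<close> closely enough to be dense in every \<open>van n\<close> themselves.\<close>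

lemma hypercyclic_subspace:
  fixes \<mu> :: "nat \<Rightarrow> nat" and r :: "nat \<Rightarrow> nat \<Rightarrow> 'a"
  assumes T: "cont_lin T" and range: "poly_dense_range T"
    and mix: "\<And>n. mixing_on T (van (\<mu> n))" and \<mu>: "\<And>n. n \<in> range \<mu> \<or> van n = {0}"
    and r: "\<And>n i. r n i \<in> van n" "\<And>n x m e. x \<in> van n \<Longrightarrow> e > 0 \<Longrightarrow> \<exists>i. p m (r n i - x) < e"
  obtains g :: "nat \<Rightarrow> 'a" where "van_dense (span (range g))" "T ` span (range g) \<subseteq> span (range g)"
    "\<And>v. v \<in> span (range g) \<Longrightarrow> v \<noteq> 0 \<Longrightarrow> hypercyclic_vec T v"
proof -
  define \<nu> where "\<nu> i = \<mu> (fst (prod_decode i))" for i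
  \<comment> \<open>Varying the last component of the code makes each \<open>r n s\<close> occur at
    arbitrarily large \<open>i\<close>. As \<open>y i\<close> is within 2^-i of \<open>d i\<close>,
    density passes to the \<open>y i\<close>.\<close>
  define d where "d i = r (\<nu> i) (fst (prod_decode (snd (prod_decode i))))" for i
  obtain y where y: "\<And>i. y i \<in> van (\<nu> i)" "\<And>i. p i (y i - d i) \<le> 1 / 2 ^ i"
    "\<And>xs m e. e > 0 \<Longrightarrow> \<exists>n. \<forall>i<length xs. p m ((T ^^ n) (y i) - r 0 (xs ! i)) < e"
  proof (rule hypercyclic_sequence[OF T, of "\<lambda>i. van (\<nu> i)" d "r 0"])
    show "l \<in> van (\<nu> i)" if "conv s l" "\<And>k. s k \<in> van (\<nu> i)" for i s l
      using that by (rule van_conv)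
    show "\<exists>N. \<forall>n\<ge>N. \<exists>z\<in>van (\<nu> i). p m (z - x) < e \<and> p m ((T ^^ n) z - y) < e"
      if "x \<in> van (\<nu> i)" "e > 0" for i x y m e
      using mix that unfolding mixing_on_def \<nu>_def by blast
    show "d i \<in> van (\<nu> i)" for i using r(1) by (simp add: d_def)
  qed (use that in blast)
  define g where "g n = (T ^^ snd (prod_decode n)) (y (fst (prod_decode n)))" for n
  have g: "range g = {(T ^^ j) (y i) | i j. True}"
  proof -
    have "(T ^^ j) (y i) = g (prod_encode (i, j))" for i j by (simp add: g_def)
    then show ?thesis unfolding g_def by blast
  qed
  show ?thesis
  proof (rule that[of g])
    show "van_dense (span (range g))"
      unfolding van_dense_def
    proof (intro allI ballI impI)
      fix n x m and e :: real assume x: "x \<in> van n" and e: "e > 0"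
      show "\<exists>y\<in>span (range g) \<inter> van n. p m (y - x) < e"
      proof (cases "van n = {0}")
        case True
        then show ?thesis using x e span_zero by (intro bexI[of _ 0]) auto
      next
        case False
        then obtain a where a: "n = \<mu> a" using \<mu> by blast
        obtain s where s: "p m (r n s - x) < e / 2" using r(2)[OF x, of "e / 2"] e by auto
        obtain j where j: "1 / 2 ^ j < e / 2"
          using real_arch_pow_inv[of "e / 2" "1/2"] e by (auto simp: power_one_over)
        define t where "t = max j m"
        define i where "i = prod_encode (a, prod_encode (s, t))"
        have "t \<le> i" unfolding i_def using le_prod_encode_2 order_trans by blast
        then have i: "j \<le> i" "m \<le> i" by (auto simp: t_def)
        have \<nu>i: "\<nu> i = n" and di: "d i = r n s" by (simp_all add: \<nu>_def d_def i_def a)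
        have "(1::real) / 2 ^ i \<le> 1 / 2 ^ j" using i by (intro divide_left_mono power_increasing) auto
        then have "p m (y i - r n s) < e / 2"
          using p_mono[OF i(2), of "y i - d i"] y(2)[of i] j di by simp
        then have "p m (y i - x) < e" using s p_triangle[of m "y i" x "r n s"] by simp
        moreover have "y i \<in> span (range g)"
          unfolding g by (intro span_base CollectI exI[of _ i] exI[of _ 0]) simp
        ultimately show ?thesis using y(1)[of i] \<nu>i by blast
      qed
    qed
    interpret T: Vector_Spaces.linear smul smul T using T by (rule cont_lin_lin)
    have "T ` range g \<subseteq> range g"
    proof -
      have "T ((T ^^ j) (y i)) = (T ^^ Suc j) (y i)" for i j by simp
      then show ?thesis unfolding g by blast
    qed
    then show "T ` span (range g) \<subseteq> span (range g)"
      by (metis T.span_image span_mono)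
    show "hypercyclic_vec T v" if "v \<in> span (range g)" "v \<noteq> 0" for v
    proof (rule hypercyclic_span[OF T range _ y(3) that(1)[unfolded g] that(2)])
      show "\<exists>i. p m (r 0 i - x) < e" if "e > 0" for x m and e :: real
        using r(2)[of x 0] that by simp
    qed
  qed
qed

end

text \<open>At most \<open>R\<close> of the distinct indices \<open>\<sigma> r\<close> lie below
  \<open>R\<close>; all other factors are at most \<open>t\<close>.\<close>

lemma prod_injective_le:
  fixes w :: "nat \<Rightarrow> real"
  assumes "inj \<sigma>" "\<And>j. 0 \<le> w j" "\<And>j. w j \<le> 1" "\<And>j. j \<ge> R \<Longrightarrow> w j \<le> t" "0 < t" "t \<le> 1"
  shows "(\<Prod>r<i. w (\<sigma> r)) \<le> t ^ i / t ^ R"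
proof -
  define A where "A = {r \<in> {..<i}. \<not> \<sigma> r < R}"
  have "(\<Prod>r<i. w (\<sigma> r)) \<le> (\<Prod>r<i. if \<not> \<sigma> r < R then t else 1)"
    using assms by (intro prod_mono) auto
  also have "\<dots> = (\<Prod>r\<in>A. t)" unfolding A_def by (rule prod.inter_filter[symmetric]) simp
  also have "\<dots> = t ^ card A" by simp
  also have "\<dots> \<le> t ^ (i - R)"
  proof (rule power_decreasing)
    have "card ({..<i} - A) \<le> card {..<R}"
      using assms(1) by (intro card_inj_on_le[of \<sigma>]) (auto simp: A_def inj_on_def)
    moreover have "card ({..<i} - A) = i - card A"
      by (subst card_Diff_subset) (auto simp: A_def)
    ultimately show "i - R \<le> card A" by simp
  qed (use assms in auto)
  also have "\<dots> \<le> t ^ i / t ^ R"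
  proof (cases "R \<le> i")
    case True
    then show ?thesis using assms(5) by (simp add: power_diff)
  next
    case False
    then have "t ^ R \<le> t ^ i" using assms by (intro power_decreasing) auto
    then show ?thesis using False assms(5) by (simp add: field_simps)
  qed
  finally show ?thesis .
qed

locale biorthogonal_system = graded_frechet smul p
  for smul :: "'k::real_normed_field \<Rightarrow> 'a::{ab_group_add,t2_space} \<Rightarrow> 'a" and p :: "nat \<Rightarrow> 'a \<Rightarrow> real" +
  fixes e :: "nat \<Rightarrow> 'a" and f :: "nat \<Rightarrow> 'a \<Rightarrow> 'k" and l :: "nat \<Rightarrow> nat" and C :: "nat \<Rightarrow> real"
  assumes e_van: "e k \<in> van (l k)" and C_nonneg: "C k \<ge> 0" and f_lin: "lfun (f k)"
    and f_bound: "norm (f k v) \<le> C k * p (l k) v" and f_e: "f k (e j) = (if j = k then 1 else 0)"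
begin

text \<open>\<open>S\<close> is the series of the rank-one operators given by \<open>w j\<close>,
  \<open>f (c j)\<close> and \<open>e j\<close>. Only the \<open>e j\<close> with
  \<open>l j \<le> m\<close> are visible to \<open>p m\<close>, so \<open>lc\<close> supplies the
  bounded order required in \<open>nuclear_operator\<close>.\<close>

lemma weighted_shift_exists:
  assumes c: "inj c" and lc: "\<And>n. \<exists>N. \<forall>j. l j \<le> n \<longrightarrow> l (c j) \<le> N"
  obtains S w where "cont_lin S" "\<And>j. 0 < w j" "\<And>j. w j \<le> 1 / real (Suc j)" "\<And>j. w j * p j (e j) \<le> 1"
    "\<And>j. S (e (c j)) = smul (of_real (w j)) (e j)" "\<And>k. k \<notin> range c \<Longrightarrow> S (e k) = 0"
proof -
  \<comment> \<open>Three demands on each weight: decay of the powers of \<open>S\<close>, control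
    of \<open>e j\<close> in the seminorms up to \<open>p j\<close>, and convergence of the
    series.\<close>
  have "\<exists>w>0. w \<le> 1 / real (Suc j) \<and> w * p j (e j) \<le> 1 \<and> w * C (c j) * p j (e j) \<le> 1 / 2 ^ j" for j
  proof -
    define x y where "x = p j (e j)" and "y = C (c j) * p j (e j)"
    have xy: "x \<ge> 0" "y \<ge> 0" using C_nonneg by (auto simp: x_def y_def)
    define w where "w = min (1 / real (Suc j)) (min (1 / (1 + x)) (1 / (2 ^ j * (1 + y))))"
    have w: "w > 0" "w \<le> 1 / real (Suc j)" "w \<le> 1 / (1 + x)" "w \<le> 1 / (2 ^ j * (1 + y))"
      using xy by (auto simp: w_def)
    have "w * x \<le> 1 / (1 + x) * x" using w xy by (intro mult_right_mono) auto
    also have "\<dots> \<le> 1" using xy by simp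
    finally have wx: "w * x \<le> 1" .
    have "w * y \<le> 1 / (2 ^ j * (1 + y)) * y" using w xy by (intro mult_right_mono) auto
    also have "\<dots> = y / (1 + y) / 2 ^ j" by simp
    also have "\<dots> \<le> 1 / 2 ^ j" using xy by (intro divide_right_mono) auto
    finally show ?thesis using w(1,2) wx by (intro exI[of _ w]) (simp add: x_def y_def mult.assoc)
  qed
  then obtain w where w: "\<And>j. w j > 0" "\<And>j. w j \<le> 1 / real (Suc j)" "\<And>j. w j * p j (e j) \<le> 1"
    "\<And>j. w j * C (c j) * p j (e j) \<le> 1 / 2 ^ j" by metis
  define g where "g j v = of_real (w j) * f (c j) v" for j v
  obtain S where S: "cont_lin S" "\<And>v. conv (\<lambda>n. \<Sum>j<n. smul (g j v) (e j)) (S v)"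
  proof (rule nuclear_operator[of g "\<lambda>j. w j * C (c j)" "\<lambda>j. l (c j)" e])
    show "lfun (g k)" for k
      unfolding g_def by (intro lfunI) (simp_all add: lfun_rules[OF f_lin] distrib_left)
    show "0 \<le> w k * C (c k)" for k using w(1)[of k] C_nonneg[of "c k"] by simp
    show "norm (g k v) \<le> w k * C (c k) * p (l (c k)) v" for k v
      using mult_left_mono[OF f_bound[of "c k" v], of "w k"] w(1)[of k]
      by (simp add: g_def norm_mult mult.assoc)
    show "w k * C (c k) * p k (e k) \<le> 1 / 2 ^ k" for k by (rule w)
    show "\<exists>n. \<forall>k. p m (e k) \<noteq> 0 \<longrightarrow> l (c k) \<le> n" for m
    proof -
      obtain N where "\<And>j. l j \<le> m \<Longrightarrow> l (c j) \<le> N" using lc by blast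
      moreover have "l k \<le> m" if "p m (e k) \<noteq> 0" for k
        using that vanD[OF e_van[of k], of m] by (meson not_less)
      ultimately show ?thesis by blast
    qed
  qed (use that in blast)
  have gS: "S v = x" if "\<And>n. n \<ge> N \<Longrightarrow> (\<Sum>j<n. smul (g j v) (e j)) = x" for v x N
    using conv_unique[OF S(2) conv_eventually_const] that by blast
  show ?thesis
  proof (rule that[of S w])
    show "S (e (c j)) = smul (of_real (w j)) (e j)" for j
    proof (rule gS)
      fix n assume "n \<ge> Suc j"
      have "(\<Sum>i<n. smul (g i (e (c j))) (e i)) = (\<Sum>i<n. if i = j then smul (of_real (w j)) (e j) else 0)"
        using c by (intro sum.cong) (auto simp: g_def f_e inj_def)
      then show "(\<Sum>i<n. smul (g i (e (c j))) (e i)) = smul (of_real (w j)) (e j)"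
        using \<open>n \<ge> Suc j\<close> by simp
    qed
    show "S (e k) = 0" if "k \<notin> range c" for k
      by (rule gS[of 0], rule sum.neutral) (use that in \<open>auto simp: g_def f_e\<close>)
  qed (use S(1) w in auto)
qed

end

text \<open>A cycle of \<open>c\<close> would give some power of \<open>S\<close> an eigenvector
  with nonzero eigenvalue. Without cycles every orbit of \<open>c\<close> meets infinitely many
  weights, and on the span of the \<open>e k\<close> the powers of \<open>S\<close> decay faster
  than any geometric sequence.\<close>

locale shift_system = biorthogonal_system smul p e f l C
  for smul :: "'k::real_normed_field \<Rightarrow> 'a::{ab_group_add,t2_space} \<Rightarrow> 'a" and p e f l C +
  fixes c :: "nat \<Rightarrow> nat" and S :: "'a \<Rightarrow> 'a" and w :: "nat \<Rightarrow> real"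
  assumes c_inj: "inj c" and c_acyclic: "n > 0 \<Longrightarrow> (c ^^ n) j \<noteq> j"
    and S_cont: "cont_lin S" and w_pos: "0 < w j" and w_le: "w j \<le> 1 / real (Suc j)"
    and w_e: "w j * p j (e j) \<le> 1"
    and S_c: "S (e (c j)) = smul (of_real (w j)) (e j)" and S_root: "k \<notin> range c \<Longrightarrow> S (e k) = 0"
    and e_dense: "\<epsilon> > 0 \<Longrightarrow> \<exists>y\<in>span (range e). p m (y - x) < \<epsilon>"
begin

lemmas S_lin = lin_rules[OF cont_lin_lin[OF S_cont]]
lemmas Sn_lin = lin_rules[OF cont_lin_lin[OF cont_lin_funpow[OF S_cont]]]

lemma S_funpow: "(S ^^ n) (e ((c ^^ n) j)) = smul (of_real (\<Prod>r<n. w ((c ^^ r) j))) (e j)"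
proof (induction n)
  case (Suc n)
  have "(S ^^ Suc n) (e ((c ^^ Suc n) j)) = (S ^^ n) (S (e (c ((c ^^ n) j))))"
    by (simp add: funpow_swap1)
  then show ?case by (simp add: S_c Sn_lin Suc mult.commute)
qed simp

lemma S_funpow_cases:
  "(S ^^ i) (e k) = 0 \<or> (\<exists>j. k = (c ^^ i) j)"
proof (induction i)
  case (Suc i)
  then show ?case
  proof (elim disjE exE)
    assume "(S ^^ i) (e k) = 0"
    then show ?thesis by (simp add: S_lin)
  next
    fix j assume k: "k = (c ^^ i) j"
    show ?thesis
    proof (cases "j \<in> range c")
      case True
      then obtain j' where "j = c j'" by blast
      then have "k = (c ^^ Suc i) j'" by (simp add: k funpow_swap1)
      then show ?thesis by blast
    next
      case False
      then show ?thesis using S_funpow[of i j] by (simp add: k S_lin S_root)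
    qed
  qed
qed auto

lemma c_orbit_inj: "inj (\<lambda>r. (c ^^ r) j)"
proof (rule injI, rule ccontr)
  have *: "(c ^^ r) j \<noteq> (c ^^ s) j" if "r < s" for r s
  proof
    assume "(c ^^ r) j = (c ^^ s) j"
    also have "s = r + (s - r)" using that by simp
    finally have "(c ^^ r) j = (c ^^ r) ((c ^^ (s - r)) j)" by (simp add: funpow_add)
    then have "j = (c ^^ (s - r)) j" using inj_fn[OF c_inj] by (simp add: inj_def)
    then show False using c_acyclic[of "s - r" j] that by simp
  qed
  fix r s assume "(c ^^ r) j = (c ^^ s) j" "r \<noteq> s"
  then show False using *[of r s] *[of s r] by (cases "r < s") auto
qed

lemma decay_e:
  assumes "\<theta> > 0"
  shows "\<exists>B. \<forall>i. p m ((S ^^ i) (e k)) \<le> B * \<theta> ^ i"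
proof -
  define t where "t = min \<theta> 1"
  have t: "0 < t" "t \<le> 1" "t \<le> \<theta>" using assms by (auto simp: t_def)
  obtain R where R: "1 / real (Suc R) < t" using nat_approx_posE[OF t(1)] by metis
  have wt: "w j \<le> t" if "R \<le> j" for j
  proof -
    have "1 / real (Suc j) \<le> 1 / real (Suc R)" using that by (intro divide_left_mono) auto
    then show ?thesis using w_le[of j] R by linarith
  qed
  have w1: "w j \<le> 1" for j
  proof -
    have "1 / real (Suc j) \<le> 1" by simp
    then show ?thesis using w_le[of j] by linarith
  qed
  \<comment> \<open>The basis vector \<open>e j\<close> reached after \<open>i\<close> steps depends
    on \<open>i\<close>. The weight \<open>w j\<close> absorbs its seminorm: for j >= m since
    \<open>w j * p j (e j) \<le> 1\<close>, for j < m by a finite sum.\<close>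
  define D where "D = 1 + (\<Sum>j<m. p m (e j))"
  have D1: "D \<ge> 1" by (simp add: D_def sum_nonneg)
  have wD: "w j * p m (e j) \<le> D" for j
  proof (cases "j < m")
    case True
    have "w j * p m (e j) \<le> 1 * p m (e j)" using w1 by (intro mult_right_mono) auto
    also have "p m (e j) \<le> (\<Sum>j<m. p m (e j))" using True by (intro member_le_sum) auto
    finally show ?thesis by (simp add: D_def)
  next
    case False
    then have "w j * p m (e j) \<le> w j * p j (e j)"
      using w_pos[of j] by (intro mult_left_mono p_mono) auto
    then show ?thesis using w_e[of j] D1 by linarith
  qed
  \<comment> \<open>The exponent \<open>Suc R\<close> pays for the factor \<open>w j\<close> spent
    on \<open>e j\<close> and for at most \<open>R\<close> weights above \<open>t\<close>.\<close>
  define B where "B = p m (e k) + D / t ^ Suc R"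
  have "p m ((S ^^ i) (e k)) \<le> B * \<theta> ^ i" for i
  proof -
    have B: "B \<ge> 0" using D1 t by (simp add: B_def)
    have "p m ((S ^^ i) (e k)) \<le> B * t ^ i"
    proof (cases i)
      case 0
      then show ?thesis using D1 t by (simp add: B_def)
    next
      case (Suc i')
      from S_funpow_cases[of i k] show ?thesis
      proof (elim disjE exE)
        assume "(S ^^ i) (e k) = 0"
        then show ?thesis using B t by simp
      next
        fix j assume k: "k = (c ^^ i) j"
        have inj: "inj (\<lambda>r. (c ^^ Suc r) j)"
          using c_orbit_inj[of j] by (auto simp: inj_def simp del: funpow.simps)
        have nn: "(\<Prod>r<n. w ((c ^^ r) j)) \<ge> 0" for n
          using w_pos by (intro prod_nonneg) (auto intro: less_imp_le)
        have "p m ((S ^^ i) (e k)) = (\<Prod>r<i. w ((c ^^ r) j)) * p m (e j)"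
          using nn by (simp only: k S_funpow p_scale norm_of_real abs_of_nonneg)
        also have "\<dots> = (w j * p m (e j)) * (\<Prod>r<i'. w ((c ^^ Suc r) j))"
          unfolding Suc prod.lessThan_Suc_shift by simp
        also have "\<dots> \<le> D * (t ^ i' / t ^ R)"
        proof (rule mult_mono[OF wD])
          show "(\<Prod>r<i'. w ((c ^^ Suc r) j)) \<le> t ^ i' / t ^ R"
            using w_pos by (intro prod_injective_le[OF inj]) (auto intro: less_imp_le w1 wt t)
          show "0 \<le> (\<Prod>r<i'. w ((c ^^ Suc r) j))"
            using w_pos by (intro prod_nonneg) (auto intro: less_imp_le)
        qed (use D1 in auto)
        also have "\<dots> = D / t ^ Suc R * t ^ i" using t by (simp add: Suc)
        also have "\<dots> \<le> B * t ^ i" using t by (intro mult_right_mono) (auto simp: B_def)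
        finally show ?thesis .
      qed
    qed
    also have "\<dots> \<le> B * \<theta> ^ i" using t B by (intro mult_left_mono power_mono) auto
    finally show ?thesis .
  qed
  then show ?thesis by blast
qed

lemma decay:
  assumes "x \<in> span (range e)" "\<theta> > 0"
  shows "\<exists>B. \<forall>i. p m ((S ^^ i) x) \<le> B * \<theta> ^ i"
  using assms(1)
proof (induction rule: span_induct_alt)
  case base
  show ?case by (intro exI[of _ 0]) (simp add: Sn_lin)
next
  case (step a x y)
  then obtain k where "x = e k" by blast
  then obtain B where B: "\<And>i. p m ((S ^^ i) x) \<le> B * \<theta> ^ i" using decay_e[OF assms(2)] by metis
  obtain B' where B': "\<And>i. p m ((S ^^ i) y) \<le> B' * \<theta> ^ i" using step by blast
  have "p m ((S ^^ i) (smul a x + y)) \<le> (norm a * B + B') * \<theta> ^ i" for i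
  proof -
    have "p m ((S ^^ i) (smul a x + y)) \<le> norm a * p m ((S ^^ i) x) + p m ((S ^^ i) y)"
      using p_add[of m "smul a ((S ^^ i) x)" "(S ^^ i) y"] by (simp add: Sn_lin p_scale)
    also have "\<dots> \<le> norm a * (B * \<theta> ^ i) + B' * \<theta> ^ i"
      by (intro add_mono mult_left_mono B B') auto
    finally show ?thesis by (simp add: algebra_simps)
  qed
  then show ?case by blast
qed

lemma S_surj:
  assumes "x \<in> span (range e)"
  shows "\<exists>y\<in>span (range e). S y = x"
  using assms
proof (induction rule: span_induct_alt)
  case base
  show ?case using span_zero by (intro bexI[of _ 0]) (simp_all add: S_lin)
next
  case (step a x y)
  then obtain j y' where j: "x = e j" "y' \<in> span (range e)" "S y' = y" by blast
  have "smul (a / of_real (w j)) (e (c j)) + y' \<in> span (range e)"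
    by (rule span_add[OF span_scale[OF span_base] j(2)]) simp
  moreover have "S (smul (a / of_real (w j)) (e (c j)) + y') = smul a x + y"
    using w_pos[of j] by (simp add: S_lin S_c j)
  ultimately show ?case by blast
qed

lemma S_dense_range: "poly_dense_range S"
  by (rule poly_dense_rangeI[OF S_cont e_dense S_surj decay])

lemma S_vanishes:
  assumes "x \<in> span (range e)"
  shows "conv (\<lambda>i. (S ^^ i) x) 0"
  unfolding conv_def
proof
  fix m
  obtain B where B: "\<And>i. p m ((S ^^ i) x) \<le> B * (1 / 2) ^ i" using decay[OF assms, of "1/2"] by auto
  have "(\<lambda>i. B / 2 ^ i) \<longlonglongrightarrow> 0" by (rule LIMSEQ_divide_realpow_zero) simp
  then show "(\<lambda>i. p m ((S ^^ i) x - 0)) \<longlonglongrightarrow> 0"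
    by (rule tendsto_sandwich[OF _ _ tendsto_const, rotated 2])
      (use B in \<open>auto simp: power_one_over\<close>)
qed

text \<open>The multiples of \<open>e ((c ^^ i) j)\<close> serve as preimages of \<open>e j\<close>
  under \<open>S ^^ i\<close>. Their level tends to infinity, so they eventually lie in every
  \<open>van n\<close> and tend to 0 however large their coefficients are.\<close>

lemma S_mixing:
  assumes levels: "\<And>j n. \<exists>K. \<forall>k\<ge>K. n \<le> l ((c ^^ k) j)" and dense: "van_dense (span (range e))"
  shows "mixing_on S (van n)"
proof (rule mixing_onI[OF S_cont subspace_van])
  fix x m and \<epsilon> :: real assume "x \<in> van n" "\<epsilon> > 0"
  then obtain x' where "x' \<in> span (range e) \<inter> van n" "p m (x' - x) < \<epsilon>"
    using dense unfolding van_dense_def by blast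
  then show "\<exists>x'. p m (x' - x) < \<epsilon> \<and>
      (\<exists>z. (\<exists>N. \<forall>i\<ge>N. z i \<in> van n) \<and> conv z x' \<and> conv (\<lambda>i. (S ^^ i) (z i)) 0)"
    using S_vanishes[of x'] conv_eventually_const[of 0 "\<lambda>_. x'" x']
    by (intro exI[of _ x'] conjI exI[of _ "\<lambda>_. x'"]) auto
next
  fix y m and \<epsilon> :: real assume "\<epsilon> > 0"
  then obtain y' where y': "y' \<in> span (range e)" "p m (y' - y) < \<epsilon>" using e_dense by blast
  have "\<exists>z. (\<forall>i. (S ^^ i) (z i) = y') \<and> (\<forall>n. \<exists>N. \<forall>i\<ge>N. z i \<in> van n)"
    using y'(1)
  proof (induction rule: span_induct_alt)
    case base
    show ?case by (intro exI[of _ "\<lambda>_. 0"]) (simp add: Sn_lin subspace_0[OF subspace_van])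
  next
    case (step a x u)
    then obtain j where x: "x = e j" by blast
    obtain z where z: "\<And>i. (S ^^ i) (z i) = u" "\<And>n. \<exists>N. \<forall>i\<ge>N. z i \<in> van n" using step by blast
    define W where "W i = (\<Prod>r<i. w ((c ^^ r) j))" for i
    have W: "W i \<noteq> 0" for i using w_pos by (auto simp: W_def dest: less_imp_neq[symmetric])
    define z' where "z' i = smul (a / of_real (W i)) (e ((c ^^ i) j)) + z i" for i
    have "(S ^^ i) (z' i) = smul a x + u" for i
      using W[of i] by (simp add: z'_def Sn_lin S_funpow z x W_def[symmetric])
    moreover have "\<exists>N. \<forall>i\<ge>N. z' i \<in> van n" for n
    proof -
      obtain K where K: "\<And>k. k \<ge> K \<Longrightarrow> n \<le> l ((c ^^ k) j)" using levels by blast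
      obtain N where N: "\<And>i. i \<ge> N \<Longrightarrow> z i \<in> van n" using z(2) by blast
      have "z' i \<in> van n" if "i \<ge> max K N" for i
        unfolding z'_def using that N e_van van_mono[OF K[of i]]
        by (intro van_add van_scale) auto
      then show ?thesis by blast
    qed
    ultimately show ?case by blast
  qed
  then obtain z where z: "\<And>i. (S ^^ i) (z i) = y'" "\<And>n. \<exists>N. \<forall>i\<ge>N. z i \<in> van n" by blast
  have "conv z 0"
    unfolding conv_def
  proof
    fix m
    obtain N where "\<And>i. i \<ge> N \<Longrightarrow> z i \<in> van (Suc m)" using z(2) by blast
    then show "(\<lambda>i. p m (z i - 0)) \<longlonglongrightarrow> 0"
      using vanD by (intro tendsto_eventually eventually_sequentiallyI[of N]) auto
  qed
  then show "\<exists>y'. p m (y' - y) < \<epsilon> \<and>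
      (\<exists>z. (\<exists>N. \<forall>i\<ge>N. z i \<in> van n) \<and> conv z 0 \<and> conv (\<lambda>i. (S ^^ i) (z i)) y')"
    using y'(2) z conv_eventually_const[of 0 "\<lambda>_. y'" y']
    by (intro exI[of _ y'] conjI exI[of _ z]) auto
qed

end

section \<open>Translation of polynomials and level-raising shifts\<close>

text \<open>The forward difference operator; it becomes the shift \<open>S\<close> in the polynomial
  model below.\<close>

definition poly_delta :: "'k::real_normed_field poly \<Rightarrow> 'k poly" where
  "poly_delta q = q \<circ>\<^sub>p [:1, 1:] - q"

lemma poly_delta_pCons: "poly_delta (pCons a q) = q + poly_delta q + pCons 0 (poly_delta q)"
proof -
  have "[:1, 1:] * r = r + pCons 0 r" for r :: "'k::real_normed_field poly" by simp
  moreover have "pCons a q = [:a:] + pCons 0 q" by simp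
  ultimately show ?thesis
    by (simp add: poly_delta_def pcompose_pCons)
qed

lemma poly_delta_0 [simp]: "poly_delta 0 = 0"
  by (simp add: poly_delta_def)

lemma poly_delta_const: "degree q = 0 \<Longrightarrow> poly_delta q = 0"
  by (elim degree_eq_zeroE) (simp add: poly_delta_def)

lemma degree_poly_delta: "degree q \<le> Suc n \<Longrightarrow> degree (poly_delta q) \<le> n"
proof (induction q arbitrary: n)
  case (pCons a q)
  show ?case
  proof (cases "q = 0")
    case True
    then show ?thesis using poly_delta_const[of "[:a:]"] by simp
  next
    case False
    then have q: "degree q \<le> n" using pCons.prems by simp
    show ?thesis
    proof (cases n)
      case 0
      then show ?thesis using q poly_delta_const[of q] by (simp add: poly_delta_pCons)
    next
      case (Suc n')
      then have d: "degree (poly_delta q) \<le> n'" using pCons.IH q by simp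
      then have "degree (pCons 0 (poly_delta q)) \<le> n" using Suc by (simp add: degree_pCons_eq_if)
      then show ?thesis unfolding poly_delta_pCons using d q Suc by (intro degree_add_le) auto
    qed
  qed
qed simp

lemma poly_delta_funpow_zero: "degree q < k \<Longrightarrow> (poly_delta ^^ k) q = 0"
proof (induction k arbitrary: q)
  case (Suc k)
  show ?case
  proof (cases k)
    case 0
    then show ?thesis using Suc.prems poly_delta_const[of q] by simp
  next
    case (Suc k')
    then have "degree (poly_delta q) < k" using degree_poly_delta[of q k'] Suc.prems by simp
    then show ?thesis using Suc.IH by (simp add: funpow_swap1)
  qed
qed simp

lemma poly_delta_funpow_add: "(poly_delta ^^ k) (q + r) = (poly_delta ^^ k) q + (poly_delta ^^ k) r"
  by (induction k) (simp_all add: poly_delta_def pcompose_add)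

lemma poly_delta_funpow_smult: "(poly_delta ^^ k) (smult a q) = smult a ((poly_delta ^^ k) q)"
  by (induction k) (simp_all add: poly_delta_def pcompose_smult smult_diff_right)

text \<open>The binomial polynomials t choose k, which the forward difference moves down by
  one.\<close>

fun newton_poly :: "nat \<Rightarrow> 'k::real_normed_field poly" where
  "newton_poly 0 = 1"
| "newton_poly (Suc k) = smult (1 / of_nat (Suc k)) ([:- of_nat k, 1:] * newton_poly k)"

text \<open>The absorption identity (k+1) binom(t+1, k+1) = (t+1) binom(t, k), from which Pascal's
  rule \<open>poly_delta_newton\<close> follows.\<close>

lemma newton_poly_shift:
  "(newton_poly :: nat \<Rightarrow> 'k::real_normed_field poly) (Suc k) \<circ>\<^sub>p [:1, 1:] = smult (1 / of_nat (Suc k)) ([:1, 1:] * newton_poly k)"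
proof (induction k)
  case 0
  show ?case by (simp add: pcompose_pCons pcompose_smult pcompose_mult pcompose_1)
next
  case (Suc k)
  have "[:- of_nat (Suc k), 1:] \<circ>\<^sub>p [:1, 1:] = [:- of_nat k, 1 :: 'k:]"
    by (simp add: pcompose_pCons)
  then have "(newton_poly (Suc (Suc k)) :: 'k poly) \<circ>\<^sub>p [:1, 1:] =
      smult (1 / of_nat (Suc (Suc k))) ([:- of_nat k, 1:] * (newton_poly (Suc k) \<circ>\<^sub>p [:1, 1:]))"
    by (subst newton_poly.simps(2)) (simp only: pcompose_smult pcompose_mult)
  also have "\<dots> = smult (1 / of_nat (Suc (Suc k))) ([:1, 1:] * newton_poly (Suc k))"
    unfolding Suc by (simp only: newton_poly.simps(2) mult_smult_right mult.left_commute)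
  finally show ?case .
qed

lemma poly_delta_newton: "poly_delta (newton_poly (Suc k)) = (newton_poly k :: 'k::real_normed_field poly)"
proof -
  have "poly_delta (newton_poly (Suc k)) =
      smult (1 / of_nat (Suc k)) (([:1, 1:] - [:- of_nat k, 1:]) * (newton_poly k :: 'k poly))"
    unfolding poly_delta_def newton_poly_shift
    by (simp only: newton_poly.simps(2) smult_diff_right[symmetric] left_diff_distrib)
  also have "[:1, 1:] - [:- of_nat k, 1:] = [:of_nat (Suc k) :: 'k:]" by simp
  also have "smult (1 / of_nat (Suc k)) ([:of_nat (Suc k):] * newton_poly k) = newton_poly k"
    by (simp del: of_nat_Suc)
  finally show ?thesis .
qed

lemma poly_newton_0: "poly (newton_poly k) 0 = (if k = 0 then 1 else 0)"
proof (cases k)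
  case (Suc j)
  then show ?thesis by (induction j arbitrary: k) auto
qed simp

lemma degree_newton_poly: "degree (newton_poly k :: 'k::real_normed_field poly) \<le> k"
proof (induction k)
  case (Suc k)
  have "degree ([:- of_nat k, 1:] * (newton_poly k :: 'k poly)) \<le> 1 + degree (newton_poly k :: 'k poly)"
    by (rule order_trans[OF degree_mult_le]) simp
  then show ?case using Suc by simp
qed simp

lemma poly_delta_funpow_newton:
  "(poly_delta ^^ j) (newton_poly k) = (if j \<le> k then newton_poly (k - j) else 0)"
proof (cases "j \<le> k")
  case True
  then show ?thesis
  proof (induction j)
    case (Suc j)
    then have "k - j = Suc (k - Suc j)" by simp
    then show ?case using Suc by (simp add: poly_delta_newton del: newton_poly.simps)
  qed simp
next
  case False
  then show ?thesis
    by (simp add: not_le poly_delta_funpow_zero[OF le_less_trans[OF degree_newton_poly]])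
qed

lemma pcompose_power: "(q ^ n) \<circ>\<^sub>p r = (q \<circ>\<^sub>p r) ^ n"
  for q r :: "'k::comm_ring_1 poly"
  by (induction n) (simp_all add: pcompose_1 pcompose_mult)

lemma linear_poly_power:
  fixes c :: "'k::real_normed_field"
  shows "[:c, 1:] ^ b = (\<Sum>i\<le>b. smult (of_nat (b choose i) * c ^ (b - i)) ([:0, 1:] ^ i))"
proof -
  have "[:c, 1:] = [:0, 1:] + [:c:]" by simp
  then have "[:c, 1:] ^ b = (\<Sum>i\<le>b. of_nat (b choose i) * [:0, 1:] ^ i * [:c:] ^ (b - i))"
    by (simp only: binomial_ring)
  also have "\<dots> = (\<Sum>i\<le>b. smult (of_nat (b choose i) * c ^ (b - i)) ([:0, 1:] ^ i))"
    by (intro sum.cong) (simp_all add: poly_const_pow of_nat_poly mult_ac)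
  finally show ?thesis .
qed

section \<open>The polynomial model of the unilateral shift\<close>

context shift_system
begin

text \<open>Division by the weights met so far turns \<open>S\<close> into an unweighted shift when
  \<open>c = Suc\<close>.\<close>

definition chain :: "nat \<Rightarrow> 'a" where
  "chain k = smul (of_real (1 / (\<Prod>r<k. w r))) (e k)"

text \<open>By Newton's formula a polynomial is the sum of its iterated differences at 0 times the
  binomial polynomials, so this is the linear map sending \<open>newton_poly k\<close> to
  \<open>chain k\<close>. For \<open>c = Suc\<close> it intertwines \<open>poly_delta\<close> with
  \<open>S\<close>, hence translation by 1 with 1 + S.\<close>

definition poly_vec :: "'k poly \<Rightarrow> 'a" where
  "poly_vec q = (\<Sum>k\<le>degree q. smul (poly ((poly_delta ^^ k) q) 0) (chain k))"

lemma poly_vec_altdef: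
  "degree q \<le> n \<Longrightarrow> poly_vec q = (\<Sum>k\<le>n. smul (poly ((poly_delta ^^ k) q) 0) (chain k))"
  unfolding poly_vec_def
  by (rule sum.mono_neutral_left) (auto simp: poly_delta_funpow_zero)

lemma poly_vec_add: "poly_vec (q + r) = poly_vec q + poly_vec r"
proof -
  define n where "n = max (degree q) (degree r)"
  have "degree q \<le> n" "degree r \<le> n" "degree (q + r) \<le> n"
    by (auto simp: n_def degree_add_le_max)
  then show ?thesis
    by (simp add: poly_vec_altdef[of _ n] poly_delta_funpow_add scale_left_distrib sum.distrib)
qed

lemma poly_vec_smult: "poly_vec (smult a q) = smul a (poly_vec q)"
  using degree_smult_le[of a q]
  by (simp add: poly_vec_altdef[of _ "degree q"] poly_delta_funpow_smult scale_sum_right)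

lemma poly_vec_0 [simp]: "poly_vec 0 = 0"
  by (simp add: poly_vec_def)

lemma poly_vec_sum: "poly_vec (\<Sum>i\<in>I. q i) = (\<Sum>i\<in>I. poly_vec (q i))"
  by (induction I rule: infinite_finite_induct) (simp_all add: poly_vec_add)

lemma poly_vec_newton: "poly_vec (newton_poly k) = chain k"
proof -
  have "poly_vec (newton_poly k) = (\<Sum>j\<le>k. smul (if j = k then 1 else 0) (chain j))"
    unfolding poly_vec_altdef[OF degree_newton_poly]
    by (intro sum.cong) (auto simp: poly_delta_funpow_newton poly_newton_0)
  also have "\<dots> = (\<Sum>j\<le>k. if j = k then chain k else 0)" by (intro sum.cong) auto
  finally show ?thesis by simp
qed

lemma span_poly_vec: "x \<in> span (range e) \<Longrightarrow> \<exists>q. x = poly_vec q"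
proof (induction rule: span_induct_alt)
  case base
  show ?case by (intro exI[of _ 0]) simp
next
  case (step a x y)
  then obtain k q where k: "x = e k" "y = poly_vec q" by blast
  have "(\<Prod>r<k. w r) \<noteq> 0" using w_pos by (auto dest: less_imp_neq[symmetric])
  then have "x = smul (of_real (\<Prod>r<k. w r)) (poly_vec (newton_poly k))"
    unfolding poly_vec_newton k chain_def scale_scale of_real_mult[symmetric] by simp
  then have "smul a x + y = poly_vec (smult (a * of_real (\<Prod>r<k. w r)) (newton_poly k) + q)"
    by (simp only: poly_vec_add poly_vec_smult k(2)) simp
  then show ?case by blast
qed

context
  assumes c_Suc: "c = Suc"
begin

lemma S_chain: "S (chain (Suc k)) = chain k" "S (chain 0) = 0"
proof -
  have "S (e (Suc k)) = smul (of_real (w k)) (e k)" using S_c[of k] c_Suc by simp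
  then have "S (chain (Suc k)) = smul (of_real (1 / (\<Prod>r<Suc k. w r) * w k)) (e k)"
    by (simp only: chain_def S_lin scale_scale of_real_mult)
  also have "1 / (\<Prod>r<Suc k. w r) * w k = 1 / (\<Prod>r<k. w r)" using w_pos[of k] by simp
  finally show "S (chain (Suc k)) = chain k" by (simp only: chain_def)
  have "S (e 0) = 0" by (rule S_root) (simp add: c_Suc)
  then show "S (chain 0) = 0" by (simp add: chain_def S_lin)
qed

lemma poly_vec_delta: "poly_vec (poly_delta q) = S (poly_vec q)"
proof -
  define n where "n = degree q"
  have "degree (poly_delta q) \<le> n" unfolding n_def using degree_poly_delta[of q "degree q"] by simp
  then have "poly_vec (poly_delta q) = (\<Sum>k\<le>n. smul (poly ((poly_delta ^^ Suc k) q) 0) (chain k))"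
    by (simp add: poly_vec_altdef funpow_swap1)
  also have "\<dots> = (\<Sum>k\<le>Suc n. smul (poly ((poly_delta ^^ k) q) 0) (S (chain k)))"
    unfolding sum.atMost_Suc_shift[of _ n] by (simp add: S_chain)
  also have "\<dots> = S (\<Sum>k\<le>Suc n. smul (poly ((poly_delta ^^ k) q) 0) (chain k))"
    by (simp only: S_lin)
  also have "\<dots> = S (poly_vec q)" by (subst poly_vec_altdef[of q "Suc n"]) (simp_all add: n_def)
  finally show ?thesis .
qed

definition T :: "'a \<Rightarrow> 'a" where
  "T x = x + S x"

lemma T_cont: "cont_lin T"
  using cont_lin_add[OF cont_lin_id S_cont] by (simp add: T_def[abs_def])

lemmas Tn_lin = lin_rules[OF cont_lin_lin[OF cont_lin_funpow[OF T_cont]]]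

lemma T_poly_vec: "(T ^^ n) (poly_vec q) = poly_vec (q \<circ>\<^sub>p [:of_nat n, 1:])"
proof (induction n)
  case (Suc n)
  have "T (poly_vec r) = poly_vec (r \<circ>\<^sub>p [:1, 1:])" for r
  proof -
    have "r \<circ>\<^sub>p [:1, 1:] = r + poly_delta r" by (simp add: poly_delta_def)
    then show ?thesis by (simp only: poly_vec_add poly_vec_delta T_def)
  qed
  then have "(T ^^ Suc n) (poly_vec q) = poly_vec (q \<circ>\<^sub>p [:of_nat n, 1:] \<circ>\<^sub>p [:1, 1:])"
    using Suc by simp
  also have "q \<circ>\<^sub>p [:of_nat n, 1:] \<circ>\<^sub>p [:1, 1:] = q \<circ>\<^sub>p [:of_nat (Suc n), 1:]"
    by (simp add: pcompose_assoc[symmetric] pcompose_pCons add.commute)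
  finally show ?case .
qed simp

text \<open>Expanding the second factor leaves finitely many fixed vectors, so convergence of the
  coefficients is enough; in the limit only the term of degree \<open>a\<close> remains.\<close>

lemma conv_binomial_family:
  fixes s :: "nat \<Rightarrow> 'k"
  assumes "\<And>i. i \<le> b \<Longrightarrow>
    (\<lambda>n. s n * (of_nat (b choose i) * (\<sigma> * of_nat n) ^ (b - i))) \<longlonglongrightarrow> (if i = 0 then t else 0)"
  shows "conv (\<lambda>n. poly_vec (smult (s n) ([:0, 1:] ^ a * [:\<sigma> * of_nat n, 1:] ^ b)))
    (smul t (poly_vec ([:0, 1:] ^ a)))"
proof -
  have eq: "poly_vec (smult (s n) ([:0, 1:] ^ a * [:\<sigma> * of_nat n, 1:] ^ b)) =
    (\<Sum>i\<le>b. smul (s n * (of_nat (b choose i) * (\<sigma> * of_nat n) ^ (b - i))) (poly_vec ([:0, 1:] ^ (a + i))))" for n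
    unfolding linear_poly_power[of "\<sigma> * of_nat n"]
    by (simp only: sum_distrib_left mult_smult_right power_add poly_vec_smult poly_vec_sum
        scale_sum_right scale_scale)
  have "conv (\<lambda>n. poly_vec (smult (s n) ([:0, 1:] ^ a * [:\<sigma> * of_nat n, 1:] ^ b)))
      (\<Sum>i\<le>b. smul (if i = 0 then t else 0) (poly_vec ([:0, 1:] ^ (a + i))))"
    unfolding eq using assms by (intro conv_sum conv_coeff) auto
  also have "(\<Sum>i\<le>b. smul (if i = 0 then t else 0) (poly_vec ([:0, 1:] ^ (a + i)))) =
      (\<Sum>i\<le>b. if i = 0 then smul t (poly_vec ([:0, 1:] ^ a)) else 0)"
    by (intro sum.cong) auto
  also have "\<dots> = smul t (poly_vec ([:0, 1:] ^ a))" by simp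
  finally show ?thesis .
qed

lemma coefficient_limit:
  "(\<lambda>n. 1 / of_nat n ^ k * (K * (\<sigma> * of_nat n) ^ j)) \<longlonglongrightarrow> (if j = k then K * \<sigma> ^ j else (0::'k))"
  if "j \<le> k"
proof (rule Lim_transform_eventually)
  have "(\<lambda>n. K * \<sigma> ^ j * (1 / of_nat n) ^ (k - j)) \<longlonglongrightarrow> K * \<sigma> ^ j * 0 ^ (k - j)"
    by (intro tendsto_intros lim_1_over_n)
  also have "K * \<sigma> ^ j * 0 ^ (k - j) = (if j = k then K * \<sigma> ^ j else 0)" using that by auto
  finally show "(\<lambda>n. K * \<sigma> ^ j * (1 / of_nat n) ^ (k - j)) \<longlonglongrightarrow> (if j = k then K * \<sigma> ^ j else 0)" .
  show "\<forall>\<^sub>F n in sequentially. K * \<sigma> ^ j * (1 / of_nat n) ^ (k - j) =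
      1 / of_nat n ^ k * (K * (\<sigma> * of_nat n) ^ j)"
    using eventually_gt_at_top[of 0]
  proof eventually_elim
    case (elim n)
    have "(of_nat n :: 'k) ^ k = of_nat n ^ (k - j) * of_nat n ^ j"
      using that by (simp flip: power_add)
    then show ?case using elim by (simp add: power_mult_distrib power_divide)
  qed
qed

text \<open>In the polynomial model \<open>T\<close> is the translation by \<open>1\<close>, and
  \<open>(t/n)\<^sup>m\<^sup>+\<^sup>1 (t - n)\<^sup>m\<close> tends to \<open>0\<close> while its translate by \<open>n\<close>, \<open>(1 + t/n)\<^sup>m\<^sup>+\<^sup>1 t\<^sup>m\<close>, tends to \<open>t\<^sup>m\<close>.
  Reflecting \<open>t\<close> exchanges the roles of the two limits.\<close>

lemma T_mixing: "mixing_on T UNIV"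
proof -
  have lim0: "conv (\<lambda>n. poly_vec (smult (1 / of_nat n ^ Suc m) ([:0, 1:] ^ Suc m * [:\<sigma> * of_nat n, 1:] ^ m))) 0"
    for m \<sigma>
  proof -
    have "(\<lambda>n. 1 / of_nat n ^ Suc m * (of_nat (m choose i) * (\<sigma> * of_nat n) ^ (m - i)))
        \<longlonglongrightarrow> (if i = 0 then 0 else 0)" for i
    proof -
      have "m - i \<le> Suc m" "m - i \<noteq> Suc m" by auto
      then show ?thesis
        using coefficient_limit[of "m - i" "Suc m" "of_nat (m choose i)" \<sigma>] by (simp del: power_Suc)
    qed
    from conv_binomial_family[OF this, of "Suc m"] show ?thesis by simp
  qed
  have lim1: "conv (\<lambda>n. poly_vec (smult (1 / of_nat n ^ Suc m) ([:0, 1:] ^ m * [:\<sigma> * of_nat n, 1:] ^ Suc m)))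
      (smul (\<sigma> ^ Suc m) (poly_vec ([:0, 1:] ^ m)))" for m \<sigma>
  proof (rule conv_binomial_family)
    fix i
    show "(\<lambda>n. 1 / of_nat n ^ Suc m * (of_nat (Suc m choose i) * (\<sigma> * of_nat n) ^ (Suc m - i)))
        \<longlonglongrightarrow> (if i = 0 then \<sigma> ^ Suc m else 0)"
    proof -
      have "(Suc m - i = Suc m) = (i = 0)" by auto
      then show ?thesis
        using coefficient_limit[of "Suc m - i" "Suc m" "of_nat (Suc m choose i)" \<sigma>]
        by (cases "i = 0") (simp_all del: power_Suc binomial_Suc_Suc)
    qed
  qed
  \<comment> \<open>Translation by \<open>n\<close> turns t^a (t - n)^b into (t + n)^a t^b, which
    has the same form with \<sigma> changed from -1 to 1.\<close>
  have translate: "(T ^^ n) (poly_vec (smult s ([:0, 1:] ^ a * [:- 1 * of_nat n, 1:] ^ b))) =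
      poly_vec (smult s ([:0, 1:] ^ b * [:1 * of_nat n, 1:] ^ a))" for n s a b
    by (simp add: T_poly_vec pcompose_smult pcompose_mult pcompose_power pcompose_pCons mult.commute)
  have up: "\<exists>z. conv z 0 \<and> conv (\<lambda>n. (T ^^ n) (z n)) (poly_vec ([:0, 1:] ^ m))" for m
    using lim0[of m "- 1"] lim1[of m 1] unfolding translate[symmetric, of "1 / of_nat n ^ Suc m" for n]
    by auto
  have down: "\<exists>z. conv z (poly_vec ([:0, 1:] ^ m)) \<and> conv (\<lambda>n. (T ^^ n) (z n)) 0" for m
  proof -
    \<comment> \<open>\<open>u n\<close> tends to \<open>(- 1) ^ Suc m\<close> times the wanted
      vector; a second factor of the same sign corrects this.\<close>
    define u where "u n = poly_vec (smult (1 / of_nat n ^ Suc m) ([:0, 1:] ^ m * [:- 1 * of_nat n, 1:] ^ Suc m))" for n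
    have "conv (\<lambda>n. smul ((- 1) ^ Suc m) (u n)) (smul ((- 1) ^ Suc m) (smul ((- 1) ^ Suc m) (poly_vec ([:0, 1:] ^ m))))"
      unfolding u_def by (intro conv_scale lim1)
    then have 1: "conv (\<lambda>n. smul ((- 1) ^ Suc m) (u n)) (poly_vec ([:0, 1:] ^ m))"
      by (simp flip: power_mult_distrib)
    have "conv (\<lambda>n. (T ^^ n) (u n)) 0"
      unfolding u_def translate by (rule lim0)
    then have "conv (\<lambda>n. (T ^^ n) (smul ((- 1) ^ Suc m) (u n))) 0"
      using conv_scale[of "\<lambda>n. (T ^^ n) (u n)" 0 "(- 1) ^ Suc m"]
      by (simp only: Tn_lin(2) scale_zero_right)
    then show ?thesis using 1 by blast
  qed
  have rep: "poly_vec q = (\<Sum>i\<le>degree q. smul (coeff q i) (poly_vec ([:0, 1:] ^ i)))" for q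
  proof -
    have "q = (\<Sum>i\<le>degree q. smult (coeff q i) ([:0, 1:] ^ i))"
      using poly_as_sum_of_monoms[of q] by (simp add: monom_altdef)
    then show ?thesis by (metis (mono_tags, lifting) poly_vec_smult poly_vec_sum sum.cong)
  qed
  show ?thesis
  proof (rule mixing_onI[OF T_cont subspace_UNIV])
    fix x m and \<epsilon> :: real assume "\<epsilon> > 0"
    then obtain x' where x': "x' \<in> span (range e)" "p m (x' - x) < \<epsilon>" using e_dense by blast
    obtain q where q: "x' = poly_vec q" using span_poly_vec[OF x'(1)] by blast
    obtain z where z: "\<And>i. conv (z i) (poly_vec ([:0, 1:] ^ i))" "\<And>i. conv (\<lambda>n. (T ^^ n) (z i n)) 0"
      using down by metis
    have "conv (\<lambda>n. \<Sum>i\<le>degree q. smul (coeff q i) (z i n)) x'"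
      unfolding q rep[of q] by (intro conv_sum conv_scale z)
    moreover have "conv (\<lambda>n. (T ^^ n) (\<Sum>i\<le>degree q. smul (coeff q i) (z i n))) (\<Sum>i\<le>degree q. smul (coeff q i) 0)"
      unfolding Tn_lin by (intro conv_sum conv_scale z)
    ultimately show "\<exists>x'. p m (x' - x) < \<epsilon> \<and> (\<exists>z. (\<exists>N. \<forall>n\<ge>N. z n \<in> UNIV) \<and> conv z x' \<and> conv (\<lambda>n. (T ^^ n) (z n)) 0)"
      using x'(2) by auto
  next
    fix y m and \<epsilon> :: real assume "\<epsilon> > 0"
    then obtain y' where y': "y' \<in> span (range e)" "p m (y' - y) < \<epsilon>" using e_dense by blast
    obtain q where q: "y' = poly_vec q" using span_poly_vec[OF y'(1)] by blast
    obtain z where z: "\<And>i. conv (z i) 0" "\<And>i. conv (\<lambda>n. (T ^^ n) (z i n)) (poly_vec ([:0, 1:] ^ i))"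
      using up by metis
    have "conv (\<lambda>n. \<Sum>i\<le>degree q. smul (coeff q i) (z i n)) (\<Sum>i\<le>degree q. smul (coeff q i) 0)"
      by (intro conv_sum conv_scale z)
    moreover have "conv (\<lambda>n. (T ^^ n) (\<Sum>i\<le>degree q. smul (coeff q i) (z i n))) y'"
      unfolding Tn_lin q rep[of q] by (intro conv_sum conv_scale z)
    ultimately show "\<exists>y'. p m (y' - y) < \<epsilon> \<and> (\<exists>z. (\<exists>N. \<forall>n\<ge>N. z n \<in> UNIV) \<and> conv z 0 \<and> conv (\<lambda>n. (T ^^ n) (z n)) y')"
      using y'(2) by auto
  qed
qed

lemma T_dense_range: "poly_dense_range T"
  by (rule poly_dense_range_shift[OF cont_lin_lin[OF S_cont] T_def S_dense_range])

end

end

text \<open>One element \<open>d i\<close> of strictly increasing level is reserved for every \<open>i\<close>. Outside the reserve, \<open>c j\<close>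
  is the previous index of the same level; the first index of a level and the reserved ones are sent
  to reserved indices of higher level.\<close>

lemma level_successor_exists:
  fixes l :: "nat \<Rightarrow> nat"
  assumes unbounded: "\<And>N. \<exists>k. N < l k"
  obtains c where "inj c" "\<And>n. \<exists>N. \<forall>j. l j \<le> n \<longrightarrow> l (c j) \<le> N"
    "\<And>j n. \<exists>K. \<forall>k\<ge>K. n \<le> l ((c ^^ k) j)" "\<And>n j. n > 0 \<Longrightarrow> (c ^^ n) j \<noteq> j"
proof -
  obtain d where d: "\<And>i. l (d i) < l (d (Suc i))"
    using dependent_nat_choice[of "\<lambda>_ _. True" "\<lambda>_ x y. l x < l y"] unbounded by metis
  have ld: "strict_mono (\<lambda>i. l (d i))" using d by (simp add: strict_mono_Suc_iff)
  have ld_ge: "i \<le> l (d i)" for i using strict_mono_imp_increasing[OF ld] .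
  define prev where "prev j = {i. i < j \<and> l i = l j \<and> i \<notin> range d}" for j
  \<comment> \<open>Odd and even positions in the reserve keep the two kinds of jumps apart. A
    reserved index is determined by its level, as is the first unreserved index of a level, so jumps
    of one kind do not collide. They raise the level because \<open>l (d i) \<ge> i\<close>.\<close>
  define c where "c j = (if j \<in> range d then d (2 * l j + 1)
    else if prev j = {} then d (2 * l j + 2) else Max (prev j))" for j
  have fin: "finite (prev j)" for j by (simp add: prev_def)
  have prev: "Max (prev j) < j" "l (Max (prev j)) = l j" "Max (prev j) \<notin> range d" if "prev j \<noteq> {}" for j
    using Max_in[OF fin that] unfolding prev_def[of j] by blast+
  have d_inj: "d i = d j \<Longrightarrow> i = j" and ld_inj: "l (d i) = l (d j) \<Longrightarrow> i = j" for i j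
    using strict_mono_eq[OF ld, of i j] by auto
  have cR: "c j = d (2 * l j + 1)" if "j \<in> range d" for j
    using that by (simp add: c_def)
  have cN: "c j = d (2 * l j + 2)" if "j \<notin> range d" "prev j = {}" for j
    using that by (simp add: c_def)
  have cP: "c j = Max (prev j)" "c j < j" "l (c j) = l j" "c j \<notin> range d"
    if "j \<notin> range d" "prev j \<noteq> {}" for j
    using that prev[OF that(2)] by (simp_all add: c_def)
  have dR: "d i \<in> range d" for i by simp
  have c_inj: False if eq: "c j = c j'" and lt: "j < j'" for j j'
  proof -
    consider "j \<in> range d" | "j \<notin> range d" "prev j = {}" | "j \<notin> range d" "prev j \<noteq> {}" by blast
    note casej = this
    consider "j' \<in> range d" | "j' \<notin> range d" "prev j' = {}" | "j' \<notin> range d" "prev j' \<noteq> {}" by blast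
    then show False
    proof cases
      case j': 1
      from casej show False
      proof cases
        case 1
        then have "2 * l j + 1 = 2 * l j' + 1" using eq cR[of j] cR[OF j'] d_inj by metis
        then show False using 1 j' ld_inj lt by auto
      next
        case 2
        then have "2 * l j + 2 = 2 * l j' + 1" using eq cN[of j] cR[OF j'] d_inj by metis
        then show False by presburger
      next
        case 3
        then show False using eq cP(4)[of j] cR[OF j'] dR by metis
      qed
    next
      case j': 2
      from casej show False
      proof cases
        case 1
        then have "2 * l j + 1 = 2 * l j' + 2" using eq cR[of j] cN[OF j'] d_inj by metis
        then show False by presburger
      next
        case 2
        then have "2 * l j + 2 = 2 * l j' + 2" using eq cN[of j] cN[OF j'] d_inj by metis
        then have "j \<in> prev j'" using 2 lt by (simp add: prev_def)
        then show False using j' by blast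
      next
        case 3
        then show False using eq cP(4)[of j] cN[OF j'] dR by metis
      qed
    next
      case j': 3
      from casej show False
      proof cases
        case 1
        then show False using eq cP(4)[OF j'] cR[of j] dR by metis
      next
        case 2
        then show False using eq cP(4)[OF j'] cN[of j] dR by metis
      next
        case 3
        then have "l j = l j'" using eq cP(3)[of j] cP(3)[OF j'] by metis
        then have "j \<in> prev j'" using 3 lt by (simp add: prev_def)
        \<comment> \<open>\<open>j\<close> is a candidate for the maximum \<open>c j'\<close>,
          whereas \<open>c j < j\<close>.\<close>
        then have "j \<le> c j'" using cP(1)[OF j'] fin by simp
        then show False using eq cP(2)[OF 3] by simp
      qed
    qed
  qed
  have "inj c"
    using c_inj by (intro injI) (metis linorder_neqE_nat)
  moreover have "\<exists>N. \<forall>j. l j \<le> n \<longrightarrow> l (c j) \<le> N" for n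
  proof (intro exI[of _ "l (d (2 * n + 2)) + n"] allI impI)
    fix j assume j: "l j \<le> n"
    have "l (d i) \<le> l (d (2 * n + 2))" if "i \<le> 2 * n + 2" for i
      using that strict_mono_less_eq[OF ld, of i "2 * n + 2"] by simp
    then show "l (c j) \<le> l (d (2 * n + 2)) + n"
      using j prev(2)[of j] by (auto simp: c_def intro: trans_le_add1)
  qed
  moreover have levels: "\<exists>K. \<forall>k\<ge>K. n \<le> l ((c ^^ k) j)" for j n
  proof -
    have step: "c i \<in> range d \<and> l i < l (c i)" if "i \<in> range d" for i
      using that ld_ge[of "2 * l i + 1"] by (simp add: c_def)
    have up: "(c ^^ k) i \<in> range d \<and> l i + k \<le> l ((c ^^ k) i)" if "i \<in> range d" for i k
    proof (induction k)
      case (Suc k)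
      then show ?case using step[of "(c ^^ k) i"] by auto
    qed (use that in simp)
    \<comment> \<open>Outside the reserve \<open>c\<close> lowers the index until the first one of
      the level is reached, which is sent into the reserve.\<close>
    have "\<exists>K. (c ^^ K) j \<in> range d"
    proof (induction j rule: less_induct)
      case (less j)
      show ?case
      proof (cases "j \<in> range d \<or> prev j = {}")
        case True
        then have "(c ^^ 1) j \<in> range d" by (auto simp: c_def)
        then show ?thesis by blast
      next
        case False
        then have "c j = Max (prev j)" "c j < j" using prev(1)[of j] by (auto simp: c_def)
        then obtain K where "(c ^^ K) (c j) \<in> range d" using less by metis
        then have "(c ^^ Suc K) j \<in> range d" by (simp add: funpow_swap1)
        then show ?thesis by blast
      qed
    qed
    then obtain K where K: "(c ^^ K) j \<in> range d" by blast
    have "n \<le> l ((c ^^ k) j)" if "k \<ge> K + n" for k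
    proof -
      have "k = (k - K) + K" using that by simp
      then have "(c ^^ k) j = (c ^^ (k - K)) ((c ^^ K) j)" by (metis funpow_add o_apply)
      moreover have "n \<le> k - K" using that by simp
      ultimately show ?thesis using up[OF K, of "k - K"] by (metis add_leE le_trans)
    qed
    then show ?thesis by blast
  qed
  moreover have "(c ^^ n) j \<noteq> j" if "n > 0" for n j
  proof
    assume cyc: "(c ^^ n) j = j"
    \<comment> \<open>A cycle would return to \<open>j\<close> at arbitrarily late times, against
      the growth of the levels.\<close>
    have "(c ^^ (n * k)) j = j" for k
      by (induction k) (simp_all add: cyc funpow_add)
    moreover obtain K where "\<And>k. k \<ge> K \<Longrightarrow> Suc (l j) \<le> l ((c ^^ k) j)" using levels by blast
    moreover have "n * K \<ge> K" using that by simp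
    ultimately show False by (metis Suc_n_not_le_n)
  qed
  ultimately show ?thesis by (rule that[of c])
qed

section \<open>An operator adapted to a given dense subspace\<close>

context graded_frechet
begin

lemma hypercyclic_invariant_subspace:
  fixes b :: "nat \<Rightarrow> 'a" and r :: "nat \<Rightarrow> nat \<Rightarrow> 'a"
  assumes b: "independent (range b)" "inj b" and dense: "van_dense (span (range b))"
    and r: "\<And>n i. r n i \<in> van n" "\<And>n x m e. x \<in> van n \<Longrightarrow> e > 0 \<Longrightarrow> \<exists>i. p m (r n i - x) < e"
    and alt: "(\<forall>x. p 0 x = 0 \<longrightarrow> x = 0) \<or> (\<forall>n. \<exists>x\<in>van n. x \<noteq> 0)"
  obtains T where "cont_lin T" "T ` span (range b) \<subseteq> span (range b)"
    "\<And>v. v \<in> span (range b) \<Longrightarrow> v \<noteq> 0 \<Longrightarrow> hypercyclic_vec T v"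
proof -
  obtain e :: "nat \<Rightarrow> 'a" and f l C where e: "span (range e) = span (range b)" "\<And>k. e k \<in> van (l k)"
    "\<And>k. C k \<ge> 0" "\<And>k. lfun (f k)" "\<And>k v. norm (f k v) \<le> C k * p (l k) v"
    "\<And>j k. f k (e j) = (if j = k then 1 else 0)"
    using biorthogonal_basis[OF b] by metis
  interpret biorthogonal_system smul p e f l C
    by (intro biorthogonal_system.intro biorthogonal_system_axioms.intro graded_frechet_axioms)
      (rule e)+
  have dense': "van_dense (span (range e))" using dense e(1) by simp
  have e_dense: "\<exists>y\<in>span (range e). p m (y - x) < \<epsilon>" if "\<epsilon> > 0" for x m \<epsilon>
  proof -
    have "x \<in> van 0" by simp
    then show ?thesis using dense' that unfolding van_dense_def by blast
  qed
  have "\<exists>T0 (\<mu> :: nat \<Rightarrow> nat). cont_lin T0 \<and> poly_dense_range T0 \<and> (\<forall>n. mixing_on T0 (van (\<mu> n))) \<and>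
      (\<forall>n::nat. n \<in> range \<mu> \<or> van n = {0})"
    using alt
  proof
    assume norm: "\<forall>x. p 0 x = 0 \<longrightarrow> x = 0"
    have l0: "l k = 0" for k
    proof (rule ccontr)
      assume "l k \<noteq> 0"
      then have "p 0 (e k) = 0" using e(2)[of k] by (simp add: van_def)
      then have "f k (e k) = 0" using norm lfun_zero[OF e(4)] by metis
      then show False using e(6) by simp
    qed
    obtain S w where "cont_lin S" "\<And>j. 0 < w j" "\<And>j. w j \<le> 1 / real (Suc j)" "\<And>j. w j * p j (e j) \<le> 1"
        "\<And>j. S (e (Suc j)) = smul (of_real (w j)) (e j)" "\<And>k. k \<notin> range Suc \<Longrightarrow> S (e k) = 0"
      using weighted_shift_exists[of Suc] l0 by auto
    then interpret shift_system smul p e f l C Suc S w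
      using e_dense by unfold_locales auto
    \<comment> \<open>Hence mixing on the whole space covers every nontrivial level, and
      \<open>\<mu>\<close> can be constantly 0.\<close>
    have "van n = {0}" if "n \<noteq> 0" for n
      using norm that by (auto simp: van_def)
    then show ?thesis
      using T_cont[OF refl] T_dense_range[OF refl] T_mixing[OF refl]
      by (intro exI[of _ "T"] exI[of _ "\<lambda>_. 0"]) auto
  next
    assume nonzero: "\<forall>n. \<exists>x\<in>van n. x \<noteq> 0"
    \<comment> \<open>If all levels were at most \<open>N\<close>, every coordinate
      \<open>f k\<close> would vanish on \<open>van (Suc N)\<close>, so that space would meet the
      span only in 0 and, by density, be trivial.\<close>
    have unbounded: "\<exists>k. N < l k" for N
    proof (rule ccontr)
      assume "\<not> ?thesis"
      then have lN: "l k \<le> N" for k by (auto simp: not_less)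
      obtain x where x: "x \<in> van (Suc N)" "x \<noteq> 0" using nonzero by blast
      obtain m where m: "p m x \<noteq> 0" using p_eq_0 x(2) by blast
      then have "p m x > 0" using p_nonneg[of m x] by linarith
      then obtain y where y: "y \<in> span (range e)" "y \<in> van (Suc N)" "p m (y - x) < p m x"
        using dense' x(1) unfolding van_dense_def by blast
      have fy: "f k y = 0" for k
      proof -
        have "p (l k) y = 0" using vanD[OF y(2)] lN[of k] by simp
        then show ?thesis using e(5)[of k y] by simp
      qed
      have "\<exists>K. y = (\<Sum>k<K. smul (f k y) (e k))"
        using y(1)
      proof (induction rule: span_induct_alt)
        case base
        show ?case by (intro exI[of _ 0]) simp
      next
        case (step a u v)
        then obtain i K where i: "u = e i" "v = (\<Sum>k<K. smul (f k v) (e k))" by blast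
        have ext: "v = (\<Sum>k<M. smul (f k v) (e k))" if "M \<ge> K" for M
        proof -
          have "f k v = 0" if "k \<ge> K" for k
            using that by (subst i(2)) (simp add: lfun_rules[OF e(4)] e(6))
          then show ?thesis using that
            by (subst i(2)) (rule sum.mono_neutral_left, auto)
        qed
        define M where "M = max K (Suc i)"
        have "smul (f k (smul a u + v)) (e k) = (if k = i then smul a (e i) else 0) + smul (f k v) (e k)" for k
          by (simp add: lfun_rules[OF e(4)] e(6) i(1) scale_left_distrib)
        then have "(\<Sum>k<M. smul (f k (smul a u + v)) (e k)) =
            (\<Sum>k<M. if k = i then smul a (e i) else 0) + (\<Sum>k<M. smul (f k v) (e k))"
          by (simp only: sum.distrib)
        also have "\<dots> = smul a u + v"
          using ext[of M] by (simp add: M_def i(1) less_max_iff_disj)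
        finally show ?case by metis
      qed
      then have "y = 0" using fy by auto
      then show False using y(3) by simp
    qed
    obtain c where c: "inj c" "\<And>n. \<exists>N. \<forall>j. l j \<le> n \<longrightarrow> l (c j) \<le> N"
      "\<And>j n. \<exists>K. \<forall>k\<ge>K. n \<le> l ((c ^^ k) j)" "\<And>n j. n > 0 \<Longrightarrow> (c ^^ n) j \<noteq> j"
      using level_successor_exists[OF unbounded] by metis
    obtain S w where "cont_lin S" "\<And>j. 0 < w j" "\<And>j. w j \<le> 1 / real (Suc j)" "\<And>j. w j * p j (e j) \<le> 1"
        "\<And>j. S (e (c j)) = smul (of_real (w j)) (e j)" "\<And>k. k \<notin> range c \<Longrightarrow> S (e k) = 0"
      using weighted_shift_exists[OF c(1,2)] by metis
    then interpret shift_system smul p e f l C c S w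
      using e_dense c by unfold_locales auto
    show ?thesis
      using S_cont S_dense_range S_mixing[OF c(3) dense']
      by (intro exI[of _ S] exI[of _ "\<lambda>n::nat. n"]) simp
  qed
  then obtain T0 and \<mu> :: "nat \<Rightarrow> nat" where T0: "cont_lin T0" "poly_dense_range T0" "\<And>n. mixing_on T0 (van (\<mu> n))"
    "\<And>n::nat. n \<in> range \<mu> \<or> van n = {0}" by blast
  obtain g :: "nat \<Rightarrow> 'a" where g: "van_dense (span (range g))" "T0 ` span (range g) \<subseteq> span (range g)"
    "\<And>v. v \<in> span (range g) \<Longrightarrow> v \<noteq> 0 \<Longrightarrow> hypercyclic_vec T0 v"
  proof (rule hypercyclic_subspace[OF T0])
    show "r n i \<in> van n" for n i by (rule r)
    show "\<exists>i. p m (r n i - x) < \<epsilon>" if "x \<in> van n" "\<epsilon> > 0" for n x m \<epsilon>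
      using that by (rule r)
  qed (rule that; assumption)
  obtain J L where J: "tame J" "tame L" "\<And>v. J (L v) = v" "\<And>v. L (J v) = v"
    "J ` span (range b) = span (range g)"
    using tame_isomorphism[OF refl dense refl g(1)] by metis
  note cJ = tame_cont_lin[OF J(1)] and cL = tame_cont_lin[OF J(2)]
  define T where "T v = L (T0 (J v))" for v
  have Tn: "(T ^^ n) v = L ((T0 ^^ n) (J v))" for n v
    by (induction n) (simp_all add: T_def J)
  show ?thesis
  proof (rule that[of T])
    show "cont_lin T"
      unfolding T_def[abs_def] by (rule cont_lin_comp[OF cL cont_lin_comp[OF T0(1) cJ]])
    show "T ` span (range b) \<subseteq> span (range b)"
    proof
      fix x assume "x \<in> T ` span (range b)"
      then obtain v where v: "v \<in> span (range b)" "x = L (T0 (J v))" by (auto simp: T_def)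
      then have "T0 (J v) \<in> J ` span (range b)" using g(2) J(5) by blast
      then show "x \<in> span (range b)" using v(2) J(4) by auto
    qed
    fix v assume v: "v \<in> span (range b)" "v \<noteq> 0"
    have "J v \<noteq> 0" using v(2) J(4) lin_zero[OF tame_lin[OF J(2)]] by metis
    then have hyp: "hypercyclic_vec T0 (J v)" using g(3) J(5) v(1) by blast
    show "hypercyclic_vec T v"
      unfolding hypercyclic_vec_def
    proof (intro allI impI)
      fix x m and \<epsilon> :: real assume "\<epsilon> > 0"
      then obtain n d where nd: "d > 0" "\<And>v. p n v < d \<Longrightarrow> p m (L v) < \<epsilon>"
        using cont_lin_small[OF cL] by metis
      obtain k where "p n ((T0 ^^ k) (J v) - J x) < d"
        using hyp nd(1) unfolding hypercyclic_vec_def by blast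
      then have "p m (L ((T0 ^^ k) (J v) - J x)) < \<epsilon>" by (rule nd(2))
      then have "p m ((T ^^ k) v - x) < \<epsilon>"
        by (simp add: Tn lin_diff[OF tame_lin[OF J(2)]] J(4))
      then show "\<exists>k. p m ((T ^^ k) v - x) < \<epsilon>" by blast
    qed
  qed
qed

end

section \<open>Dense subalgebras\<close>

context graded_frechet
begin

text \<open>Dropping the first \<open>N\<close> seminorms allows a norm among them, if there is one,
  to take the place of \<open>p 0\<close>.\<close>

lemma frechet_seminorms_shift: "frechet_seminorms smul (\<lambda>n. p (N + n))"
  unfolding frechet_seminorms_def
proof (intro conjI allI impI)
  show "seminorm smul (p (N + n))" for n by (rule p_seminorm)
  show "p (N + n) x \<le> p (N + Suc n) x" for n x by (rule p_mono) simp
  have le: "p n x \<le> p (N + n) x" for n x by (rule p_mono) simp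
  show "x = 0" if "\<forall>n. p (N + n) x = 0" for x
    using that le by (intro p_eq_0) (metis antisym p_nonneg)
  show "open U \<longleftrightarrow> (\<forall>x\<in>U. \<exists>n. \<exists>e>0. {y. p (N + n) (y - x) < e} \<subseteq> U)" for U
    unfolding open_iff
  proof (intro ball_cong refl iffI; elim exE conjE)
    fix x n and e :: real assume "e > 0" "{y. p n (y - x) < e} \<subseteq> U"
    moreover have "{y. p (N + n) (y - x) < e} \<subseteq> {y. p n (y - x) < e}"
      using le by (auto intro: le_less_trans)
    ultimately show "\<exists>n. \<exists>e>0. {y. p (N + n) (y - x) < e} \<subseteq> U" by blast
  qed blast
  show "\<exists>l. s \<longlonglongrightarrow> l" if "\<forall>n. \<forall>e>0. \<exists>M. \<forall>i\<ge>M. \<forall>j\<ge>M. p (N + n) (s i - s j) < e" for s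
  proof -
    have "\<forall>n. \<forall>e>0. \<exists>M. \<forall>i\<ge>M. \<forall>j\<ge>M. p n (s i - s j) < e"
      using that le by (meson le_less_trans)
    then show ?thesis using frechet unfolding frechet_seminorms_def by blast
  qed
qed

text \<open>Separability passes to the subspaces \<open>van n\<close>: in each ball around a point
  of a countable dense set, a point of \<open>van n\<close> is chosen whenever there is one.\<close>

lemma dense_sequences_exist:
  assumes "separable_space (euclidean :: 'a topology)"
  obtains r :: "nat \<Rightarrow> nat \<Rightarrow> 'a" where "\<And>n i. r n i \<in> van n"
    "\<And>n x m e. x \<in> van n \<Longrightarrow> e > 0 \<Longrightarrow> \<exists>i. p m (r n i - x) < e"
proof -
  obtain D :: "'a set" where D: "countable D" "closure D = UNIV"
    using assms by (auto simp: separable_space_def)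
  define q where "q = from_nat_into D"
  have "D \<noteq> {}" using D(2) by auto
  then have q: "range q = D" unfolding q_def using D(1) by (rule range_from_nat_into)
  have q_dense: "\<exists>i. p m (q i - x) < e" if "e > 0" for x m e
    using D(2) q that closure_iff[of x D] by auto
  define near where "near n m d j y \<longleftrightarrow> y \<in> van n \<and> p m (y - q d) < 1 / real (Suc j)" for n m d j y
  \<comment> \<open>The default 0 belongs to every \<open>van n\<close>.\<close>
  define pick where "pick n m d j = (if \<exists>y. near n m d j y then SOME y. near n m d j y else 0)" for n m d j
  define r where "r n i = (case prod_decode i of (m, i') \<Rightarrow> case prod_decode i' of (d, j) \<Rightarrow> pick n m d j)" for n i
  have near: "near n m d j (pick n m d j)" if "near n m d j y" for n m d j y
    using that unfolding pick_def by (metis someI)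
  have pick_van: "pick n m d j \<in> van n" for n m d j
  proof (cases "\<exists>y. near n m d j y")
    case True
    then show ?thesis using near near_def by blast
  next
    case False
    then show ?thesis using subspace_0[OF subspace_van] by (simp add: pick_def)
  qed
  show ?thesis
  proof (rule that[of r])
    show "r n i \<in> van n" for n i by (simp add: r_def pick_van split: prod.split)
    fix n x m and e :: real assume x: "x \<in> van n" and e: "e > 0"
    obtain j where j: "1 / real (Suc j) < e / 2" using nat_approx_posE[of "e / 2"] e by auto
    obtain d where d: "p m (q d - x) < 1 / real (Suc j)" using q_dense[of "1 / real (Suc j)"] by auto
    \<comment> \<open>\<open>x\<close> itself shows that this ball meets \<open>van n\<close>, so
      the chosen point is within twice the radius of \<open>x\<close>.\<close>
    have "near n m d j x" using x d by (simp add: near_def p_commute)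
    then have "p m (pick n m d j - q d) < 1 / real (Suc j)" using near by (auto simp: near_def)
    then have "p m (pick n m d j - x) < e"
      using d j p_triangle[of m "pick n m d j" x "q d"] by simp
    moreover have "r n (prod_encode (m, prod_encode (d, j))) = pick n m d j" by (simp add: r_def)
    ultimately show "\<exists>i. p m (r n i - x) < e" by metis
  qed
qed

text \<open>A finite set has a closed span, the kernel of a continuous projection; if dense, it
  would be the whole space.\<close>

lemma infinite_dense_span:
  assumes "van_dense (span B)" "infinite_dimensional smul"
  shows "infinite B"
proof
  assume B: "finite B"
  obtain P where P: "tame P" "\<And>v. v - P v \<in> span B" "\<And>b. b \<in> B \<Longrightarrow> P b = 0"
    using finite_projection[OF B] by metis
  note lP = lin_rules[OF tame_lin[OF P(1)]]
  have zero: "P a = 0" if "a \<in> span B" for a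
    using that by (induction rule: span_induct_alt) (auto simp: lP P(3))
  have "P v = 0" for v
  proof (rule p_eq_0, rule ccontr)
    fix m assume "p m (P v) \<noteq> 0"
    then have "p m (P v) > 0" using p_nonneg[of m "P v"] by linarith
    then obtain n d where nd: "d > 0" "\<And>w. p n w < d \<Longrightarrow> p m (P w) < p m (P v)"
      using cont_lin_small[OF tame_cont_lin[OF P(1)]] by metis
    have "v \<in> van 0" by simp
    then obtain a where a: "a \<in> span B" "p n (a - v) < d"
      using assms(1) nd(1) unfolding van_dense_def by blast
    have "P (a - v) = - P v" by (simp add: lP zero[OF a(1)])
    then show False using nd(2)[OF a(2)] by simp
  qed
  then have "span B = UNIV" using P(2) by fastforce
  then show False using B assms(2) by (auto simp: infinite_dimensional_def)
qed

end

primrec product_level :: "'a::ring set \<Rightarrow> nat \<Rightarrow> 'a set" where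
  "product_level D 0 = D"
| "product_level D (Suc n) = product_level D n \<union> (\<lambda>(x, y). x * y) ` (product_level D n \<times> product_level D n)"

lemma generated_semigroup_exists:
  fixes D :: "'a::ring set"
  assumes "countable D"
  obtains M where "countable M" "D \<subseteq> M" "\<And>x y. x \<in> M \<Longrightarrow> y \<in> M \<Longrightarrow> x * y \<in> M"
proof
  define M where "M = (\<Union>n. product_level D n)"
  have "countable (product_level D n)" for n
    by (induction n) (use assms in auto)
  then show "countable (\<Union>n. product_level D n)" by simp
  show "D \<subseteq> (\<Union>n. product_level D n)" using product_level.simps(1) by blast
  fix x y assume "x \<in> (\<Union>n. product_level D n)" "y \<in> (\<Union>n. product_level D n)"
  then obtain i j where "x \<in> product_level D i" "y \<in> product_level D j" by blast
  moreover have "product_level D i \<subseteq> product_level D j" if "i \<le> j" for i j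
    using that by (induction j rule: dec_induct) auto
  ultimately have "x \<in> product_level D (max i j)" "y \<in> product_level D (max i j)"
    by (meson max.cobounded1 max.cobounded2 subsetD)+
  then have "x * y \<in> product_level D (Suc (max i j))" by force
  then show "x * y \<in> (\<Union>n. product_level D n)" by blast
qed

lemma (in frechet_algebra) subalgebra_span:
  assumes "\<And>x y. x \<in> M \<Longrightarrow> y \<in> M \<Longrightarrow> x * y \<in> M"
  shows "subalgebra smul (span M)"
  unfolding subalgebra_def
proof (intro conjI ballI)
  show "subspace (span M)" by simp
  have *: "x * y \<in> span M" if "x \<in> M" "y \<in> span M" for x y
    using that(2)
  proof (induction rule: span_induct_alt)
    case (step c u v)
    then show ?case using assms[OF that(1)]
      by (simp add: distrib_left mult_smul_right span_add span_scale span_base)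
  qed (simp add: span_zero)
  fix x y assume "x \<in> span M" and y: "y \<in> span M"
  then show "x * y \<in> span M"
  proof (induction rule: span_induct_alt)
    case (step c u v)
    then show ?case using * y
      by (simp add: distrib_right mult_smul_left span_add span_scale)
  qed (simp add: span_zero)
qed

lemma dense_hypercyclic_algebra_exists:
  fixes smul :: "'k::real_normed_field \<Rightarrow> 'a::{ring,t2_space} \<Rightarrow> 'a"
  assumes alg: "frechet_algebra smul" and hb: "hahn_banach smul"
    and sep: "separable_space (euclidean :: 'a topology)" and inf: "infinite_dimensional smul"
  shows "\<exists>(T :: 'a \<Rightarrow> 'a) A. Vector_Spaces.linear smul smul T \<and> continuous_on UNIV T \<and>
    subalgebra smul A \<and> closure A = UNIV \<and> hamel_dim_aleph0 smul A \<and>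
    T ` A \<subseteq> A \<and> hypercyclic_algebra smul T A"
proof -
  interpret frechet_algebra smul by (rule alg)
  have "\<exists>p. graded_frechet smul p \<and>
    ((\<forall>x. p 0 x = 0 \<longrightarrow> x = 0) \<or> (\<forall>n. \<exists>x\<in>graded_frechet.van p n. x \<noteq> 0))"
  proof -
    obtain p where p: "frechet_seminorms smul p" using ex_frechet_seminorms by blast
    interpret graded_frechet smul p
      by (intro graded_frechet.intro graded_frechet_axioms.intro vector_space_axioms p hb)
    show ?thesis
    proof (cases "\<exists>N. \<forall>x. p N x = 0 \<longrightarrow> x = 0")
      case True
      then obtain N where N: "\<forall>x. p (N + 0) x = 0 \<longrightarrow> x = 0" by auto
      have "graded_frechet smul (\<lambda>n. p (N + n))"
        by (intro graded_frechet.intro graded_frechet_axioms.intro vector_space_axioms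
            frechet_seminorms_shift hb)
      with N show ?thesis by (intro exI[of _ "\<lambda>n. p (N + n)"]) simp
    next
      case False
      have "\<exists>x\<in>van n. x \<noteq> 0" for n
      proof -
        obtain x where x: "p n x = 0" "x \<noteq> 0" using False by blast
        have "p i x = 0" if "i < n" for i using p_mono[of i n x] x(1) that by (simp add: antisym)
        then show ?thesis using x(2) by (auto simp: van_def)
      qed
      then show ?thesis using graded_frechet_axioms by blast
    qed
  qed
  then obtain p where gf: "graded_frechet smul p"
    and alt: "(\<forall>x. p 0 x = 0 \<longrightarrow> x = 0) \<or> (\<forall>n. \<exists>x\<in>graded_frechet.van p n. x \<noteq> 0)"
    by (elim exE conjE) (rule that)
  interpret graded_frechet smul p by (rule gf)
  obtain r :: "nat \<Rightarrow> nat \<Rightarrow> 'a" where r: "\<And>n i. r n i \<in> van n"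
    "\<And>n x m e. x \<in> van n \<Longrightarrow> e > 0 \<Longrightarrow> \<exists>i. p m (r n i - x) < e"
    using dense_sequences_exist[OF sep] by metis
  have "countable (range (\<lambda>(n, i). r n i))" by simp
  \<comment> \<open>Closing all the dense sequences under products keeps them countable and makes
    their span an algebra.\<close>
  then obtain M where M: "countable M" "range (\<lambda>(n, i). r n i) \<subseteq> M"
    "\<And>x y. x \<in> M \<Longrightarrow> y \<in> M \<Longrightarrow> x * y \<in> M"
    using generated_semigroup_exists by metis
  \<comment> \<open>Products of the chosen vectors may be dependent; a maximal independent part of
    \<open>M\<close> has the same span and is the Hamel basis.\<close>
  obtain B where B: "B \<subseteq> M" "independent B" "M \<subseteq> span B"
    using maximal_independent_subset by metis
  have AB: "span B = span M" using B by (intro antisym span_minimal span_mono) auto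
  have dense: "van_dense (span B)"
    unfolding van_dense_def
  proof (intro allI ballI impI)
    fix n x m and e :: real assume "x \<in> van n" "e > 0"
    then obtain i where "p m (r n i - x) < e" using r(2) by blast
    moreover have "r n i \<in> span B" unfolding AB using M(2) by (intro span_base) auto
    ultimately show "\<exists>y\<in>span B \<inter> van n. p m (y - x) < e" using r(1) by blast
  qed
  have infB: "infinite B" using infinite_dense_span[OF dense inf] .
  have cB: "countable B" using B(1) M(1) countable_subset by blast
  define b where "b = from_nat_into B"
  have bij: "bij_betw b UNIV B" unfolding b_def using cB infB by (rule bij_betw_from_nat_into)
  then have b: "range b = B" "inj b" by (auto simp: bij_betw_def)
  obtain T where T: "cont_lin T" "T ` span B \<subseteq> span B"
    "\<And>v. v \<in> span B \<Longrightarrow> v \<noteq> 0 \<Longrightarrow> hypercyclic_vec T v"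
    using hypercyclic_invariant_subspace[of b, OF _ b(2) _ r alt] B(2) dense unfolding b(1) by metis
  have "closure (span B) = UNIV"
  proof -
    have "x \<in> closure (span B)" for x
      unfolding closure_iff
    proof (intro allI impI)
      fix m and e :: real assume "e > 0"
      moreover have "x \<in> van 0" by simp
      ultimately show "\<exists>y\<in>span B. p m (y - x) < e" using dense unfolding van_dense_def by blast
    qed
    then show ?thesis by blast
  qed
  moreover have "hamel_dim_aleph0 smul (span B)"
    unfolding hamel_dim_aleph0_def
  proof (intro exI[of _ B] conjI)
    show "B \<approx> (UNIV :: nat set)"
      by (rule eqpoll_sym) (use bij in \<open>auto simp: eqpoll_def\<close>)
  qed (use B(2) in auto)
  moreover have sub: "subalgebra smul (span B)" unfolding AB by (rule subalgebra_span[OF M(3)])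
  moreover have "hypercyclic_algebra smul T (span B)"
    unfolding hypercyclic_algebra_def
  proof (intro conjI sub)
    have "b 0 \<in> span B" "b 0 \<noteq> 0" using b(1) B(2) dependent_zero by (auto intro: span_base)
    then show "span B \<noteq> {0}" by blast
    show "span B - {0} \<subseteq> hypercyclic_vectors T"
    proof
      fix v assume "v \<in> span B - {0}"
      then have v: "hypercyclic_vec T v" using T(3) by blast
      have "x \<in> closure (orbit T v)" for x
        using v unfolding closure_iff hypercyclic_vec_def orbit_def by blast
      then show "v \<in> hypercyclic_vectors T" by (auto simp: hypercyclic_vectors_def)
    qed
  qed
  ultimately show ?thesis
    using T(2) cont_lin_lin[OF T(1)] cont_lin_continuous[OF T(1)] by blast
qed

theorem theorem1p1:
  fixes smulR :: "real \<Rightarrow> 'a::{ring,t2_space} \<Rightarrow> 'a"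
    and smulC :: "complex \<Rightarrow> 'b::{ring,t2_space} \<Rightarrow> 'b"
  shows "(frechet_algebra smulR \<and> separable_space (euclidean :: 'a topology) \<and>
            infinite_dimensional smulR \<longrightarrow>
          (\<exists>(T :: 'a \<Rightarrow> 'a) A. Vector_Spaces.linear smulR smulR T \<and> continuous_on UNIV T \<and>
             subalgebra smulR A \<and> closure A = UNIV \<and> hamel_dim_aleph0 smulR A \<and>
             T ` A \<subseteq> A \<and> hypercyclic_algebra smulR T A))
       \<and> (frechet_algebra smulC \<and> separable_space (euclidean :: 'b topology) \<and>
            infinite_dimensional smulC \<longrightarrow>
          (\<exists>(T :: 'b \<Rightarrow> 'b) A. Vector_Spaces.linear smulC smulC T \<and> continuous_on UNIV T \<and>
             subalgebra smulC A \<and> closure A = UNIV \<and> hamel_dim_aleph0 smulC A \<and>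
             T ` A \<subseteq> A \<and> hypercyclic_algebra smulC T A))"
proof (intro conjI impI; elim conjE)
  assume R: "frechet_algebra smulR"
  then have "vector_space smulR" by (simp add: frechet_algebra_def frechet_space_def)
  note dense_hypercyclic_algebra_exists[OF R hahn_banach_real[OF this]]
  then show "separable_space (euclidean :: 'a topology) \<Longrightarrow> infinite_dimensional smulR \<Longrightarrow>
    \<exists>(T :: 'a \<Rightarrow> 'a) A. Vector_Spaces.linear smulR smulR T \<and> continuous_on UNIV T \<and>
      subalgebra smulR A \<and> closure A = UNIV \<and> hamel_dim_aleph0 smulR A \<and>
      T ` A \<subseteq> A \<and> hypercyclic_algebra smulR T A" .
next
  assume C: "frechet_algebra smulC"
  then have "vector_space smulC" by (simp add: frechet_algebra_def frechet_space_def)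
  note dense_hypercyclic_algebra_exists[OF C hahn_banach_complex[OF this]]
  then show "separable_space (euclidean :: 'b topology) \<Longrightarrow> infinite_dimensional smulC \<Longrightarrow>
    \<exists>(T :: 'b \<Rightarrow> 'b) A. Vector_Spaces.linear smulC smulC T \<and> continuous_on UNIV T \<and>
      subalgebra smulC A \<and> closure A = UNIV \<and> hamel_dim_aleph0 smulC A \<and>
      T ` A \<subseteq> A \<and> hypercyclic_algebra smulC T A" .
qed

end
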